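(* Let $H_1$ be an apex-forest and $H_2$ an outerplanar graph, and let $\ell:=\max\{|V(H_1)|,|V(H_2)|,2\}-1$. Then every $2$-connected graph $G$ of pathwidth at least $2^{9\ell^2 - 3\ell +2}-2$ contains $H_1$ or $H_2$ as a minor.
   Context: All graphs are finite and simple. A graph $H$ is an apex-forest if $H-v$ is a forest for some $v\in V(H)$. A graph is outerplanar if it has a plane embedding with all vertices on the outer face. The pathwidth of $G$ is the minimum $k$ such that there are sets $B_1,\dots,B_n\subseteq V(G)$ with $|B_i|\le k+1$, each vertex lying in a non-empty interval of consecutive $B_i$'s, and each edge contained in some $B_i$. *)

theory Defs
  imports "HOL-Analysis.Analysis" "Graph_Theory.Graph_Theory"
begin

text \<open>
  Finite simple graphs are the symmetric digraphs of the locale \<^locale>\<open>graph\<close>: finite, without loops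
  and without parallel arcs, an undirected edge \<open>uv\<close> being the pair of arcs \<open>(u, v)\<close>, \<open>(v, u)\<close>.
\<close>

definition undirected_edges :: "('a, 'b) pre_digraph \<Rightarrow> 'a set set" where
  "undirected_edges G = {{u, v} |u v. u \<rightarrow>\<^bsub>G\<^esub> v}"

text \<open>
  The library's \<^const>\<open>forest\<close> is not usable here: in a symmetric digraph the closed walk \<open>u, v, u\<close>
  along one edge counts as a \<^const>\<open>pre_digraph.cycle\<close>. The cycles of length at least 3 are
  exactly the cycles of the underlying undirected simple graph.
\<close>

definition undirected_forest :: "('a, 'b) pre_digraph \<Rightarrow> bool" where
  "undirected_forest G \<longleftrightarrow> \<not> (\<exists>p. pre_digraph.cycle G p \<and> 3 \<le> length p)"

definition apex_forest :: "('a, 'b) pre_digraph \<Rightarrow> bool" where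
  "apex_forest G \<longleftrightarrow> (\<exists>v \<in> verts G. undirected_forest (pre_digraph.del_vert G v))"

definition two_connected :: "('a, 'b) pre_digraph \<Rightarrow> bool" where
  "two_connected G \<longleftrightarrow>
     2 < card (verts G) \<and> Digraph_Component.connected G \<and>
     (\<forall>v \<in> verts G. Digraph_Component.connected (pre_digraph.del_vert G v))"

text \<open>
  In a plane embedding the vertex \<open>v\<close> is drawn as the point \<open>p v\<close> and the undirected edge \<open>e\<close> as the
  arc \<open>\<gamma> e\<close>, whose interior is the path image without \<open>p ` e\<close>.
\<close>

definition plane_embedding ::
    "('a, 'b) pre_digraph \<Rightarrow> ('a \<Rightarrow> complex) \<Rightarrow> ('a set \<Rightarrow> real \<Rightarrow> complex) \<Rightarrow> bool" where
  "plane_embedding G p \<gamma> \<longleftrightarrow>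
     inj_on p (verts G) \<and>
     (\<forall>e \<in> undirected_edges G.
        arc (\<gamma> e) \<and> {pathstart (\<gamma> e), pathfinish (\<gamma> e)} = p ` e \<and>
        (path_image (\<gamma> e) - p ` e) \<inter> p ` verts G = {}) \<and>
     (\<forall>e \<in> undirected_edges G. \<forall>f \<in> undirected_edges G. e \<noteq> f \<longrightarrow>
        (path_image (\<gamma> e) - p ` e) \<inter> path_image (\<gamma> f) = {})"

definition drawing ::
    "('a, 'b) pre_digraph \<Rightarrow> ('a \<Rightarrow> complex) \<Rightarrow> ('a set \<Rightarrow> real \<Rightarrow> complex) \<Rightarrow> complex set" where
  "drawing G p \<gamma> = p ` verts G \<union> (\<Union>e \<in> undirected_edges G. path_image (\<gamma> e))"

text \<open>
  Faces are the components of the complement of the drawing. The drawing is compact, so exactly one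
  of them is unbounded; a vertex lies on it if it belongs to its frontier.
\<close>

definition outerplanar :: "('a, 'b) pre_digraph \<Rightarrow> bool" where
  "outerplanar G \<longleftrightarrow>
     (\<exists>p \<gamma>. plane_embedding G p \<gamma> \<and>
        (\<exists>F \<in> components (- drawing G p \<gamma>). \<not> bounded F \<and> p ` verts G \<subseteq> frontier F))"

definition path_decomposition :: "('a, 'b) pre_digraph \<Rightarrow> 'a set list \<Rightarrow> bool" where
  "path_decomposition G Bs \<longleftrightarrow>
     (\<forall>B \<in> set Bs. B \<subseteq> verts G) \<and>
     (\<forall>v \<in> verts G. \<exists>i j. i \<le> j \<and> {k. k < length Bs \<and> v \<in> Bs ! k} = {i..j}) \<and>
     (\<forall>u v. u \<rightarrow>\<^bsub>G\<^esub> v \<longrightarrow> (\<exists>B \<in> set Bs. u \<in> B \<and> v \<in> B))"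

definition pathwidth :: "('a, 'b) pre_digraph \<Rightarrow> nat" where
  "pathwidth G = (LEAST k. \<exists>Bs. path_decomposition G Bs \<and> (\<forall>B \<in> set Bs. card B \<le> k + 1))"

text \<open>
  \<open>H\<close> is a minor of \<open>G\<close> if there are branch sets \<open>\<mu> x\<close> for \<open>x \<in> V(H)\<close>, to be contracted to single
  vertices: disjoint, each inducing a connected (in particular non-empty) subgraph of \<open>G\<close>, with an
  edge of \<open>G\<close> between \<open>\<mu> x\<close> and \<open>\<mu> y\<close> for every edge \<open>xy\<close> of \<open>H\<close>.
\<close>

definition is_minor :: "('a, 'b) pre_digraph \<Rightarrow> ('c, 'd) pre_digraph \<Rightarrow> bool" where
  "is_minor H G \<longleftrightarrow>
     (\<exists>\<mu>. (\<forall>x \<in> verts H. \<mu> x \<subseteq> verts G \<and> Digraph_Component.connected (G \<restriction> \<mu> x)) \<and>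
          disjoint_family_on \<mu> (verts H) \<and>
          (\<forall>x y. x \<rightarrow>\<^bsub>H\<^esub> y \<longrightarrow> (\<exists>u \<in> \<mu> x. \<exists>v \<in> \<mu> y. u \<rightarrow>\<^bsub>G\<^esub> v)))"

end

theory Submission
  imports Defs "HOL-Complex_Analysis.Winding_Numbers"
begin

text \<open>
  A graph of large pathwidth contains a complete binary tree of large height as a minor, by Diestel's
  argument with Menger's theorem. Cut the tree into nested pairs of disjoint connected branches. Since
  \<open>G\<close> is 2-connected, every branch has two disjoint connections to the outside, leading to two hubs
  \<open>P\<close> and \<open>Q\<close>, and a pair of sub-branches can be chosen that lies either in parallel or in series
  between the hubs. By induction on the nesting depth, parallel pairs double a binary tree that is rooted
  at one hub and whose leaves all see the other hub, and series pairs glue a triangle onto every outer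
  edge of a triangulated polygon. A deep tree contains every small apex-forest, with the hub as the
  apex, and a large triangulation contains every small graph whose vertices have a linear order
  without crossing edges.

  An outerplanar graph has such an order. By the Jordan curve theorem, a plane drawing with all vertices
  on the outer face contains neither three internally disjoint paths of length at least two with
  common ends nor two crossing chords of a cycle. By the first property its 2-connected subgraphs that
  cannot be split further have Hamiltonian cycles, by the second the cyclic order is non-crossing,
  and such orders are glued along cut vertices.
\<close>

text \<open>The obstacle is that a pair of branches need not be cleanly parallel or in series: one
  branch can hang between two parts while the other sees all three. Two such pendant pairs, one
  nested in a branch of the other, always yield a clean pair, so a clean pair costs two levels of
  nesting. Moreover a parallel pair guarantees a connected new root at only one of the hubs. The
  induction therefore runs on three counters: the height \<open>i\<close> of a tree rooted at
  \<open>P\<close>, the height \<open>j\<close> of a tree rooted at \<open>Q\<close>, and the stage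
  \<open>s\<close> of a triangulation; each clean pair pays for one step of one counter. With
  \<open>d = l - 1\<close> the goals are \<open>i = j = d\<close> and \<open>s = 2 * d\<close>,
  because a layer of triangles takes two series pairs, one for the outer edges and one for the
  triangles on them. This makes \<open>4 * d\<close> pairs and \<open>8 * d\<close> levels of
  nesting. One level is bought with \<open>Suc d\<close> levels of the binary tree: \<open>d\<close>
  levels below a node either form an apex tree against the rest of the graph or contain a way down
  to a subtree that the rest does not touch. This is why the exponent is quadratic in
  \<open>l\<close>.\<close>

section \<open>Menger's theorem\<close>

definition walk :: "('a \<times> 'a) set \<Rightarrow> 'a list \<Rightarrow> bool" where
  "walk R p \<longleftrightarrow> p \<noteq> [] \<and> successively (\<lambda>x y. (x, y) \<in> R) p"

definition separates :: "('a \<times> 'a) set \<Rightarrow> 'a set \<Rightarrow> 'a set \<Rightarrow> 'a set \<Rightarrow> bool" where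
  "separates R A B S \<longleftrightarrow> (\<forall>p. walk R p \<and> hd p \<in> A \<and> last p \<in> B \<longrightarrow> set p \<inter> S \<noteq> {})"

lemma walk_append:
  "walk R p \<Longrightarrow> walk R q \<Longrightarrow> (last p, hd q) \<in> R \<Longrightarrow> walk R (p @ q)"
  by (auto simp: walk_def successively_append_iff)

lemma walk_prefix: "walk R (p @ q) \<Longrightarrow> p \<noteq> [] \<Longrightarrow> walk R p"
  by (auto simp: walk_def successively_append_iff)

lemma walk_suffix: "walk R (p @ q) \<Longrightarrow> q \<noteq> [] \<Longrightarrow> walk R q"
  by (auto simp: walk_def successively_append_iff)

lemma walk_mono: "walk R p \<Longrightarrow> R \<subseteq> R' \<Longrightarrow> walk R' p"
  unfolding walk_def by (metis (mono_tags, lifting) successively_mono subsetD)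

lemma walk_join:
  assumes "walk R (p @ [v])" "walk R (v # q)" shows "walk R (p @ v # q)"
  using assms by (auto simp: walk_def successively_append_iff)

lemma walk_avoiding_arc:
  assumes "walk (insert (x, y) R) p" "\<And>q r. p = q @ x # y # r \<Longrightarrow> False"
  shows "walk R p"
  using assms
proof (induction p)
  case Nil then show ?case by (simp add: walk_def)
next
  case (Cons a p)
  show ?case
  proof (cases p)
    case Nil then show ?thesis by (simp add: walk_def)
  next
    case (Cons b p')
    have "walk (insert (x, y) R) p"
      using Cons.prems(1) Cons by (auto simp: walk_def)
    moreover have "\<And>q r. p = q @ x # y # r \<Longrightarrow> False"
      using Cons.prems(2) by (metis append_Cons)
    ultimately have "walk R p" using Cons.IH by blast
    moreover have "(a, b) \<in> R"
      using Cons.prems(1) Cons.prems(2)[of "[]" p'] Cons by (auto simp: walk_def)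
    ultimately show ?thesis using Cons by (auto simp: walk_def)
  qed
qed

lemma set_tl: "set (tl xs) \<subseteq> set xs"
  by (cases xs) auto

text \<open>Goering's induction on the number of arcs.\<close>

theorem menger:
  fixes R :: "('a \<times> 'a) set"
  assumes "finite R" "finite A" "\<And>S. finite S \<Longrightarrow> separates R A B S \<Longrightarrow> k \<le> card S"
  shows "\<exists>P. finite P \<and> card P = k \<and>
    (\<forall>p\<in>P. walk R p \<and> distinct p \<and> hd p \<in> A \<and> last p \<in> B) \<and>
    (\<forall>p\<in>P. \<forall>q\<in>P. p \<noteq> q \<longrightarrow> set p \<inter> set q = {})"
  using assms
proof (induction "card R" arbitrary: R A B rule: less_induct)
  case less
  let ?M = "\<lambda>R A B P. finite P \<and> card P = k \<and>
    (\<forall>p\<in>P. walk R p \<and> distinct p \<and> hd p \<in> A \<and> last p \<in> B) \<and>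
    (\<forall>p\<in>P. \<forall>q\<in>P. p \<noteq> q \<longrightarrow> set p \<inter> set q = {})"
  show ?case
  proof (cases "R = {}")
    case True
    have "separates R A B (A \<inter> B)"
      unfolding separates_def
    proof (intro allI impI)
      fix p assume p: "walk R p \<and> hd p \<in> A \<and> last p \<in> B"
      then have "length p = 1"
        using True by (cases p rule: remdups_adj.cases) (auto simp: walk_def)
      then show "set p \<inter> (A \<inter> B) \<noteq> {}" using p by (cases p) auto
    qed
    then have "k \<le> card (A \<inter> B)" using less.prems by auto
    then obtain C where C: "C \<subseteq> A \<inter> B" "card C = k" "finite C"
      by (meson obtain_subset_with_card_n)
    have "card ((\<lambda>x. [x]) ` C) = k"
      using C by (simp add: card_image inj_on_def)
    then show ?thesis
      using C by (intro exI[of _ "(\<lambda>x. [x]) ` C"]) (auto simp: walk_def)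
  next
    case False
    then obtain x y where xy: "(x, y) \<in> R" by auto
    define R' where "R' = R - {(x, y)}"
    have RR': "R = insert (x, y) R'" "(x, y) \<notin> R'" "finite R'" "card R' < card R"
      using xy less.prems(1) card_Diff1_less[of R "(x, y)"] by (auto simp: R'_def simp del: card_Diff_insert)
    have R'R: "R' \<subseteq> R" by (simp add: R'_def)
    show ?thesis
    proof (cases "\<forall>S. finite S \<longrightarrow> separates R' A B S \<longrightarrow> k \<le> card S")
      case True
      have "\<exists>P. ?M R' A B P"
        by (rule less.hyps[OF RR'(4) RR'(3) less.prems(2)]) (use True in blast)
      then obtain P where "?M R' A B P" ..
      then have "?M R A B P" using walk_mono[OF _ R'R] by simp
      then show ?thesis ..
    next
      case False
      \<comment> \<open>Adding either end of the deleted arc to \<open>S\<close> gives a separator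
        for the full relation, so both extended sets have exactly \<open>k\<close> elements and can
        serve as targets for the induction hypothesis.\<close>
      then obtain S where S: "finite S" "separates R' A B S" "card S < k" by auto
      have hit: "set p \<inter> insert v S \<noteq> {}"
        if p: "walk R p" "hd p \<in> A" "last p \<in> B" and v: "v = x \<or> v = y" for p v
      proof (cases "walk R' p")
        case True then show ?thesis using S(2) p unfolding separates_def by blast
      next
        case False
        then obtain q r where "p = q @ x # y # r"
          using walk_avoiding_arc[of x y R' p] p(1) RR'(1) by blast
        then show ?thesis using v by auto
      qed
      then have sepx: "separates R A B (insert x S)" and sepy: "separates R A B (insert y S)"
        by (auto simp: separates_def)
      have "k \<le> card (insert x S)" "k \<le> card (insert y S)"
        using less.prems(3) sepx sepy S(1) by auto
      then have xS: "x \<notin> S" "card (insert x S) = k" and yS: "y \<notin> S" "card (insert y S) = k"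
        using S by (auto simp: card_insert_if split: if_splits)
      \<comment> \<open>A set separating \<open>A\<close> from \<open>insert x S\<close> without the
        arc also separates \<open>A\<close> from \<open>B\<close> with it: a walk cut at its first
        vertex in \<open>insert x S\<close> cannot have used the arc, which would put
        \<open>x\<close> before the cut.\<close>
      have Pge: "k \<le> card C" if C: "finite C" "separates R' A (insert x S) C" for C
      proof (rule less.prems(3)[OF C(1)], unfold separates_def, intro allI impI)
        fix p assume p: "walk R p \<and> hd p \<in> A \<and> last p \<in> B"
        then have "\<exists>v\<in>set p. v \<in> insert x S" using hit by blast
        then obtain q v r where q: "p = q @ v # r" "v \<in> insert x S" "\<forall>u\<in>set q. u \<notin> insert x S"
          using split_list_first_prop[of p "\<lambda>v. v \<in> insert x S"] by auto
        have w: "walk R (q @ [v])" using walk_prefix[of R "q @ [v]" r] p q(1) by simp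
        have "walk R' (q @ [v])"
        proof (rule walk_avoiding_arc[of x y])
          show "walk (insert (x, y) R') (q @ [v])" using w RR'(1) by simp
          fix q' r' assume "q @ [v] = q' @ x # y # r'"
          then have "q = butlast (q' @ x # y # r')" by (metis butlast_snoc)
          then have "x \<in> set q" by (simp add: butlast_append)
          then show False using q(3) by auto
        qed
        moreover have "hd (q @ [v]) \<in> A" using p q(1) by (cases q) auto
        ultimately have "set (q @ [v]) \<inter> C \<noteq> {}"
          using C(2) q(2) unfolding separates_def by (metis last_snoc)
        then show "set p \<inter> C \<noteq> {}" using q(1) by auto
      qed
      have "\<exists>P. ?M R' A (insert x S) P"
        by (rule less.hyps[OF RR'(4) RR'(3) less.prems(2) Pge])
      then obtain P where P: "finite P" "card P = k"
        "\<And>p. p \<in> P \<Longrightarrow> walk R' p \<and> distinct p \<and> hd p \<in> A \<and> last p \<in> insert x S"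
        "\<And>p q. p \<in> P \<Longrightarrow> q \<in> P \<Longrightarrow> p \<noteq> q \<Longrightarrow> set p \<inter> set q = {}"
        by auto
      have Qge: "k \<le> card C" if C: "finite C" "separates R' (insert y S) B C" for C
      proof (rule less.prems(3)[OF C(1)], unfold separates_def, intro allI impI)
        fix p assume p: "walk R p \<and> hd p \<in> A \<and> last p \<in> B"
        then have "\<exists>v\<in>set p. v \<in> insert y S" using hit by blast
        then obtain q v r where q: "p = q @ v # r" "v \<in> insert y S" "\<forall>u\<in>set r. u \<notin> insert y S"
          using split_list_last_prop[of p "\<lambda>v. v \<in> insert y S"] by auto
        have w: "walk R (v # r)" using walk_suffix[of R q "v # r"] p q(1) by simp
        have "walk R' (v # r)"
        proof (rule walk_avoiding_arc[of x y])
          show "walk (insert (x, y) R') (v # r)" using w RR'(1) by simp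
          fix q' r' assume "v # r = q' @ x # y # r'"
          then have "y \<in> set r" by (cases q') auto
          then show False using q(3) by auto
        qed
        moreover have "last (v # r) \<in> B" using p q(1) by auto
        ultimately have "set (v # r) \<inter> C \<noteq> {}"
          using C(2) q(2) unfolding separates_def by (metis list.sel(1))
        then show "set p \<inter> C \<noteq> {}" using q(1) by auto
      qed
      have "\<exists>P. ?M R' (insert y S) B P"
        by (rule less.hyps[OF RR'(4) RR'(3) _ Qge]) (use S(1) in simp)
      then obtain Q where Q: "finite Q" "card Q = k"
        "\<And>p. p \<in> Q \<Longrightarrow> walk R' p \<and> distinct p \<and> hd p \<in> insert y S \<and> last p \<in> B"
        "\<And>p q. p \<in> Q \<Longrightarrow> q \<in> Q \<Longrightarrow> p \<noteq> q \<Longrightarrow> set p \<inter> set q = {}"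
        by auto
      have ne: "p \<noteq> []" if "p \<in> P \<union> Q" for p using that P(3) Q(3) by (auto simp: walk_def)
      have eqP: "p = p'" if "p \<in> P" "p' \<in> P" "v \<in> set p" "v \<in> set p'" for p p' v
        using P(4)[OF that(1,2)] that(3,4) by blast
      have eqQ: "p = p'" if "p \<in> Q" "p' \<in> Q" "v \<in> set p" "v \<in> set p'" for p p' v
        using Q(4)[OF that(1,2)] that(3,4) by blast
      have lastp: "last p \<in> set p" if "p \<in> P" for p using that ne by auto
      have hdq: "hd p \<in> set p" if "p \<in> Q" for p using that ne by auto
      have injP: "inj_on last P"
        by (rule inj_onI) (metis eqP lastp)
      have injQ: "inj_on hd Q"
        by (rule inj_onI) (metis eqQ hdq)
      have lastP: "last ` P = insert x S"
      proof (rule card_subset_eq)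
        show "card (last ` P) = card (insert x S)" using card_image[OF injP] P(2) xS(2) by simp
      qed (use P(3) S(1) in auto)
      have hdQ: "hd ` Q = insert y S"
      proof (rule card_subset_eq)
        show "card (hd ` Q) = card (insert y S)" using card_image[OF injQ] Q(2) yS(2) by simp
      qed (use Q(3) S(1) in auto)
      define p where "p s = inv_into P last s" for s
      define q where "q s = inv_into Q hd s" for s
      have p: "p s \<in> P" "last (p s) = s" if "s \<in> insert x S" for s
        unfolding p_def using that lastP inv_into_into[of s last P] f_inv_into_f[of s last P] by simp_all
      have q: "q s \<in> Q" "hd (q s) = s" if "s \<in> insert y S" for s
        unfolding q_def using that hdQ inv_into_into[of s hd Q] f_inv_into_f[of s hd Q] by simp_all
      have onlyP: "v = s" if "s \<in> insert x S" "v \<in> set (p s)" "v \<in> insert x S" for s v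
        using eqP[OF p(1)[OF that(1)] p(1)[OF that(3)] that(2)] lastp[OF p(1)[OF that(3)]] p(2)[OF that(1)] p(2)[OF that(3)]
        by simp
      have onlyQ: "v = s" if "s \<in> insert y S" "v \<in> set (q s)" "v \<in> insert y S" for s v
        using eqQ[OF q(1)[OF that(1)] q(1)[OF that(3)] that(2)] hdq[OF q(1)[OF that(3)]] q(2)[OF that(1)] q(2)[OF that(3)]
        by simp
      \<comment> \<open>At a common vertex outside \<open>S\<close>, the beginning of
        \<open>p s\<close> and the end of \<open>q t\<close> would form an
        \<open>A\<close>-\<open>B\<close> walk without the arc. It would have to meet
        \<open>S\<close>, but the paths touch their separators only at \<open>s\<close> and
        \<open>t\<close>, which lie on the discarded pieces.\<close>
      have meet: "v \<in> S \<and> v = s \<and> v = t"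
        if st: "s \<in> insert x S" "t \<in> insert y S" and v: "v \<in> set (p s)" "v \<in> set (q t)" for s t v
      proof (cases "v \<in> S")
        case True then show ?thesis using onlyP onlyQ st v by blast
      next
        case False
        obtain a b where ab: "p s = a @ v # b" using v(1) by (meson split_list)
        obtain c d where cd: "q t = c @ v # d" using v(2) by (meson split_list)
        have dist: "distinct (p s)" "distinct (q t)"
          using P(3)[OF p(1)[OF st(1)]] Q(3)[OF q(1)[OF st(2)]] by simp_all
        have "walk R' (p s)" "walk R' (q t)"
          using P(3)[OF p(1)[OF st(1)]] Q(3)[OF q(1)[OF st(2)]] by simp_all
        then have "walk R' (a @ [v])" "walk R' (v # d)"
          using walk_prefix[of R' "a @ [v]" b] walk_suffix[of R' c "v # d"] unfolding ab cd by simp_all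
        then have "walk R' (a @ v # d)" by (rule walk_join)
        moreover have "hd (a @ v # d) \<in> A"
          using P(3)[OF p(1)[OF st(1)]] ab by (cases a) auto
        moreover have "last (a @ v # d) \<in> B"
          using Q(3)[OF q(1)[OF st(2)]] cd by auto
        ultimately obtain u where u: "u \<in> set (a @ v # d)" "u \<in> S"
          using S(2) unfolding separates_def by blast
        then consider "u \<in> set a" | "u \<in> set d" using False by auto
        then have False
        proof cases
          case 1
          then have "u = s" using onlyP[OF st(1), of u] ab u(2) by auto
          moreover have "last (p s) \<in> set (v # b)" using ab by auto
          ultimately show False using p(2)[OF st(1)] dist(1) ab 1 by auto
        next
          case 2
          then have "u = t" using onlyQ[OF st(2), of u] cd u(2) by auto
          moreover have "hd (q t) \<in> set (c @ [v])" using cd by (cases c) auto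
          ultimately show False using q(2)[OF st(2)] dist(2) cd 2 by auto
        qed
        then show ?thesis ..
      qed
      \<comment> \<open>The deleted arc joins the path ending in \<open>x\<close> to the path
        starting in \<open>y\<close>; all other paths are joined at their common vertex in
        \<open>S\<close>.\<close>
      define f where "f s = (if s = x then p x @ q y else p s @ tl (q s))" for s
      have set_f: "set (f s) \<subseteq> set (p s) \<union> set (q (if s = x then y else s))" for s
        using set_tl[of "q s"] by (auto simp: f_def)
      have idx: "(if s = x then y else s) \<in> insert y S" if "s \<in> insert x S" for s using that by auto
      have f_ok: "walk R (f s) \<and> distinct (f s) \<and> hd (f s) \<in> A \<and> last (f s) \<in> B"
        if s: "s \<in> insert x S" for s
      proof (cases "s = x")
        case True
        have "set (p x) \<inter> set (q y) = {}" using meet[of x y] xS by blast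
        moreover have "walk R (p x @ q y)"
        proof (rule walk_append)
          show "walk R (p x)" "walk R (q y)"
            using P(3)[OF p(1)[of x]] Q(3)[OF q(1)[of y]] walk_mono[OF _ R'R] by simp_all
          show "(last (p x), hd (q y)) \<in> R" using p(2)[of x] q(2)[of y] xy by simp
        qed
        ultimately show ?thesis
          using True P(3)[OF p(1)[of x]] Q(3)[OF q(1)[of y]] ne[of "p x"] ne[of "q y"] p(1)[of x] q(1)[of y]
          by (simp add: f_def)
      next
        case False
        then have sS: "s \<in> S" "s \<in> insert y S" using s by auto
        obtain c where c: "q s = s # c"
          using q[OF sS(2)] ne[of "q s"] by (cases "q s") auto
        obtain a where a: "p s = a @ [s]"
          using p[OF s] ne[of "p s"] by (cases "p s" rule: rev_cases) auto
        have "walk R' (a @ s # c)"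
          using P(3)[OF p(1)[OF s]] Q(3)[OF q(1)[OF sS(2)]] unfolding a c by (simp add: walk_join)
        moreover have "set (p s) \<inter> set c = {}"
        proof -
          have "distinct (q s)" using Q(3)[OF q(1)[OF sS(2)]] by simp
          then have "s \<notin> set c" by (simp add: c)
          then show ?thesis using meet[OF s sS(2)] unfolding c by auto
        qed
        moreover have "distinct (p s)" "distinct (q s)" "hd (p s) \<in> A" "last (q s) \<in> B"
          using P(3)[OF p(1)[OF s]] Q(3)[OF q(1)[OF sS(2)]] by auto
        ultimately show ?thesis
          using False walk_mono[OF _ R'R, of "a @ s # c"] unfolding f_def a c by (auto simp: hd_append split: if_splits)
      qed
      have f_disj: "set (f s) \<inter> set (f t) = {}" if s: "s \<in> insert x S" and t: "t \<in> insert x S" and "s \<noteq> t" for s t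
      proof -
        let ?n = "\<lambda>s. if s = x then y else s"
        have n: "?n s \<noteq> ?n t" using that yS(1) by auto
        have "set (p s) \<inter> set (p t) = {}"
          using P(4)[OF p(1)[OF s] p(1)[OF t]] p(2)[OF s] p(2)[OF t] \<open>s \<noteq> t\<close> by metis
        moreover have "set (q (?n s)) \<inter> set (q (?n t)) = {}"
          using Q(4)[OF q(1)[OF idx[OF s]] q(1)[OF idx[OF t]]] q(2)[OF idx[OF s]] q(2)[OF idx[OF t]] n by metis
        moreover have cross: "set (p a) \<inter> set (q (?n b)) = {}"
          if ab: "a \<in> insert x S" "b \<in> insert x S" "a \<noteq> b" for a b
        proof (rule ccontr)
          assume "set (p a) \<inter> set (q (?n b)) \<noteq> {}"
          then obtain v where "v \<in> set (p a)" "v \<in> set (q (?n b))" by blast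
          from meet[OF ab(1) idx[OF ab(2)] this] have "v \<in> S" "v = a" "v = ?n b" by blast+
          then show False using ab(3) yS(1) by (cases "b = x") auto
        qed
        ultimately have "set (p s) \<inter> set (p t) = {}" "set (q (?n s)) \<inter> set (q (?n t)) = {}"
          "set (p s) \<inter> set (q (?n t)) = {}" "set (p t) \<inter> set (q (?n s)) = {}"
          using cross[OF s t] cross[OF t s] \<open>s \<noteq> t\<close> by simp_all
        then show ?thesis using set_f[of s] set_f[of t] by blast
      qed
      have "inj_on f (insert x S)"
      proof (rule inj_onI, rule ccontr)
        fix s t assume st: "s \<in> insert x S" "t \<in> insert x S" "f s = f t" "s \<noteq> t"
        then have "f s = []" using f_disj[OF st(1,2,4)] by simp
        then show False using f_ok[OF st(1)] by (simp add: walk_def)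
      qed
      then have "card (f ` insert x S) = k" using xS(2) card_image by blast
      then show ?thesis
        using f_ok f_disj S(1) by (intro exI[of _ "f ` insert x S"]) auto
    qed
  qed
qed

section \<open>Connected vertex sets\<close>

locale sym_rel =
  fixes E :: "'a \<Rightarrow> 'a \<Rightarrow> bool"
  assumes sym: "E u v \<Longrightarrow> E v u"
begin

definition adj :: "'a set \<Rightarrow> 'a set \<Rightarrow> bool" where
  "adj X Y \<longleftrightarrow> (\<exists>x\<in>X. \<exists>y\<in>Y. E x y)"

text \<open>Stated through cuts because most arguments below extract an edge that leaves a given
  part; \<open>conn_path\<close> recovers paths.\<close>

definition conn :: "'a set \<Rightarrow> bool" where
  "conn X \<longleftrightarrow> X \<noteq> {} \<and> (\<forall>Y. Y \<subseteq> X \<longrightarrow> Y \<noteq> {} \<longrightarrow> Y \<noteq> X \<longrightarrow> adj Y (X - Y))"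

definition nbrs :: "'a set \<Rightarrow> 'a set" where
  "nbrs X = {v. v \<notin> X \<and> (\<exists>u\<in>X. E u v)}"

definition component :: "'a set \<Rightarrow> 'a \<Rightarrow> 'a set" where
  "component X c = \<Union>{Y. Y \<subseteq> X \<and> conn Y \<and> c \<in> Y}"

lemma adj_sym: "adj X Y \<longleftrightarrow> adj Y X"
  unfolding adj_def using sym by blast

lemma adj_mono: "adj X Y \<Longrightarrow> X \<subseteq> X' \<Longrightarrow> Y \<subseteq> Y' \<Longrightarrow> adj X' Y'"
  unfolding adj_def by blast

lemma adjI: "x \<in> X \<Longrightarrow> y \<in> Y \<Longrightarrow> E x y \<Longrightarrow> adj X Y"
  unfolding adj_def by blast

lemma adj_Un [simp]: "adj X (Y \<union> Z) \<longleftrightarrow> adj X Y \<or> adj X Z" "adj (Y \<union> Z) X \<longleftrightarrow> adj Y X \<or> adj Z X"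
  unfolding adj_def by blast+

lemma adj_empty [simp]: "\<not> adj X {}" "\<not> adj {} X"
  unfolding adj_def by blast+

lemma adj_nbrs: "adj X Y \<Longrightarrow> X \<inter> Y = {} \<Longrightarrow> Y \<inter> nbrs X \<noteq> {}"
  unfolding adj_def nbrs_def by blast

lemma connD: "conn X \<Longrightarrow> Y \<subseteq> X \<Longrightarrow> Y \<noteq> {} \<Longrightarrow> Y \<noteq> X \<Longrightarrow> adj Y (X - Y)"
  unfolding conn_def by blast

lemma conn_nonempty: "conn X \<Longrightarrow> X \<noteq> {}"
  unfolding conn_def by blast

lemma conn_singleton [simp]: "conn {v}"
  unfolding conn_def by blast

lemma conn_UN:
  assumes "\<And>Y. Y \<in> F \<Longrightarrow> conn Y" "\<And>Y. Y \<in> F \<Longrightarrow> c \<in> Y" "F \<noteq> {}"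
  shows "conn (\<Union>F)"
  unfolding conn_def
proof (intro conjI allI impI)
  show "\<Union>F \<noteq> {}" using assms by blast
  fix Z assume Z: "Z \<subseteq> \<Union>F" "Z \<noteq> {}" "Z \<noteq> \<Union>F"
  have "\<exists>Y\<in>F. Z \<inter> Y \<noteq> {} \<and> \<not> Y \<subseteq> Z"
  proof (cases "c \<in> Z")
    case True then show ?thesis using Z assms(2) by blast
  next
    case False
    obtain z where "z \<in> Z" using Z(2) by blast
    then show ?thesis using Z(1) False assms(2) by blast
  qed
  then obtain Y where Y: "Y \<in> F" "Z \<inter> Y \<noteq> {}" "\<not> Y \<subseteq> Z" by blast
  then have "adj (Z \<inter> Y) (Y - Z \<inter> Y)" using connD[OF assms(1)[OF Y(1)], of "Z \<inter> Y"] by blast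
  then show "adj Z (\<Union>F - Z)" by (rule adj_mono) (use Y in blast)+
qed

lemma conn_Un_meet: "conn X \<Longrightarrow> conn Y \<Longrightarrow> X \<inter> Y \<noteq> {} \<Longrightarrow> conn (X \<union> Y)"
  using conn_UN[of "{X, Y}"] by auto

lemma conn_pair: "E u v \<Longrightarrow> conn {u, v}"
  unfolding conn_def
proof (intro conjI allI impI)
  fix Y assume "E u v" "Y \<subseteq> {u, v}" "Y \<noteq> {}" "Y \<noteq> {u, v}"
  then consider "Y = {u}" "u \<noteq> v" | "Y = {v}" "u \<noteq> v" by blast
  then show "adj Y ({u, v} - Y)" using \<open>E u v\<close> sym unfolding adj_def by cases blast+
qed auto

lemma conn_Un:
  assumes "conn X" "conn Y" "adj X Y" shows "conn (X \<union> Y)"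
proof -
  obtain u v where uv: "u \<in> X" "v \<in> Y" "E u v" using assms(3) unfolding adj_def by blast
  have "conn (X \<union> {u, v})" using conn_Un_meet[OF assms(1) conn_pair[OF uv(3)]] uv by blast
  then have "conn (X \<union> {u, v} \<union> Y)" using conn_Un_meet[OF _ assms(2)] uv by blast
  moreover have "X \<union> {u, v} \<union> Y = X \<union> Y" using uv by blast
  ultimately show ?thesis by simp
qed

lemma conn_insert: "conn X \<Longrightarrow> u \<in> X \<Longrightarrow> E u v \<Longrightarrow> conn (insert v X)"
  using conn_Un[of X "{v}"] by (auto simp: adj_def)

lemma conn_walk: "p \<noteq> [] \<Longrightarrow> successively E p \<Longrightarrow> conn (set p)"
proof (induction p rule: induct_list012)
  case (3 x y zs)
  then have "conn (set (y # zs))" "E y x" using sym by auto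
  then show ?case using conn_insert[of "set (y # zs)" y x] by simp
qed auto

lemma component_props:
  assumes "c \<in> X"
  shows "c \<in> component X c" "component X c \<subseteq> X" "conn (component X c)" "\<not> adj (component X c) (X - component X c)"
proof -
  let ?F = "{Y. Y \<subseteq> X \<and> conn Y \<and> c \<in> Y}"
  have c: "{c} \<in> ?F" using assms by simp
  then show "c \<in> component X c" unfolding component_def by blast
  show sub: "component X c \<subseteq> X" unfolding component_def by blast
  show con: "conn (component X c)" unfolding component_def by (rule conn_UN[of _ c]) (use c in blast)+
  show "\<not> adj (component X c) (X - component X c)"
  proof
    assume "adj (component X c) (X - component X c)"
    then obtain u v where uv: "u \<in> component X c" "v \<in> X" "v \<notin> component X c" "E u v"
      unfolding adj_def by blast
    then have "conn (insert v (component X c))" using conn_insert con by blast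
    then have "insert v (component X c) \<in> ?F"
      using uv(2) sub \<open>c \<in> component X c\<close> by blast
    then show False using uv(3) unfolding component_def by blast
  qed
qed

lemma component_adj_cut:
  assumes "conn X" "Y \<subseteq> X" "Y \<noteq> {}" "c \<in> X - Y"
  shows "adj (component (X - Y) c) Y"
proof -
  let ?K = "component (X - Y) c"
  note K = component_props[OF assms(4)]
  have "adj ?K (X - ?K)" using connD[OF assms(1), of ?K] K assms by blast
  moreover have "X - ?K = Y \<union> (X - Y - ?K)" using K(2) assms(2) by blast
  ultimately have "adj ?K Y \<or> adj ?K (X - Y - ?K)" by (metis adj_Un(1))
  then show ?thesis using K(4) by blast
qed

lemma conn_path:
  assumes "conn X" "u \<in> X" "v \<in> X"
  shows "\<exists>p. p \<noteq> [] \<and> distinct p \<and> successively E p \<and> set p \<subseteq> X \<and> hd p = u \<and> last p = v"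
proof -
  let ?P = "\<lambda>v p. p \<noteq> [] \<and> distinct p \<and> successively E p \<and> set p \<subseteq> X \<and> hd p = u \<and> last p = v"
  let ?R = "{v \<in> X. \<exists>p. ?P v p}"
  have "?R = X"
  proof (rule ccontr)
    assume ne: "?R \<noteq> X"
    have "u \<in> ?R" using assms(2) by (auto intro: exI[of _ "[u]"])
    then have "adj ?R (X - ?R)" using connD[OF assms(1), of ?R] ne by blast
    then obtain x y where xy: "x \<in> ?R" "y \<in> X - ?R" "E x y" unfolding adj_def by blast
    then obtain p where p: "?P x p" by blast
    have "y \<notin> set p"
    proof
      assume "y \<in> set p"
      then obtain a b where "p = a @ y # b" by (meson split_list)
      then have "?P y (a @ [y])" using p walk_prefix[of "{(x, y). E x y}" "a @ [y]" b]
        by (auto simp: walk_def hd_append)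
      then show False using xy by blast
    qed
    then have "?P y (p @ [y])" using p xy by (auto simp: successively_append_iff)
    then show False using xy by blast
  qed
  then show ?thesis using assms(3) by blast
qed

text \<open>A disjoint connected family that covers as much of \<open>A\<close> as possible covers
  all of it, since an edge leaving the union would let one member grow. This turns disjoint
  connected pieces into a partition, so that no stray vertices have to be tracked.\<close>

lemma absorb:
  assumes A: "finite A" "conn A" and I: "i0 \<in> I"
    and X: "\<And>i. i \<in> I \<Longrightarrow> conn (X i)" "\<And>i. i \<in> I \<Longrightarrow> X i \<subseteq> A" "disjoint_family_on X I"
  shows "\<exists>Y. (\<forall>i\<in>I. X i \<subseteq> Y i \<and> conn (Y i)) \<and> disjoint_family_on Y I \<and> (\<Union>i\<in>I. Y i) = A"
proof -
  let ?ok = "\<lambda>Y. (\<forall>i\<in>I. X i \<subseteq> Y i \<and> conn (Y i) \<and> Y i \<subseteq> A) \<and> disjoint_family_on Y I"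
  have "\<exists>Y. ?ok Y \<and> (\<forall>Z. ?ok Z \<longrightarrow> card (\<Union>i\<in>I. Z i) \<le> card (\<Union>i\<in>I. Y i))"
  proof (rule ex_has_greatest_nat[of ?ok X _ "Suc (card A)"])
    show "?ok X" using X by simp
    show "\<forall>Y. ?ok Y \<longrightarrow> card (\<Union>i\<in>I. Y i) < Suc (card A)"
      using card_mono[OF A(1)] by (simp add: UN_subset_iff less_Suc_eq_le)
  qed
  then obtain Y where Y: "?ok Y" and max: "\<And>Z. ?ok Z \<Longrightarrow> card (\<Union>i\<in>I. Z i) \<le> card (\<Union>i\<in>I. Y i)"
    by auto
  have "(\<Union>i\<in>I. Y i) = A"
  proof (rule ccontr)
    assume ne: "(\<Union>i\<in>I. Y i) \<noteq> A"
    have sub: "(\<Union>i\<in>I. Y i) \<subseteq> A" using Y by blast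
    have "Y i0 \<noteq> {}" using Y I conn_nonempty by simp
    then have "(\<Union>i\<in>I. Y i) \<noteq> {}" using I by blast
    then have "adj (\<Union>i\<in>I. Y i) (A - (\<Union>i\<in>I. Y i))" using connD[OF A(2) sub] ne by simp
    then obtain u v j where uv: "j \<in> I" "u \<in> Y j" "v \<in> A" "v \<notin> (\<Union>i\<in>I. Y i)" "E u v"
      unfolding adj_def by blast
    define Z where "Z = Y(j := insert v (Y j))"
    have "conn (insert v (Y j))" using conn_insert[of "Y j" u v] Y uv by simp
    then have "?ok Z"
      using Y uv by (auto simp: Z_def disjoint_family_on_def)
    moreover have "(\<Union>i\<in>I. Z i) = insert v (\<Union>i\<in>I. Y i)" using uv(1) by (auto simp: Z_def)
    moreover have "finite (\<Union>i\<in>I. Y i)" using sub A(1) finite_subset by blast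
    ultimately show False using max[of Z] uv(4) by simp
  qed
  then show ?thesis using Y by blast
qed

lemma absorb2:
  assumes "finite A" "conn A" "conn X1" "conn X2" "X1 \<subseteq> A" "X2 \<subseteq> A" "X1 \<inter> X2 = {}"
  obtains Y1 Y2 where "X1 \<subseteq> Y1" "X2 \<subseteq> Y2" "conn Y1" "conn Y2" "Y1 \<inter> Y2 = {}" "Y1 \<union> Y2 = A"
proof -
  have "\<exists>Y. (\<forall>i\<in>{0, 1::nat}. (if i = 0 then X1 else X2) \<subseteq> Y i \<and> conn (Y i)) \<and>
    disjoint_family_on Y {0, 1} \<and> (\<Union>i\<in>{0, 1}. Y i) = A"
    by (rule absorb[of A 0]) (use assms in \<open>auto simp: disjoint_family_on_def\<close>)
  then obtain Y where "X1 \<subseteq> Y 0" "X2 \<subseteq> Y (1::nat)" "conn (Y 0)" "conn (Y 1)" "Y 0 \<inter> Y 1 = {}" "Y 0 \<union> Y 1 = A"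
    by (auto simp: disjoint_family_on_def)
  then show thesis using that by blast
qed

lemma absorb3:
  assumes "finite A" "conn A" "conn X1" "conn X2" "conn X3" "X1 \<subseteq> A" "X2 \<subseteq> A" "X3 \<subseteq> A"
    "X1 \<inter> X2 = {}" "X1 \<inter> X3 = {}" "X2 \<inter> X3 = {}"
  obtains Y1 Y2 Y3 where "X1 \<subseteq> Y1" "X2 \<subseteq> Y2" "X3 \<subseteq> Y3" "conn Y1" "conn Y2" "conn Y3"
    "Y1 \<inter> Y2 = {}" "Y1 \<inter> Y3 = {}" "Y2 \<inter> Y3 = {}" "Y1 \<union> Y2 \<union> Y3 = A"
proof -
  let ?X = "\<lambda>i::nat. if i = 0 then X1 else if i = 1 then X2 else X3"
  have "\<exists>Y. (\<forall>i\<in>{0, 1, 2}. ?X i \<subseteq> Y i \<and> conn (Y i)) \<and>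
    disjoint_family_on Y {0, 1, 2} \<and> (\<Union>i\<in>{0, 1, 2}. Y i) = A"
    by (rule absorb[of A 0]) (use assms in \<open>auto simp: disjoint_family_on_def\<close>)
  then obtain Y where "X1 \<subseteq> Y 0" "X2 \<subseteq> Y (1::nat)" "X3 \<subseteq> Y 2" "conn (Y 0)" "conn (Y 1)" "conn (Y 2)"
    "Y 0 \<inter> Y 1 = {}" "Y 0 \<inter> Y 2 = {}" "Y 1 \<inter> Y 2 = {}" "Y 0 \<union> Y 1 \<union> Y 2 = A"
    by (auto simp: disjoint_family_on_def)
  then show thesis using that by blast
qed

lemma absorb4:
  assumes "finite A" "conn A" "conn X1" "conn X2" "conn X3" "conn X4"
    "X1 \<subseteq> A" "X2 \<subseteq> A" "X3 \<subseteq> A" "X4 \<subseteq> A"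
    "X1 \<inter> X2 = {}" "X1 \<inter> X3 = {}" "X2 \<inter> X3 = {}" "X1 \<inter> X4 = {}" "X2 \<inter> X4 = {}" "X3 \<inter> X4 = {}"
  obtains Y1 Y2 Y3 Y4 where "X1 \<subseteq> Y1" "X2 \<subseteq> Y2" "X3 \<subseteq> Y3" "X4 \<subseteq> Y4"
    "conn Y1" "conn Y2" "conn Y3" "conn Y4"
    "Y1 \<inter> Y2 = {}" "Y1 \<inter> Y3 = {}" "Y2 \<inter> Y3 = {}" "Y1 \<inter> Y4 = {}" "Y2 \<inter> Y4 = {}" "Y3 \<inter> Y4 = {}"
    "Y1 \<union> Y2 \<union> Y3 \<union> Y4 = A"
proof -
  let ?X = "\<lambda>i::nat. if i = 0 then X1 else if i = 1 then X2 else if i = 2 then X3 else X4"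
  have "\<exists>Y. (\<forall>i\<in>{0, 1, 2, 3}. ?X i \<subseteq> Y i \<and> conn (Y i)) \<and>
    disjoint_family_on Y {0, 1, 2, 3} \<and> (\<Union>i\<in>{0, 1, 2, 3}. Y i) = A"
    by (rule absorb[of A 0]) (use assms in \<open>auto simp: disjoint_family_on_def\<close>)
  then obtain Y where "X1 \<subseteq> Y 0" "X2 \<subseteq> Y (1::nat)" "X3 \<subseteq> Y 2" "X4 \<subseteq> Y 3"
    "conn (Y 0)" "conn (Y 1)" "conn (Y 2)" "conn (Y 3)"
    "Y 0 \<inter> Y 1 = {}" "Y 0 \<inter> Y 2 = {}" "Y 1 \<inter> Y 2 = {}" "Y 0 \<inter> Y 3 = {}" "Y 1 \<inter> Y 3 = {}" "Y 2 \<inter> Y 3 = {}"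
    "Y 0 \<union> Y 1 \<union> Y 2 \<union> Y 3 = A"
    by (auto simp: disjoint_family_on_def)
  then show thesis using that by blast
qed

end

section \<open>Graphs of large pathwidth contain large trees\<close>

locale fin_graph = sym_rel E for E :: "'a \<Rightarrow> 'a \<Rightarrow> bool" +
  fixes V :: "'a set"
  assumes finite_V: "finite V" and E_V: "E u v \<Longrightarrow> u \<in> V"
begin

lemma E_V': "E u v \<Longrightarrow> v \<in> V"
  using E_V sym by blast

definition bd :: "'a set \<Rightarrow> 'a set" where
  "bd X = {u \<in> X. \<exists>v\<in>V - X. E u v}"

text \<open>
  A good set is an initial segment of a linear layout all of whose proper initial segments have
  fewer than \<open>w\<close> boundary vertices.
\<close>

inductive good :: "nat \<Rightarrow> 'a set \<Rightarrow> bool" for w where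
  good_empty: "good w {}"
| good_insert: "good w X \<Longrightarrow> v \<in> V \<Longrightarrow> v \<notin> X \<Longrightarrow> card (bd X) < w \<Longrightarrow> good w (insert v X)"

lemma good_subset: "good w X \<Longrightarrow> X \<subseteq> V"
  by (induction rule: good.induct) auto

lemma finite_bd: "X \<subseteq> V \<Longrightarrow> finite (bd X)"
  unfolding bd_def using finite_V finite_subset by fastforce

lemma bd_submodular:
  assumes "X \<subseteq> V" "Y \<subseteq> V"
  shows "card (bd (X \<inter> Y)) + card (bd (X \<union> Y)) \<le> card (bd X) + card (bd Y)"
proof -
  note fin = finite_bd[OF assms(1)] finite_bd[OF assms(2)]
    finite_bd[of "X \<inter> Y"] finite_bd[of "X \<union> Y"]
  have "card (bd (X \<inter> Y)) + card (bd (X \<union> Y)) =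
      card (bd (X \<inter> Y) \<union> bd (X \<union> Y)) + card (bd (X \<inter> Y) \<inter> bd (X \<union> Y))"
    using fin assms by (intro card_Un_Int) auto
  also have "\<dots> \<le> card (bd X \<union> bd Y) + card (bd X \<inter> bd Y)"
    by (intro add_mono card_mono) (use fin in \<open>auto simp: bd_def\<close>)
  also have "\<dots> = card (bd X) + card (bd Y)"
    using fin by (intro card_Un_Int[symmetric]) auto
  finally show ?thesis .
qed

text \<open>Restrict the layout of \<open>Y\<close> to \<open>Z\<close>. For a prefix
  \<open>X\<close> the minimality of \<open>bd Z\<close> bounds \<open>bd (Z \<union> X)\<close>
  from below, so submodularity gives \<open>card (bd (Z \<inter> X)) \<le> card (bd X)\<close>, and
  the restricted layout stays below \<open>w\<close>.\<close>

lemma good_subset_min: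
  assumes "good w Y" "Z \<subseteq> Y" "\<And>Z'. Z \<subseteq> Z' \<Longrightarrow> Z' \<subseteq> Y \<Longrightarrow> card (bd Z) \<le> card (bd Z')"
  shows "good w Z"
proof -
  have YV: "Y \<subseteq> V" using good_subset assms(1) by blast
  have "good w (Z \<inter> X)" if "good w X" "X \<subseteq> Y" for X
    using that
  proof (induction rule: good.induct)
    case good_empty then show ?case using good.good_empty by simp
  next
    case (good_insert X v)
    then have IH: "good w (Z \<inter> X)" by simp
    show ?case
    proof (cases "v \<in> Z")
      case True
      have "card (bd Z) \<le> card (bd (Z \<union> X))" using assms(2,3) good_insert by auto
      moreover have "card (bd (Z \<inter> X)) + card (bd (Z \<union> X)) \<le> card (bd Z) + card (bd X)"
        using bd_submodular[of Z X] good_insert assms(2) YV by blast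
      ultimately have "card (bd (Z \<inter> X)) < w" using good_insert by linarith
      then have "good w (insert v (Z \<inter> X))" using good.good_insert[OF IH] good_insert by simp
      then show ?thesis using True by simp
    next
      case False then show ?thesis using IH by simp
    qed
  qed
  from this[OF assms(1)] show ?thesis using assms(2) by (simp add: Int_absorb2)
qed

text \<open>Menger's theorem between the two boundaries. A separator with fewer than
  \<open>k\<close> vertices would contain the boundary of a set between \<open>X\<close> and
  \<open>Y\<close>; a set in between with the smallest boundary is good by
  \<open>good_subset_min\<close>, against the last assumption.\<close>

lemma boundary_linkage:
  assumes Y: "good w Y" "X \<subseteq> Y" and k: "card (bd X) = k" "card (bd Y) = k"
    and min: "\<And>Z. good w Z \<Longrightarrow> X \<subseteq> Z \<Longrightarrow> Z \<subseteq> Y \<Longrightarrow> k \<le> card (bd Z)"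
  shows "\<exists>p. (\<forall>u\<in>bd X. hd (p u) = u \<and> p u \<noteq> [] \<and> successively E (p u) \<and>
        set (p u) \<subseteq> (Y - X) \<union> {u} \<and> last (p u) \<in> bd Y) \<and>
      (\<forall>u\<in>bd X. \<forall>v\<in>bd X. u \<noteq> v \<longrightarrow> set (p u) \<inter> set (p v) = {}) \<and>
      bd Y = (\<lambda>u. last (p u)) ` bd X"
proof -
  have YV: "Y \<subseteq> V" and XV: "X \<subseteq> V" using good_subset Y by auto
  define D where "D = (Y - X) \<union> bd X"
  define R where "R = {(u, v). E u v \<and> u \<in> D \<and> v \<in> D}"
  have "finite Y" using YV finite_V finite_subset by blast
  then have "finite D" unfolding D_def using finite_bd[OF XV] by simp
  then have "finite (D \<times> D)" by simp
  then have finR: "finite R" by (rule finite_subset[rotated]) (auto simp: R_def)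
  have sep: "k \<le> card S" if S: "finite S" "separates R (bd X) (bd Y) S" for S
  proof (rule ccontr)
    assume less: "\<not> k \<le> card S"
    \<comment> \<open>\<open>C\<close> is what can be reached from the boundary of \<open>X\<close>
      before meeting \<open>S\<close>. Any edge leaving \<open>Z\<close> from a vertex outside
      \<open>S\<close> would either extend \<open>C\<close> or complete a walk to the boundary of
      \<open>Y\<close> that avoids \<open>S\<close>.\<close>
    define C where "C = {v \<in> D. \<exists>p. walk R p \<and> hd p \<in> bd X \<and> last p = v \<and> set p \<inter> S = {}}"
    define Z where "Z = X \<union> C \<union> (S \<inter> Y)"
    have DY: "D \<subseteq> Y" using Y(2) by (auto simp: D_def bd_def)
    have ZY: "Z \<subseteq> Y" using Y(2) DY by (auto simp: Z_def C_def)
    have C0: "u \<in> C" if "u \<in> bd X" "u \<notin> S" for u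
      using that by (auto simp: C_def D_def walk_def intro!: exI[of _ "[u]"])
    have "bd Z \<subseteq> S"
    proof
      fix u assume u: "u \<in> bd Z"
      then obtain t where t: "t \<in> V" "t \<notin> Z" "E u t" by (auto simp: bd_def)
      show "u \<in> S"
      proof (rule ccontr)
        assume uS: "u \<notin> S"
        have "u \<in> C"
        proof (cases "u \<in> X")
          case True
          then have "u \<in> bd X" using t by (auto simp: bd_def Z_def)
          then show ?thesis using C0 uS by blast
        qed (use u uS in \<open>auto simp: bd_def Z_def\<close>)
        then obtain p where p: "walk R p" "hd p \<in> bd X" "last p = u" "set p \<inter> S = {}" "u \<in> D"
          by (auto simp: C_def)
        show False
        proof (cases "t \<in> Y")
          case False
          then have "u \<in> bd Y" using p(5) DY t by (auto simp: bd_def)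
          then show False using S(2) p unfolding separates_def by blast
        next
          case True
          then have "t \<in> D" "t \<notin> S" using t by (auto simp: D_def Z_def)
          then have "walk R (p @ [t])"
            using p t by (intro walk_append) (auto simp: R_def walk_def)
          then have "t \<in> C"
            using p \<open>t \<in> D\<close> \<open>t \<notin> S\<close> by (auto simp: C_def walk_def hd_append intro!: exI[of _ "p @ [t]"])
          then show False using t by (simp add: Z_def)
        qed
      qed
    qed
    then have small: "card (bd Z) < k" using less S(1) card_mono[of S "bd Z"] by simp
    let ?mid = "\<lambda>Z. X \<subseteq> Z \<and> Z \<subseteq> Y"
    have "?mid Z" using ZY by (auto simp: Z_def)
    then obtain Z0 where Z0: "?mid Z0" and least: "\<And>Z'. ?mid Z' \<Longrightarrow> card (bd Z0) \<le> card (bd Z')"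
      using ex_has_least_nat[of ?mid Z "\<lambda>Z. card (bd Z)"] by blast
    have "good w Z0" by (rule good_subset_min[OF Y(1)]) (use Z0 least in auto)
    then show False using min[of Z0] Z0 least[OF \<open>?mid Z\<close>] small by simp
  qed
  obtain P where P: "finite P" "card P = k"
    "\<And>p. p \<in> P \<Longrightarrow> walk R p \<and> distinct p \<and> hd p \<in> bd X \<and> last p \<in> bd Y"
    "\<And>p q. p \<in> P \<Longrightarrow> q \<in> P \<Longrightarrow> p \<noteq> q \<Longrightarrow> set p \<inter> set q = {}"
    using menger[where B = "bd Y" and k = k, OF finR finite_bd[OF XV] sep] by auto
  have eqP: "p = p'" if "p \<in> P" "p' \<in> P" "v \<in> set p" "v \<in> set p'" for p p' v
    using P(4)[OF that(1,2)] that(3,4) by blast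
  have ne: "p \<noteq> []" if "p \<in> P" for p using P(3)[OF that] by (simp add: walk_def)
  have injh: "inj_on hd P" by (rule inj_onI) (metis eqP hd_in_set ne)
  have injl: "inj_on last P" by (rule inj_onI) (metis eqP last_in_set ne)
  have hdP: "hd ` P = bd X"
  proof (rule card_subset_eq)
    show "card (hd ` P) = card (bd X)" using card_image[OF injh] P(2) k by simp
  qed (use P(3) finite_bd[OF XV] in auto)
  have lastP: "last ` P = bd Y"
  proof (rule card_subset_eq)
    show "card (last ` P) = card (bd Y)" using card_image[OF injl] P(2) k by simp
  qed (use P(3) finite_bd[OF YV] in auto)
  define p where "p u = inv_into P hd u" for u
  have p: "p u \<in> P" "hd (p u) = u" if "u \<in> bd X" for u
    unfolding p_def using that hdP inv_into_into[of u hd P] f_inv_into_f[of u hd P] by simp_all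
  have p_hd: "p (hd q) = q" if "q \<in> P" for q
    unfolding p_def using injh that by simp
  \<comment> \<open>The starting points of the paths exhaust \<open>bd X\<close>, so by disjointness
    no path returns to it.\<close>
  have only: "v = u" if "u \<in> bd X" "v \<in> bd X" "v \<in> set (p u)" for u v
    using eqP[OF p(1)[OF that(1)] p(1)[OF that(2)] that(3)] hd_in_set[OF ne[OF p(1)[OF that(2)]]]
      p(2)[OF that(1)] p(2)[OF that(2)] by simp
  have setD: "set q \<subseteq> D" if "walk R q" "hd q \<in> D" for q
    using that
  proof (induction q rule: induct_list012)
    case (3 x y zs)
    then have "walk R (y # zs)" "y \<in> D" by (auto simp: walk_def R_def)
    then show ?case using 3 by auto
  qed (auto simp: walk_def)
  show ?thesis
  proof (intro exI[of _ p] conjI ballI impI)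
    fix u assume u: "u \<in> bd X"
    note pu = P(3)[OF p(1)[OF u]]
    show "hd (p u) = u" "p u \<noteq> []" "last (p u) \<in> bd Y" using p[OF u] ne pu by auto
    show "successively E (p u)"
      using pu unfolding walk_def by (auto simp: R_def elim: successively_mono)
    show "set (p u) \<subseteq> (Y - X) \<union> {u}"
      using setD[of "p u"] pu only[OF u] by (fastforce simp: D_def)
    fix v assume v: "v \<in> bd X" "u \<noteq> v"
    show "set (p u) \<inter> set (p v) = {}"
      using P(4)[OF p(1)[OF u] p(1)[OF v(1)]] p(2)[OF u] p(2)[OF v(1)] v(2) by metis
  next
    have "last ` P = (\<lambda>u. last (p u)) ` (hd ` P)" using p_hd by (force simp: image_image)
    then show "bd Y = (\<lambda>u. last (p u)) ` bd X" using lastP hdP by simp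
  qed
qed

text \<open>A minor model of the tree on the nodes \<open>1..n\<close> whose parent function is
  \<open>par\<close>.\<close>

definition rooted_model :: "(nat \<Rightarrow> nat) \<Rightarrow> nat \<Rightarrow> (nat \<Rightarrow> 'a set) \<Rightarrow> bool" where
  "rooted_model par n B \<longleftrightarrow> (\<forall>k\<in>{1..n}. conn (B k) \<and> B k \<subseteq> V) \<and> disjoint_family_on B {1..n} \<and>
    (\<forall>k\<in>{2..n}. adj (B k) (B (par k)))"

lemma rooted_model_extend:
  assumes B: "rooted_model par i B" and X: "\<And>k. k \<in> {1..i} \<Longrightarrow> B k \<subseteq> X" and y: "y \<in> V" "y \<notin> X"
    and par: "\<And>k. 2 \<le> k \<Longrightarrow> par k \<in> {1..<k}"
    and yB: "i \<ge> 1 \<Longrightarrow> \<exists>u\<in>B (par (Suc i)). E u y"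
  shows "rooted_model par (Suc i) (B(Suc i := {y}))"
proof -
  let ?B = "B(Suc i := {y})"
  have iv: "{1..Suc i} = insert (Suc i) {1..i}" by auto
  have "disjoint_family_on ?B {1..Suc i}"
    unfolding disjoint_family_on_def
  proof (intro ballI impI)
    fix m n assume mn: "m \<in> {1..Suc i}" "n \<in> {1..Suc i}" "m \<noteq> n"
    have "B m \<inter> B n = {}" if "m \<in> {1..i}" "n \<in> {1..i}"
      using B that mn(3) by (auto simp: rooted_model_def disjoint_family_on_def)
    moreover have "y \<notin> B m" if "m \<in> {1..i}" for m using X[OF that] y by blast
    ultimately show "?B m \<inter> ?B n = {}" using mn iv by auto
  qed
  moreover have "adj (?B k) (?B (par k))" if k: "k \<in> {2..Suc i}" for k
  proof (cases "k = Suc i")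
    case True
    then have "par k \<noteq> Suc i" "\<exists>u\<in>B (par k). E u y" using par[of k] yB k by auto
    then show ?thesis using True sym by (auto simp: adj_def)
  next
    case False
    then have "adj (B k) (B (par k))" "par k \<noteq> Suc i" using B k par[of k] by (auto simp: rooted_model_def)
    then show ?thesis using False by simp
  qed
  moreover have "\<forall>k\<in>{1..Suc i}. conn (?B k) \<and> ?B k \<subseteq> V"
    using B y by (auto simp: rooted_model_def)
  ultimately show ?thesis by (auto simp: rooted_model_def)
qed

text \<open>
  Diestel's proof of the pathwidth theorem: the branch sets are rooted in the boundary of a good
  set \<open>X\<close> that is maximal for its boundary size, so that Menger's theorem lets them follow
  the boundary when \<open>X\<close> grows.
\<close>

lemma tree_model_boundary:
  assumes par: "\<And>k. 2 \<le> k \<Longrightarrow> par k \<in> {1..<k}" and V: "\<not> good w V" and "i \<le> w"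
  shows "\<exists>X B b. good w X \<and> rooted_model par i B \<and> inj_on b {1..i} \<and> bd X = b ` {1..i} \<and>
    (\<forall>k\<in>{1..i}. B k \<subseteq> X \<and> b k \<in> B k) \<and> (\<forall>Z. good w Z \<longrightarrow> X \<subset> Z \<longrightarrow> i < card (bd Z))"
  using \<open>i \<le> w\<close>
proof (induction i)
  case 0
  let ?P = "\<lambda>X. good w X \<and> bd X = {}"
  have "\<exists>X. ?P X \<and> (\<forall>Z. ?P Z \<longrightarrow> card Z \<le> card X)"
  proof (rule ex_has_greatest_nat[of ?P "{}" _ "Suc (card V)"])
    show "?P {}" by (simp add: good_empty bd_def)
    show "\<forall>X. ?P X \<longrightarrow> card X < Suc (card V)"
      using good_subset finite_V by (auto simp: less_Suc_eq_le intro!: card_mono)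
  qed
  then obtain X where X: "?P X" "\<And>Z. ?P Z \<Longrightarrow> card Z \<le> card X" by auto
  have "0 < card (bd Z)" if "good w Z" "X \<subset> Z" for Z
  proof -
    have "finite Z" using good_subset[OF that(1)] finite_V finite_subset by blast
    then have "card X < card Z" using that(2) psubset_card_mono by blast
    then have "bd Z \<noteq> {}" using X(2)[of Z] that(1) by auto
    then show ?thesis using finite_bd[OF good_subset[OF that(1)]] by (simp add: card_gt_0_iff)
  qed
  then show ?case using X(1) by (auto simp: rooted_model_def disjoint_family_on_def)
next
  case (Suc i)
  then obtain X B b where X: "good w X" and B: "rooted_model par i B" and b: "inj_on b {1..i}" "bd X = b ` {1..i}"
    and Bb: "\<And>k. k \<in> {1..i} \<Longrightarrow> B k \<subseteq> X \<and> b k \<in> B k"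
    and max: "\<And>Z. good w Z \<Longrightarrow> X \<subset> Z \<Longrightarrow> i < card (bd Z)"
    by auto
  have XV: "X \<subseteq> V" using good_subset X by blast
  have cX: "card (bd X) = i" using b card_image by fastforce
  \<comment> \<open>The new node is placed on a vertex outside \<open>X\<close> next to the boundary
    vertex that represents its parent; the very first node may go anywhere outside
    \<open>X\<close>.\<close>
  have "\<exists>y\<in>V - X. i \<ge> 1 \<longrightarrow> E (b (par (Suc i))) y"
  proof (cases "i = 0")
    case True
    have "X \<noteq> V" using X V by blast
    then show ?thesis using XV True by auto
  next
    case False
    then have "b (par (Suc i)) \<in> bd X" using b(2) par[of "Suc i"] by auto
    then show ?thesis by (auto simp: bd_def)
  qed
  then obtain y where y: "y \<in> V" "y \<notin> X" "i \<ge> 1 \<Longrightarrow> E (b (par (Suc i))) y" by blast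
  define X' where "X' = insert y X"
  have gX': "good w X'" unfolding X'_def using good_insert[OF X y(1,2)] cX Suc.prems by simp
  have "bd X' \<subseteq> insert y (bd X)" by (auto simp: X'_def bd_def)
  moreover have "i < card (bd X')" using max[OF gX'] y(2) by (auto simp: X'_def)
  moreover have "card (insert y (bd X)) \<le> Suc i" using cX finite_bd[OF XV] by (simp add: card_insert_if)
  ultimately have bX': "bd X' = insert y (bd X)" "card (bd X') = Suc i"
    using finite_bd[OF XV] card_seteq[of "insert y (bd X)" "bd X'"] by auto
  \<comment> \<open>A largest good superset of \<open>X'\<close> whose boundary has at most
    \<open>Suc i\<close> vertices. The branch sets follow the linkage from the boundary of
    \<open>X'\<close> to that of this set, which restores the maximality that the induction asks
    for.\<close>
  let ?P = "\<lambda>Y. good w Y \<and> X' \<subseteq> Y \<and> card (bd Y) \<le> Suc i"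
  have "\<exists>Y. ?P Y \<and> (\<forall>Z. ?P Z \<longrightarrow> card Z \<le> card Y)"
  proof (rule ex_has_greatest_nat[of ?P X' _ "Suc (card V)"])
    show "?P X'" using gX' bX' by simp
    show "\<forall>Y. ?P Y \<longrightarrow> card Y < Suc (card V)"
      using good_subset finite_V by (auto simp: less_Suc_eq_le intro!: card_mono)
  qed
  then obtain Y where Y: "?P Y" "\<And>Z. ?P Z \<Longrightarrow> card Z \<le> card Y" by auto
  have YV: "Y \<subseteq> V" using good_subset Y by blast
  have XX': "X \<subset> Z" if "X' \<subseteq> Z" for Z using that y(2) by (auto simp: X'_def)
  have cY: "card (bd Y) = Suc i" using Y(1) max[of Y] XX'[of Y] by (simp add: le_antisym Suc_le_eq)
  have maxY: "Suc i < card (bd Z)" if "good w Z" "Y \<subset> Z" for Z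
  proof (rule ccontr)
    assume "\<not> Suc i < card (bd Z)"
    moreover have "X' \<subseteq> Z" using Y(1) that(2) by blast
    ultimately have "card Z \<le> card Y" using Y(2)[of Z] that(1) by simp
    moreover have "finite Z" using good_subset[OF that(1)] finite_V finite_subset by blast
    ultimately show False using psubset_card_mono[OF _ that(2)] by simp
  qed
  have "Suc i \<le> card (bd Z)" if "good w Z" "X' \<subseteq> Z" for Z
    using max[OF that(1) XX'[OF that(2)]] by simp
  from boundary_linkage[OF conjunct1[OF Y(1)] conjunct1[OF conjunct2[OF Y(1)]] bX'(2) cY this]
  obtain p where p0: "(\<forall>u\<in>bd X'. hd (p u) = u \<and> p u \<noteq> [] \<and> successively E (p u) \<and>
        set (p u) \<subseteq> (Y - X') \<union> {u} \<and> last (p u) \<in> bd Y) \<and>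
      (\<forall>u\<in>bd X'. \<forall>v\<in>bd X'. u \<noteq> v \<longrightarrow> set (p u) \<inter> set (p v) = {}) \<and>
      bd Y = (\<lambda>u. last (p u)) ` bd X'" ..
  have p: "hd (p u) = u" "p u \<noteq> []" "successively E (p u)" "set (p u) \<subseteq> (Y - X') \<union> {u}" "last (p u) \<in> bd Y"
    if "u \<in> bd X'" for u using p0 that by simp_all
  have pp: "set (p u) \<inter> set (p v) = {}" if "u \<in> bd X'" "v \<in> bd X'" "u \<noteq> v" for u v
    using p0 that by simp
  have plast: "bd Y = (\<lambda>u. last (p u)) ` bd X'" using p0 by simp
  define B' where "B' = B(Suc i := {y})"
  define b' where "b' = b(Suc i := y)"
  have B': "rooted_model par (Suc i) B'" unfolding B'_def
  proof (rule rooted_model_extend[OF B _ y(1,2) par])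
    show "\<And>k. k \<in> {1..i} \<Longrightarrow> B k \<subseteq> X" using Bb by blast
    assume i: "1 \<le> i"
    then have "par (Suc i) \<in> {1..i}" using par[of "Suc i"] by auto
    then show "\<exists>u\<in>B (par (Suc i)). E u y" using Bb y(3)[OF i] by blast
  qed
  have iv: "{1..Suc i} = insert (Suc i) {1..i}" by auto
  have bd': "bd X' = b' ` {1..Suc i}" unfolding bX'(1) b(2) b'_def iv by (auto simp: image_iff)
  have inj': "inj_on b' {1..Suc i}" by (rule eq_card_imp_inj_on) (use bX'(2) bd' in auto)
  have B'b': "B' k \<subseteq> X'" "b' k \<in> B' k" if "k \<in> {1..Suc i}" for k
    using that Bb[of k] by (cases "k = Suc i"; force simp: B'_def b'_def X'_def)+
  have b'bd: "b' k \<in> bd X'" if "k \<in> {1..Suc i}" for k using bd' that by blast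
  have B'_disj: "B' k \<inter> B' m = {}" if "k \<in> {1..Suc i}" "m \<in> {1..Suc i}" "k \<noteq> m" for k m
    using B' that by (auto simp: rooted_model_def disjoint_family_on_def)
  define C where "C k = B' k \<union> set (p (b' k))" for k
  have Cp: "B' k \<inter> set (p (b' m)) = {}" if km: "k \<in> {1..Suc i}" "m \<in> {1..Suc i}" "k \<noteq> m" for k m
  proof -
    have "set (p (b' m)) \<subseteq> (Y - X') \<union> {b' m}" by (rule p(4)[OF b'bd[OF km(2)]])
    moreover have "b' m \<notin> B' k" using B'_disj[OF km] B'b'(2)[OF km(2)] by blast
    ultimately show ?thesis using B'b'(1)[OF km(1)] by blast
  qed
  have model: "rooted_model par (Suc i) C"
    unfolding rooted_model_def
  proof (intro conjI ballI)
    fix k assume k: "k \<in> {1..Suc i}"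
    have "conn (B' k)" using B' k by (auto simp: rooted_model_def)
    moreover have "conn (set (p (b' k)))" using p(2,3)[OF b'bd[OF k]] conn_walk by blast
    moreover have "b' k \<in> set (p (b' k))" using p(1,2)[OF b'bd[OF k]] hd_in_set by metis
    ultimately show "conn (C k)" unfolding C_def using B'b'(2)[OF k] by (intro conn_Un_meet) auto
    show "C k \<subseteq> V" using B'b'[OF k] Y(1) YV p(4)[OF b'bd[OF k]] unfolding C_def by blast
  next
    show "disjoint_family_on C {1..Suc i}" unfolding disjoint_family_on_def
    proof (intro ballI impI)
      fix k m assume km: "k \<in> {1..Suc i}" "m \<in> {1..Suc i}" "k \<noteq> m"
      have "b' k \<noteq> b' m" using inj' km by (auto dest: inj_onD)
      then have "set (p (b' k)) \<inter> set (p (b' m)) = {}" using pp[OF b'bd[OF km(1)] b'bd[OF km(2)]] by simp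
      then show "C k \<inter> C m = {}" using B'_disj[OF km] Cp[OF km] Cp[OF km(2,1)] km(3) unfolding C_def by blast
    qed
  next
    fix k assume "k \<in> {2..Suc i}"
    then have "adj (B' k) (B' (par k))" using B' by (auto simp: rooted_model_def)
    then show "adj (C k) (C (par k))" by (rule adj_mono) (auto simp: C_def)
  qed
  define c where "c k = last (p (b' k))" for k
  have bdY: "bd Y = c ` {1..Suc i}" using plast bd' by (simp add: c_def image_image)
  have injc: "inj_on c {1..Suc i}" by (rule eq_card_imp_inj_on) (use cY bdY in auto)
  have "C k \<subseteq> Y \<and> c k \<in> C k" if k: "k \<in> {1..Suc i}" for k
  proof
    have "X' \<subseteq> Y" "b' k \<in> X'" using Y(1) B'b'[OF k] by auto
    then show "C k \<subseteq> Y" using B'b'(1)[OF k] p(4)[OF b'bd[OF k]] unfolding C_def by blast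
    show "c k \<in> C k" using p(2)[OF b'bd[OF k]] by (simp add: C_def c_def)
  qed
  then show ?case using Y(1) model injc bdY maxY by (intro exI[of _ Y] exI[of _ C] exI[of _ c]) simp
qed

text \<open>The last node is added without following the boundary afterwards; this is how boundaries
  of size \<open>w\<close> lead to \<open>Suc w\<close> branch sets.\<close>

theorem tree_model:
  assumes par: "\<And>k. 2 \<le> k \<Longrightarrow> par k \<in> {1..<k}" and V: "\<not> good w V"
  shows "\<exists>B. rooted_model par (Suc w) B"
proof -
  obtain X B b where X: "good w X" and B: "rooted_model par w B" and b: "bd X = b ` {1..w}"
    and Bb: "\<And>k. k \<in> {1..w} \<Longrightarrow> B k \<subseteq> X \<and> b k \<in> B k"
    using tree_model_boundary[OF par V order_refl] by auto
  have XV: "X \<subseteq> V" using good_subset X by blast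
  have "\<exists>y\<in>V - X. w \<ge> 1 \<longrightarrow> E (b (par (Suc w))) y"
  proof (cases "w = 0")
    case True
    have "X \<noteq> V" using X V by blast
    then show ?thesis using XV True by auto
  next
    case False
    then have "b (par (Suc w)) \<in> bd X" using b par[of "Suc w"] by auto
    then show ?thesis by (auto simp: bd_def)
  qed
  then obtain y where y: "y \<in> V" "y \<notin> X" "w \<ge> 1 \<Longrightarrow> E (b (par (Suc w))) y" by blast
  have "rooted_model par (Suc w) (B(Suc w := {y}))"
  proof (rule rooted_model_extend[OF B _ y(1,2) par])
    show "\<And>k. k \<in> {1..w} \<Longrightarrow> B k \<subseteq> X" using Bb by blast
    assume w: "1 \<le> w"
    then have "par (Suc w) \<in> {1..w}" using par[of "Suc w"] by auto
    then show "\<exists>u\<in>B (par (Suc w)). E u y" using Bb y(3)[OF w] by blast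
  qed
  then show ?thesis by blast
qed

lemma good_layout:
  "good w X \<Longrightarrow> \<exists>xs. distinct xs \<and> set xs = X \<and> (\<forall>i<length xs. card (bd (set (take i xs))) < w)"
proof (induction rule: good.induct)
  case good_empty then show ?case by simp
next
  case (good_insert X v)
  then obtain xs where xs: "distinct xs" "set xs = X" "\<forall>i<length xs. card (bd (set (take i xs))) < w" by blast
  have "card (bd (set (take i (xs @ [v])))) < w" if "i < length (xs @ [v])" for i
    using that xs good_insert by (cases "i = length xs") auto
  then show ?case using xs good_insert by (intro exI[of _ "xs @ [v]"]) auto
qed

end

section \<open>Series-parallel refinement\<close>

text \<open>2-connectivity as expansion: a set with at most one outside neighbour would be cut off
  by that neighbour from a further vertex.\<close>

locale two_conn_graph = fin_graph E V for E :: "'a \<Rightarrow> 'a \<Rightarrow> bool" and V +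
  assumes two_conn: "X \<noteq> {} \<Longrightarrow> X \<subseteq> V \<Longrightarrow> 2 \<le> card (V - X) \<Longrightarrow> 2 \<le> card (nbrs X)"
begin

lemma finite_nbrs: "finite (nbrs X)"
  by (rule finite_subset[OF _ finite_V]) (auto simp: nbrs_def E_V')

text \<open>Menger's theorem with \<open>k = 2\<close>. If fewer than two vertices separated
  \<open>S\<close> from \<open>T\<close>, the part reachable from \<open>S\<close> would have fewer
  than two neighbours although at least two vertices lie outside it.\<close>

lemma two_disjoint_walks:
  assumes "S \<subseteq> V" "2 \<le> card S" "T \<subseteq> V" "2 \<le> card T"
  shows "\<exists>p q. successively E p \<and> successively E q \<and> p \<noteq> [] \<and> q \<noteq> [] \<and> hd p \<in> S \<and> hd q \<in> S \<and>
    last p \<in> T \<and> last q \<in> T \<and> set p \<inter> set q = {}"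
proof -
  define R where "R = {(u, v). E u v}"
  have "R \<subseteq> V \<times> V" using E_V E_V' by (auto simp: R_def)
  then have finR: "finite R" using finite_V finite_subset by blast
  have finS: "finite S" using assms(1) finite_V finite_subset by blast
  have sep: "2 \<le> card D" if D: "finite D" "separates R S T D" for D
  proof (rule ccontr)
    assume less: "\<not> 2 \<le> card D"
    define X where "X = {v \<in> V. \<exists>p. walk R p \<and> hd p \<in> S \<and> last p = v \<and> set p \<inter> D = {}}"
    have sub: "S - D \<subseteq> X" using assms(1) by (auto simp: X_def walk_def intro!: exI[of _ "[x]" for x])
    have "S - D \<noteq> {}"
    proof
      assume "S - D = {}"
      then have "card S \<le> card D" using D(1) by (intro card_mono) auto
      then show False using assms(2) less by simp
    qed
    then have "X \<noteq> {}" using sub by auto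
    have TX: "T - D \<subseteq> V - X"
      using assms(3) D(2) unfolding X_def separates_def by blast
    have nX: "nbrs X \<subseteq> D"
    proof
      fix v assume "v \<in> nbrs X"
      then obtain u p where u: "v \<notin> X" "E u v" "walk R p" "hd p \<in> S" "last p = u" "set p \<inter> D = {}"
        by (auto simp: nbrs_def X_def)
      show "v \<in> D"
      proof (rule ccontr)
        assume "v \<notin> D"
        moreover have "walk R (p @ [v])" using u by (intro walk_append) (auto simp: walk_def R_def)
        ultimately have "v \<in> X"
          using u E_V' by (auto simp: X_def walk_def hd_append intro!: exI[of _ "p @ [v]"])
        then show False using u by simp
      qed
    qed
    have "X \<inter> D = {}"
    proof -
      have "last p \<notin> D" if "walk R p" "set p \<inter> D = {}" for p
        using that last_in_set[of p] unfolding walk_def by blast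
      then show ?thesis by (auto simp: X_def)
    qed
    have "\<not> 2 \<le> card (nbrs X)" using card_mono[OF D(1) nX] less by simp
    moreover have "2 \<le> card (V - X)"
    proof -
      have "T \<subseteq> V - X"
        using TX assms(3) \<open>X \<inter> D = {}\<close> by auto
      then have "card T \<le> card (V - X)" using finite_V by (intro card_mono) auto
      then show ?thesis using assms(4) by simp
    qed
    moreover have "X \<subseteq> V" by (auto simp: X_def)
    ultimately show False using two_conn[OF \<open>X \<noteq> {}\<close>] by simp
  qed
  obtain P where P: "card P = 2"
    "\<And>p. p \<in> P \<Longrightarrow> walk R p \<and> distinct p \<and> hd p \<in> S \<and> last p \<in> T"
    "\<And>p q. p \<in> P \<Longrightarrow> q \<in> P \<Longrightarrow> p \<noteq> q \<Longrightarrow> set p \<inter> set q = {}"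
    using menger[where B = T and k = 2, OF finR finS sep] by auto
  obtain p q where pq: "P = {p, q}" "p \<noteq> q" using P(1) by (auto simp: card_2_iff)
  have pP: "p \<in> P" and qP: "q \<in> P" using pq by auto
  have "successively E p" "successively E q" "p \<noteq> []" "q \<noteq> []"
    using P(2)[OF pP] P(2)[OF qP] by (simp_all add: walk_def R_def)
  then show ?thesis using P(2)[OF pP] P(2)[OF qP] P(3)[OF pP qP pq(2)] by (intro exI[of _ p] exI[of _ q]) simp
qed

text \<open>The piece runs from the last visit to \<open>y\<close> up to the first exit from
  \<open>U\<close>. It is non-empty because no edge leads from \<open>y\<close> directly out of
  \<open>U\<close>.\<close>

lemma walk_interior:
  assumes "successively E p" "p \<noteq> []" "hd p \<in> y" "last p \<notin> U" "y \<subseteq> U" "\<not> adj y (- U)"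
  shows "\<exists>m. conn m \<and> m \<subseteq> U - y \<and> m \<subseteq> set p \<and> adj y m \<and> adj m (- U)"
proof -
  have "\<exists>v\<in>set p. v \<notin> U" using assms(2,4) last_in_set by blast
  then obtain a v b where v: "p = a @ v # b" "v \<notin> U" "\<forall>u\<in>set a. u \<in> U"
    using split_list_first_prop[of p "\<lambda>v. v \<notin> U"] by auto
  have "a \<noteq> []" using assms(3,5) v by (cases a) auto
  then have "hd a \<in> y" using assms(3) v by simp
  then have "\<exists>u\<in>set a. u \<in> y" using \<open>a \<noteq> []\<close> hd_in_set by blast
  then obtain c u d where u: "a = c @ u # d" "u \<in> y" "\<forall>x\<in>set d. x \<notin> y"
    using split_list_last_prop[of a "\<lambda>u. u \<in> y"] by auto
  have succ: "successively E (u # d @ [v])"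
    using assms(1) unfolding v(1) u(1) by (auto simp: successively_append_iff successively_Cons hd_append split: if_splits)
  have "d \<noteq> []"
  proof
    assume "d = []"
    then have "E u v" using succ by simp
    then show False using assms(6) u(2) v(2) by (auto simp: adj_def)
  qed
  then have d: "successively E d" "E u (hd d)" "E (last d) v"
    using succ by (auto simp: successively_append_iff successively_Cons)
  have "adj y (set d)" using adjI[OF u(2) hd_in_set[OF \<open>d \<noteq> []\<close>] d(2)] .
  moreover have "adj (set d) (- U)" using adjI[OF last_in_set[OF \<open>d \<noteq> []\<close>] _ d(3), of "- U"] v(2) by simp
  ultimately show ?thesis
    using conn_walk[OF \<open>d \<noteq> []\<close> d(1)] u v by (intro exI[of _ "set d"]) auto
qed

text \<open>The empty \<open>m\<close> stands for a direct edge, so that direct and indirect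
  connections can be treated alike.\<close>

definition link :: "'a set \<Rightarrow> 'a set \<Rightarrow> 'a set \<Rightarrow> bool" where
  "link y m P \<longleftrightarrow> (m = {} \<and> adj y P) \<or> (conn m \<and> adj y m \<and> adj m P)"

lemma link_Un: "link y m (P \<union> Q) \<longleftrightarrow> link y m P \<or> link y m Q"
  unfolding link_def by auto

lemma link_conn: "link y m l \<Longrightarrow> conn l \<Longrightarrow> conn (l \<union> m) \<and> adj y (l \<union> m)"
  unfolding link_def using conn_Un[of l m] adj_sym by auto

lemma link_nonadj: "link y m P \<Longrightarrow> \<not> adj y P \<Longrightarrow> conn m \<and> adj y m \<and> adj m P"
  unfolding link_def by auto

lemma component_max: "conn Y \<Longrightarrow> c \<in> Y \<Longrightarrow> Y \<subseteq> X \<Longrightarrow> Y \<subseteq> component X c"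
  unfolding component_def by blast

lemma link_exists:
  assumes "conn K" "y \<subseteq> K" "y \<noteq> {}" "adj K X"
  shows "\<exists>m. m \<subseteq> K - y \<and> link y m X"
proof (cases "adj y X")
  case True then show ?thesis by (auto simp: link_def)
next
  case False
  obtain q x where q: "q \<in> K" "x \<in> X" "E q x" using assms(4) by (auto simp: adj_def)
  then have qK: "q \<in> K - y" using False by (auto simp: adj_def)
  let ?m = "component (K - y) q"
  have "adj y ?m" using component_adj_cut[OF assms(1-3) qK] adj_sym by blast
  moreover have "adj ?m X" using adjI[OF component_props(1)[OF qK] q(2,3)] .
  ultimately show ?thesis
    using component_props(2,3)[OF qK] by (intro exI[of _ ?m]) (simp add: link_def)
qed

text \<open>Both given connections lead to \<open>X1\<close>. Distribute all of \<open>K\<close>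
  among \<open>y\<close>, \<open>m1\<close> and \<open>m2\<close>; whichever of the three enlarged
  parts sees \<open>X2\<close> supplies the connection to \<open>X2\<close>, and one of
  \<open>m1\<close>, \<open>m2\<close> outside that part keeps the connection to
  \<open>X1\<close>.\<close>

lemma two_links_reroute:
  assumes K: "conn K" "finite K" "y \<subseteq> K" "conn y" "adj K X2" "\<not> adj y X2"
    and m: "conn m1" "conn m2" "m1 \<subseteq> K - y" "m2 \<subseteq> K - y" "m1 \<inter> m2 = {}" "adj y m1" "adj y m2"
      "adj m1 X1" "adj m2 X1"
  shows "\<exists>n1 n2. n1 \<subseteq> K - y \<and> n2 \<subseteq> K - y \<and> n1 \<inter> n2 = {} \<and> link y n1 X1 \<and> link y n2 X2"
proof -
  obtain Y M1 M2 where Y: "y \<subseteq> Y" "m1 \<subseteq> M1" "m2 \<subseteq> M2" "conn Y" "conn M1" "conn M2"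
    "Y \<inter> M1 = {}" "Y \<inter> M2 = {}" "M1 \<inter> M2 = {}" "Y \<union> M1 \<union> M2 = K"
    by (rule absorb3[of K y m1 m2]) (use K m in auto)
  have sub: "M1 \<subseteq> K - y" "M2 \<subseteq> K - y" "Y \<subseteq> K" using Y by auto
  have dis: "m2 \<inter> M1 = {}" "m1 \<inter> M2 = {}" "m1 \<inter> Y = {}" using Y(2,3,7,9) by auto
  have "adj M1 X2 \<or> adj M2 X2 \<or> adj Y X2" using K(5) unfolding Y(10)[symmetric] by auto
  then show ?thesis
  proof (elim disjE)
    assume "adj M1 X2"
    then have "link y M1 X2" "link y m2 X1"
      using m Y adj_mono[OF m(6) order_refl Y(2)] by (auto simp: link_def)
    then show ?thesis using sub dis m(4) by (intro exI[of _ m2] exI[of _ M1]) simp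
  next
    assume "adj M2 X2"
    then have "link y M2 X2" "link y m1 X1"
      using m Y adj_mono[OF m(7) order_refl Y(3)] by (auto simp: link_def)
    then show ?thesis using sub dis m(3) by (intro exI[of _ m1] exI[of _ M2]) simp
  next
    assume "adj Y X2"
    then obtain n where n: "n \<subseteq> Y - y" "link y n X2"
      using link_exists[OF Y(4,1) conn_nonempty[OF K(4)]] by blast
    moreover have "link y m1 X1" using m by (auto simp: link_def)
    moreover have "n \<subseteq> K - y" "m1 \<inter> n = {}" using n(1) sub(3) dis(3) by auto
    ultimately show ?thesis using m(3) by (intro exI[of _ m1] exI[of _ n]) simp
  qed
qed

text \<open>The two vertices in \<open>y\<close> and the two outside \<open>K\<close> are the
  terminals for \<open>two_disjoint_walks\<close>. If both walks leave \<open>K\<close> towards the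
  same target, \<open>two_links_reroute\<close> redirects one of them.\<close>

lemma two_links:
  assumes K: "conn K" "K \<subseteq> V" "2 \<le> card (V - K)" and y: "y \<subseteq> K" "conn y" "2 \<le> card y"
    and X: "nbrs K \<subseteq> X1 \<union> X2" "adj K X1" "adj K X2"
  shows "\<exists>m1 m2. m1 \<subseteq> K - y \<and> m2 \<subseteq> K - y \<and> m1 \<inter> m2 = {} \<and> link y m1 X1 \<and> link y m2 X2"
proof -
  have yne: "y \<noteq> {}" using conn_nonempty y by blast
  have finK: "finite K" using K(2) finite_V finite_subset by blast
  consider "adj y X1" | "adj y X2" | "\<not> adj y X1" "\<not> adj y X2" by blast
  then show ?thesis
  proof cases
    case 1
    then have "link y {} X1" by (simp add: link_def)
    then show ?thesis using link_exists[OF K(1) y(1) yne X(3)] by blast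
  next
    case 2
    then have "link y {} X2" by (simp add: link_def)
    then show ?thesis using link_exists[OF K(1) y(1) yne X(2)] by blast
  next
    case 3
    have out: "adj m (X1 \<union> X2)" if "adj m (- K)" "m \<subseteq> K" for m
      using that X(1) unfolding adj_def nbrs_def by blast
    have nout: "\<not> adj y (- K)" using out[of y] y(1) 3 by auto
    obtain p q where pq: "successively E p" "successively E q" "p \<noteq> []" "q \<noteq> []" "hd p \<in> y" "hd q \<in> y"
      "last p \<in> V - K" "last q \<in> V - K" "set p \<inter> set q = {}"
      using two_disjoint_walks[of y "V - K"] y K by auto
    obtain m1 where m1: "conn m1" "m1 \<subseteq> K - y" "m1 \<subseteq> set p" "adj y m1" "adj m1 (- K)"
      using walk_interior[OF pq(1,3,5) _ y(1) nout] pq(7) by auto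
    obtain m2 where m2: "conn m2" "m2 \<subseteq> K - y" "m2 \<subseteq> set q" "adj y m2" "adj m2 (- K)"
      using walk_interior[OF pq(2,4,6) _ y(1) nout] pq(8) by auto
    have dis: "m1 \<inter> m2 = {}" using m1(3) m2(3) pq(9) by blast
    have o1: "adj m1 X1 \<or> adj m1 X2" and o2: "adj m2 X1 \<or> adj m2 X2"
      using out[of m1] out[of m2] m1 m2 by auto
    consider "adj m1 X1" "adj m2 X2" | "adj m1 X2" "adj m2 X1" | "adj m1 X1" "adj m2 X1" | "adj m1 X2" "adj m2 X2"
      using o1 o2 by blast
    then show ?thesis
    proof cases
      case 1
      then show ?thesis using m1 m2 dis by (intro exI[of _ m1] exI[of _ m2]) (auto simp: link_def)
    next
      case 2
      then show ?thesis using m1 m2 dis by (intro exI[of _ m2] exI[of _ m1]) (auto simp: link_def)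
    next
      case 3
      show ?thesis
        by (rule two_links_reroute[OF K(1) finK y(1,2) X(3) \<open>\<not> adj y X2\<close> m1(1) m2(1) m1(2) m2(2) dis m1(4) m2(4) 3])
    next
      case 4
      have "\<exists>n1 n2. n1 \<subseteq> K - y \<and> n2 \<subseteq> K - y \<and> n1 \<inter> n2 = {} \<and> link y n1 X2 \<and> link y n2 X1"
        by (rule two_links_reroute[OF K(1) finK y(1,2) X(2) \<open>\<not> adj y X1\<close> m1(1) m2(1) m1(2) m2(2) dis m1(4) m2(4) 4])
      then show ?thesis by blast
    qed
  qed
qed

text \<open>On a path from \<open>y\<close> to \<open>P\<close> any two vertices can be separated by
  a cut between them, one half staying with \<open>y\<close> and the other with \<open>P\<close>.
  This is needed when a component has all its neighbours on the path.\<close>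

lemma path_split:
  assumes "conn l" "adj y l" "adj l P"
  obtains l' where "l' \<subseteq> l" "conn l'" "adj y l'" "adj l' P"
    "\<And>c d. c \<in> l' \<Longrightarrow> d \<in> l' \<Longrightarrow> c \<noteq> d \<Longrightarrow> \<exists>p q. p \<union> q = l' \<and> p \<inter> q = {} \<and> conn p \<and> conn q \<and>
      adj y p \<and> adj q P \<and> (c \<in> p \<and> d \<in> q \<or> d \<in> p \<and> c \<in> q)"
proof -
  obtain s u where su: "s \<in> y" "u \<in> l" "E s u" using assms(2) by (auto simp: adj_def)
  obtain v t where vt: "v \<in> l" "t \<in> P" "E v t" using assms(3) by (auto simp: adj_def)
  obtain p where p: "p \<noteq> []" "distinct p" "successively E p" "set p \<subseteq> l" "hd p = u" "last p = v"
    using conn_path[OF assms(1) su(2) vt(1)] by blast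
  have split: "\<exists>q r. q \<union> r = set p \<and> q \<inter> r = {} \<and> conn q \<and> conn r \<and> adj y q \<and> adj r P \<and> c \<in> q \<and> d \<in> r"
    if "p = a @ c # b" "d \<in> set b" for a b c d
  proof -
    have b: "b \<noteq> []" using that by auto
    have "successively E (a @ [c])" "successively E b"
      using p(3) that(1) b walk_prefix[of "{(x, y). E x y}" "a @ [c]" b] walk_suffix[of "{(x, y). E x y}" "a @ [c]" b]
      by (auto simp: walk_def)
    then have "conn (set (a @ [c]))" "conn (set b)" using conn_walk[of "a @ [c]"] conn_walk[of b] b by auto
    moreover have "u \<in> set (a @ [c])" using p(5) that(1) by (cases a) auto
    then have "adj y (set (a @ [c]))" using su adjI by metis
    moreover have "v \<in> set b" using p(6) that(1) b by auto
    then have "adj (set b) P" using vt adjI by metis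
    moreover have "set (a @ [c]) \<inter> set b = {}" using p(2) that(1) by auto
    moreover have "set (a @ [c]) \<union> set b = set p" using that(1) by auto
    ultimately show ?thesis using that(2) by (intro exI[of _ "set (a @ [c])"] exI[of _ "set b"]) auto
  qed
  show thesis
  proof (rule that[of "set p"])
    show "conn (set p)" using conn_walk p by blast
    show "adj y (set p)" using adjI[OF su(1) _ su(3)] hd_in_set[OF p(1)] p(5) by simp
    show "adj (set p) P" using adjI[OF _ vt(2) vt(3)] last_in_set[OF p(1)] p(6) by simp
    show "set p \<subseteq> l" by fact
    fix c d assume cd: "c \<in> set p" "d \<in> set p" "c \<noteq> d"
    obtain a b where ab: "p = a @ c # b" using cd(1) by (meson split_list)
    show "\<exists>q r. q \<union> r = set p \<and> q \<inter> r = {} \<and> conn q \<and> conn r \<and> adj y q \<and> adj r P \<and>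
        (c \<in> q \<and> d \<in> r \<or> d \<in> q \<and> c \<in> r)"
    proof (cases "d \<in> set b")
      case True
      from split[OF ab True] show ?thesis by metis
    next
      case False
      then have "d \<in> set a" using cd ab by auto
      then obtain a1 a2 where "a = a1 @ d # a2" by (meson split_list)
      then have "p = a1 @ d # (a2 @ c # b)" using ab by simp
      from split[OF this, of c] show ?thesis by (simp, metis)
    qed
  qed
qed

end

section \<open>Parallel and series pairs between two hubs\<close>

context two_conn_graph begin

text \<open>\<open>P\<close> and \<open>Q\<close> play the part of the two terminals in a
  series-parallel decomposition of \<open>U\<close>.\<close>

definition hubs :: "'a set \<Rightarrow> 'a set \<Rightarrow> 'a set \<Rightarrow> bool" where
  "hubs U P Q \<longleftrightarrow> conn P \<and> conn Q \<and> P \<subseteq> V \<and> Q \<subseteq> V \<and> P \<inter> Q = {} \<and> U \<inter> P = {} \<and> U \<inter> Q = {} \<and>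
    nbrs U \<subseteq> P \<union> Q \<and> adj U P \<and> adj U Q"

text \<open>Two vertices per branch let Menger's theorem send two disjoint paths out of it; the
  connected rest \<open>U - y - y'\<close> is the material for connections to the hubs and between
  the branches.\<close>

definition split_pair :: "'a set \<Rightarrow> 'a set \<Rightarrow> 'a set \<Rightarrow> bool" where
  "split_pair U y y' \<longleftrightarrow> U \<subseteq> V \<and> conn U \<and> y \<subseteq> U \<and> y' \<subseteq> U \<and> y \<inter> y' = {} \<and> conn y \<and> conn y' \<and>
    2 \<le> card y \<and> 2 \<le> card y' \<and> \<not> adj y y' \<and> conn (U - y - y') \<and>
    nbrs y \<subseteq> U - y - y' \<and> nbrs y' \<subseteq> U - y - y'"

text \<open>
  A pair of branches \<open>y\<close>, \<open>y'\<close> of \<open>U\<close> is parallel between the hubs \<open>P\<close>, \<open>Q\<close> if the hubs grow into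
  \<open>U\<close> until both branches see both of them, and in series if there is a middle part \<open>w\<close> that sees
  both branches.
\<close>

definition parallel :: "'a set \<Rightarrow> 'a set \<Rightarrow> 'a set \<Rightarrow> 'a set \<Rightarrow> 'a set \<Rightarrow> bool" where
  "parallel U P Q y y' \<longleftrightarrow> (\<exists>l r. l \<union> r \<subseteq> U - y - y' \<and> l \<inter> r = {} \<and> nbrs y \<subseteq> l \<union> r \<and> nbrs y' \<subseteq> l \<union> r \<and>
    adj y l \<and> adj y r \<and> adj y' l \<and> adj y' r \<and> conn (P \<union> l) \<and> conn (Q \<union> r) \<and>
    (conn l \<and> adj l P \<or> conn r \<and> adj r Q))"

definition weak_series :: "'a set \<Rightarrow> 'a set \<Rightarrow> 'a set \<Rightarrow> 'a set \<Rightarrow> 'a set \<Rightarrow> bool" where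
  "weak_series U P Q y y' \<longleftrightarrow> (\<exists>l w r. l \<union> w \<union> r = U - y - y' \<and> l \<inter> w = {} \<and> l \<inter> r = {} \<and> w \<inter> r = {} \<and>
    conn l \<and> conn w \<and> conn r \<and> adj l P \<and> adj r Q \<and> adj y l \<and> adj y w \<and> adj y' w \<and> adj y' r)"

lemma hubs_sym: "hubs U P Q \<Longrightarrow> hubs U Q P"
  unfolding hubs_def by blast

lemma split_pair_sym: "split_pair U y y' \<Longrightarrow> split_pair U y' y"
proof -
  have "U - y' - y = U - y - y'" by blast
  then show "split_pair U y y' \<Longrightarrow> split_pair U y' y"
    unfolding split_pair_def using adj_sym[of y y'] by auto
qed

lemma parallel_sym: "parallel U P Q y y' \<Longrightarrow> parallel U P Q y' y"
proof -
  have "U - y' - y = U - y - y'" by blast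
  then show "parallel U P Q y y' \<Longrightarrow> parallel U P Q y' y"
    unfolding parallel_def by (elim exE, rename_tac l r, rule_tac x = l in exI, rule_tac x = r in exI, simp)
qed

lemma parallel_flip: "parallel U P Q y y' \<Longrightarrow> parallel U Q P y y'"
  unfolding parallel_def
proof (elim exE)
  fix l r
  assume "l \<union> r \<subseteq> U - y - y' \<and> l \<inter> r = {} \<and> nbrs y \<subseteq> l \<union> r \<and> nbrs y' \<subseteq> l \<union> r \<and>
    adj y l \<and> adj y r \<and> adj y' l \<and> adj y' r \<and> conn (P \<union> l) \<and> conn (Q \<union> r) \<and>
    (conn l \<and> adj l P \<or> conn r \<and> adj r Q)"
  then show "\<exists>l r. l \<union> r \<subseteq> U - y - y' \<and> l \<inter> r = {} \<and> nbrs y \<subseteq> l \<union> r \<and> nbrs y' \<subseteq> l \<union> r \<and>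
    adj y l \<and> adj y r \<and> adj y' l \<and> adj y' r \<and> conn (Q \<union> l) \<and> conn (P \<union> r) \<and>
    (conn l \<and> adj l Q \<or> conn r \<and> adj r P)"
    by (intro exI[of _ r] exI[of _ l]) (simp add: Un_commute Int_commute disj_commute)
qed

lemma weak_series_flip: "weak_series U P Q y y' \<Longrightarrow> weak_series U Q P y' y"
  unfolding weak_series_def
proof (elim exE)
  fix l w r
  assume "l \<union> w \<union> r = U - y - y' \<and> l \<inter> w = {} \<and> l \<inter> r = {} \<and> w \<inter> r = {} \<and>
    conn l \<and> conn w \<and> conn r \<and> adj l P \<and> adj r Q \<and> adj y l \<and> adj y w \<and> adj y' w \<and> adj y' r"
  then show "\<exists>l w r. l \<union> w \<union> r = U - y' - y \<and> l \<inter> w = {} \<and> l \<inter> r = {} \<and> w \<inter> r = {} \<and>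
    conn l \<and> conn w \<and> conn r \<and> adj l Q \<and> adj r P \<and> adj y' l \<and> adj y' w \<and> adj y w \<and> adj y r"
    by (intro exI[of _ r] exI[of _ w] exI[of _ l]) (auto)
qed

text \<open>Three disjoint connected parts are enough: absorption extends them to a partition of the
  rest and can only add adjacencies.\<close>

lemma weak_seriesI:
  assumes s: "split_pair U y y'"
    and "l \<subseteq> U - y - y'" "w \<subseteq> U - y - y'" "r \<subseteq> U - y - y'" "l \<inter> w = {}" "l \<inter> r = {}" "w \<inter> r = {}"
    and "conn l" "conn w" "conn r" and a: "adj l P" "adj r Q" "adj y l" "adj y w" "adj y' w" "adj y' r"
  shows "weak_series U P Q y y'"
proof -
  have "U \<subseteq> V" using s unfolding split_pair_def by blast
  then have fin: "finite (U - y - y')" using finite_V finite_subset by blast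
  obtain l' w' r' where n: "l \<subseteq> l'" "w \<subseteq> w'" "r \<subseteq> r'" "conn l'" "conn w'" "conn r'"
    "l' \<inter> w' = {}" "l' \<inter> r' = {}" "w' \<inter> r' = {}" "l' \<union> w' \<union> r' = U - y - y'"
    by (rule absorb3[OF fin, of l w r]) (use assms in \<open>auto simp: split_pair_def\<close>)
  have "adj l' P" "adj r' Q" "adj y l'" "adj y w'" "adj y' w'" "adj y' r'"
    using adj_mono[OF a(1) n(1) order_refl] adj_mono[OF a(2) n(3) order_refl] adj_mono[OF a(3) order_refl n(1)]
      adj_mono[OF a(4) order_refl n(2)] adj_mono[OF a(5) order_refl n(2)] adj_mono[OF a(6) order_refl n(3)]
    by simp_all
  then show ?thesis unfolding weak_series_def using n by (intro exI[of _ l'] exI[of _ w'] exI[of _ r']) simp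
qed

text \<open>The contacts of \<open>m\<close> with \<open>y\<close> and with \<open>P\<close> lie
  outside \<open>y'\<close> by the last two assumptions. If no component of \<open>m - y'\<close>
  contains both, the two components that contain them touch \<open>y'\<close>: one connects
  \<open>y\<close> to \<open>y'\<close>, the other \<open>y'\<close> to \<open>P\<close>.\<close>

lemma trim:
  assumes m: "conn m" "adj y m" "adj m P" and y': "\<not> adj y y'" "\<not> adj y' P"
  shows "(\<exists>C\<subseteq>m - y'. conn C \<and> adj y C \<and> adj C P) \<or>
    (\<exists>w l. w \<subseteq> m - y' \<and> l \<subseteq> m - y' \<and> w \<inter> l = {} \<and> conn w \<and> conn l \<and> adj y w \<and> adj y' w \<and> adj y' l \<and> adj l P)"
proof (cases "m \<inter> y' = {}")
  case True then show ?thesis using m by blast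
next
  case False
  obtain s u where su: "s \<in> y" "u \<in> m" "E s u" using m(2) by (auto simp: adj_def)
  obtain v t where vt: "v \<in> m" "t \<in> P" "E v t" using m(3) by (auto simp: adj_def)
  have eq: "m - m \<inter> y' = m - y'" by blast
  have u: "u \<in> m - y'" and v: "v \<in> m - y'" using su vt y' by (auto simp: adj_def)
  let ?w = "component (m - y') u" and ?l = "component (m - y') v"
  note cu = component_props[OF u] and cv = component_props[OF v]
  have au: "adj y ?w" and av: "adj ?l P" using adjI su(1,3) vt(2,3) cu(1) cv(1) by metis+
  show ?thesis
  proof (cases "v \<in> ?w")
    case True
    then have "adj ?w P" using adjI vt(2,3) by metis
    then show ?thesis using cu au by blast
  next
    case False
    have "?w \<inter> ?l = {}"
    proof (rule ccontr)
      assume "?w \<inter> ?l \<noteq> {}"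
      then have "conn (?w \<union> ?l)" using conn_Un_meet cu(3) cv(3) by blast
      then have "?w \<union> ?l \<subseteq> ?w" using component_max[of "?w \<union> ?l" u "m - y'"] cu(1,2) cv(2) by blast
      then show False using False cv(1) by blast
    qed
    moreover have "adj ?w (m \<inter> y')" "adj ?l (m \<inter> y')"
      using component_adj_cut[OF m(1), of "m \<inter> y'" u] component_adj_cut[OF m(1), of "m \<inter> y'" v] u v False
        \<open>m \<inter> y' \<noteq> {}\<close> unfolding eq by blast+
    then have "adj y' ?w" "adj y' ?l" using adj_mono adj_sym by (metis Int_lower2 order_refl)+
    ultimately show ?thesis using cu(2,3) cv(2,3) au av by blast
  qed
qed

definition linked :: "'a set \<Rightarrow> 'a set \<Rightarrow> 'a set \<Rightarrow> 'a set \<Rightarrow> 'a set \<Rightarrow> 'a set \<Rightarrow> bool" where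
  "linked A y P Q l r \<longleftrightarrow> l \<subseteq> A \<and> r \<subseteq> A \<and> l \<inter> r = {} \<and> conn l \<and> conn r \<and> adj y l \<and> adj l P \<and> adj y r \<and> adj r Q"

lemma split_nonadj:
  assumes "split_pair U y y'" "hubs U P Q"
  shows "\<not> adj y P" "\<not> adj y Q" "\<not> adj y' P" "\<not> adj y' Q"
proof -
  have "\<not> adj x X" if "x \<subseteq> U" "nbrs x \<subseteq> U - y - y'" "U \<inter> X = {}" for x X
    using that unfolding adj_def nbrs_def by blast
  then show "\<not> adj y P" "\<not> adj y Q" "\<not> adj y' P" "\<not> adj y' Q"
    using assms unfolding split_pair_def hubs_def by simp_all
qed

lemma hubs_card: "hubs U P Q \<Longrightarrow> 2 \<le> card (V - U)"
proof -
  assume h: "hubs U P Q"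
  have "P \<noteq> {}" "Q \<noteq> {}" using h conn_nonempty unfolding hubs_def by simp_all
  then obtain p q where pq: "p \<in> P" "q \<in> Q" by blast
  then have "{p, q} \<subseteq> V - U" "p \<noteq> q" using h unfolding hubs_def by auto
  then show ?thesis using card_mono[of "V - U" "{p, q}"] finite_V by simp
qed

text \<open>Trim both connections of \<open>y\<close> at \<open>y'\<close>. If neither is broken,
  \<open>y\<close> is linked to both hubs. If exactly one is broken, its two pieces and the other
  connection form a series pair. If both are broken, their outer pieces link \<open>y'\<close> to
  both hubs.\<close>

lemma series_or_linked:
  assumes s: "split_pair U y y'" and h: "hubs U P Q"
  shows "weak_series U P Q y y' \<or> weak_series U P Q y' y \<or> (\<exists>l r. linked (U - y - y') y P Q l r) \<or>
    (\<exists>l r. linked (U - y - y') y' P Q l r)"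
proof -
  note na = split_nonadj[OF s h]
  have U: "conn U" "U \<subseteq> V" "y \<subseteq> U" "conn y" "2 \<le> card y" "\<not> adj y y'"
    "nbrs U \<subseteq> P \<union> Q" "adj U P" "adj U Q"
    using s h unfolding split_pair_def hubs_def by auto
  obtain m1 m2 where m: "m1 \<subseteq> U - y" "m2 \<subseteq> U - y" "m1 \<inter> m2 = {}" "link y m1 P" "link y m2 Q"
    using two_links[OF U(1,2) hubs_card[OF h] U(3-5) U(7-9)] by blast
  have l1: "conn m1" "adj y m1" "adj m1 P" and l2: "conn m2" "adj y m2" "adj m2 Q"
    using link_nonadj m(4,5) na by blast+
  note s' = split_pair_sym[OF s]
  from trim[OF l1 U(6) na(3)] show ?thesis
  proof
    assume "\<exists>C\<subseteq>m1 - y'. conn C \<and> adj y C \<and> adj C P"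
    then obtain C where C: "C \<subseteq> m1 - y'" "conn C" "adj y C" "adj C P" by blast
    from trim[OF l2 U(6) na(4)] show ?thesis
    proof
      assume "\<exists>C\<subseteq>m2 - y'. conn C \<and> adj y C \<and> adj C Q"
      then obtain D where D: "D \<subseteq> m2 - y'" "conn D" "adj y D" "adj D Q" by blast
      have "linked (U - y - y') y P Q C D" unfolding linked_def using C D m by blast
      then show ?thesis by blast
    next
      assume "\<exists>w l. w \<subseteq> m2 - y' \<and> l \<subseteq> m2 - y' \<and> w \<inter> l = {} \<and> conn w \<and> conn l \<and> adj y w \<and> adj y' w \<and> adj y' l \<and> adj l Q"
      then obtain w r where w: "w \<subseteq> m2 - y'" "r \<subseteq> m2 - y'" "w \<inter> r = {}" "conn w" "conn r"
        "adj y w" "adj y' w" "adj y' r" "adj r Q" by blast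
      have "weak_series U P Q y y'"
        by (rule weak_seriesI[OF s, of C w r]) (use C w m in blast)+
      then show ?thesis by blast
    qed
  next
    assume "\<exists>w l. w \<subseteq> m1 - y' \<and> l \<subseteq> m1 - y' \<and> w \<inter> l = {} \<and> conn w \<and> conn l \<and> adj y w \<and> adj y' w \<and> adj y' l \<and> adj l P"
    then obtain w l where w: "w \<subseteq> m1 - y'" "l \<subseteq> m1 - y'" "w \<inter> l = {}" "conn w" "conn l"
      "adj y w" "adj y' w" "adj y' l" "adj l P" by blast
    from trim[OF l2 U(6) na(4)] show ?thesis
    proof
      assume "\<exists>C\<subseteq>m2 - y'. conn C \<and> adj y C \<and> adj C Q"
      then obtain D where D: "D \<subseteq> m2 - y'" "conn D" "adj y D" "adj D Q" by blast
      have "weak_series U P Q y' y"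
        by (rule weak_seriesI[OF s', of l w D]) (use D w m in blast)+
      then show ?thesis by blast
    next
      assume "\<exists>w l. w \<subseteq> m2 - y' \<and> l \<subseteq> m2 - y' \<and> w \<inter> l = {} \<and> conn w \<and> conn l \<and> adj y w \<and> adj y' w \<and> adj y' l \<and> adj l Q"
      then obtain r where r: "r \<subseteq> m2 - y'" "conn r" "adj y' r" "adj r Q" by blast
      have "linked (U - y - y') y' P Q l r" unfolding linked_def using w r m by blast
      then show ?thesis by blast
    qed
  qed
qed

lemma conn_Un_Un:
  assumes "conn P" "conn X" "conn Y" "adj X P" "adj Y P" shows "conn (P \<union> (X \<union> Y))"
proof -
  have "conn (P \<union> X)" using conn_Un assms adj_sym by blast
  then have "conn (P \<union> X \<union> Y)" using conn_Un[of "P \<union> X" Y] assms adj_sym by auto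
  then show ?thesis by (simp add: Un_assoc)
qed

lemma linked_flip: "linked A y P Q l r \<Longrightarrow> linked A y Q P r l"
  unfolding linked_def by blast

lemma parallelI:
  assumes s: "split_pair U y y'" and h: "hubs U P Q"
    and "l \<union> r = U - y - y'" "l \<inter> r = {}" "adj y l" "adj y r" "adj y' l" "adj y' r" "conn (P \<union> l)" "conn (Q \<union> r)"
    "conn l \<and> adj l P \<or> conn r \<and> adj r Q"
  shows "parallel U P Q y y'"
  unfolding parallel_def using assms unfolding split_pair_def
  by (intro exI[of _ l] exI[of _ r]) simp

text \<open>
  The component \<open>K\<close> of \<open>y'\<close> outside the connection \<open>l \<union> y \<union> r\<close> decides: where it attaches gives a
  series or a parallel configuration.
\<close>

lemma linked_left:
  assumes s: "split_pair U y y'" and h: "hubs U P Q" and L: "linked (U - y - y') y P Q l r"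
    and K: "K = component (U - (l \<union> y \<union> r)) c" "c \<in> y'" and Kl: "adj K l"
    and l_split: "\<And>c d. c \<in> l \<Longrightarrow> d \<in> l \<Longrightarrow> c \<noteq> d \<Longrightarrow> \<exists>p q. p \<union> q = l \<and> p \<inter> q = {} \<and> conn p \<and> conn q \<and>
      adj y p \<and> adj q P \<and> (c \<in> p \<and> d \<in> q \<or> d \<in> p \<and> c \<in> q)"
  shows "weak_series U P Q y y' \<or> weak_series U P Q y' y \<or> parallel U P Q y y'"
proof -
  let ?A = "U - y - y'"
  note na = split_nonadj[OF s h] and s' = split_pair_sym[OF s]
  have S: "U \<subseteq> V" "y \<subseteq> U" "y' \<subseteq> U" "y \<inter> y' = {}" "conn y" "conn y'" "2 \<le> card y'" "\<not> adj y y'" "\<not> adj y' y"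
    "conn ?A"
    using s adj_sym unfolding split_pair_def by auto
  have hU: "conn P" "conn Q" "P \<inter> Q = {}" "U \<inter> P = {}" "U \<inter> Q = {}" "nbrs U \<subseteq> P \<union> Q"
    using h unfolding hubs_def by auto
  have Ll: "l \<subseteq> ?A" "r \<subseteq> ?A" "l \<inter> r = {}" "conn l" "conn r" "adj y l" "adj l P" "adj y r" "adj r Q"
    using L unfolding linked_def by auto
  have cK: "c \<in> U - (l \<union> y \<union> r)" using K(2) S Ll by blast
  note KP = component_props[OF cK, folded K(1)]
  have y'K: "y' \<subseteq> K" unfolding K(1) by (rule component_max) (use S K(2) Ll in auto)
  have KV: "K \<subseteq> V" and KU: "K \<subseteq> U" using KP(2) S(1) by auto
  have cVK: "2 \<le> card (V - K)"
  proof -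
    have "card (V - U) \<le> card (V - K)" using KU finite_V by (intro card_mono) auto
    then show ?thesis using hubs_card[OF h] by simp
  qed
  have nK: "nbrs K \<subseteq> l \<union> y \<union> r \<union> P \<union> Q"
  proof
    fix v assume "v \<in> nbrs K"
    then obtain u where u: "u \<in> K" "E u v" "v \<notin> K" by (auto simp: nbrs_def)
    show "v \<in> l \<union> y \<union> r \<union> P \<union> Q"
    proof (cases "v \<in> U")
      case True then show ?thesis using KP(4) u by (auto simp: adj_def)
    next
      case False
      then have "v \<in> nbrs U" using u KU by (auto simp: nbrs_def)
      then show ?thesis using hU by blast
    qed
  qed
  note links = two_links[OF KP(3) KV cVK y'K S(6,7)]
  have disK: "K \<inter> l = {}" "K \<inter> r = {}" "K \<inter> y = {}" using KP(2) by auto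
  have KA: "K - y' \<subseteq> ?A" using KU disK by blast
  have mK: "m \<subseteq> ?A" "m \<inter> l = {}" "m \<inter> r = {}" "l \<inter> m = {}" "r \<inter> m = {}" if "m \<subseteq> K - y'" for m
    using that KA disK by blast+
  have eqA: "U - y' - y = ?A" by blast
  note wsI = weak_seriesI[OF s] and wsI' = weak_seriesI[OF s', unfolded eqA]
  note distr = Int_Un_distrib Int_Un_distrib2
  have finA: "finite ?A" using S(1) finite_V finite_subset by blast
  show ?thesis
  proof (cases "adj K y")
    case True
    have "nbrs K \<subseteq> y \<union> (l \<union> r \<union> P \<union> Q)" "adj K (l \<union> r \<union> P \<union> Q)" using nK Kl by auto
    \<comment> \<open>The link from \<open>y'\<close> to \<open>y\<close> becomes the middle part.
      The target of the second link decides the order: \<open>l\<close> or \<open>P\<close> puts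
      \<open>y'\<close> on the side of \<open>P\<close>, \<open>r\<close> or \<open>Q\<close> puts
      it on the side of \<open>Q\<close>.\<close>
    from links[OF this(1) True this(2)] obtain m1 m2 where
      m: "m1 \<subseteq> K - y'" "m2 \<subseteq> K - y'" "m1 \<inter> m2 = {}" "link y' m1 y" "link y' m2 (l \<union> r \<union> P \<union> Q)" by blast
    have m1: "conn m1" "adj y' m1" "adj y m1" using link_nonadj[OF m(4) S(9)] adj_sym by auto
    have m21: "m2 \<inter> m1 = {}" using m(3) by blast
    note facts = m(3) m21 m1 Ll distr mK[OF m(1)] mK[OF m(2)]
    from m(5) consider "link y' m2 l" | "link y' m2 r" | "link y' m2 P" | "link y' m2 Q"
      unfolding link_Un by blast
    then show ?thesis
    proof cases
      case 1
      then have "conn (l \<union> m2)" "adj y' (l \<union> m2)" using link_conn Ll by auto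
      then have "weak_series U P Q y' y"
        by (intro wsI'[of "l \<union> m2" m1 r]) (simp_all add: facts)
      then show ?thesis by blast
    next
      case 2
      then have "conn (r \<union> m2)" "adj y' (r \<union> m2)" using link_conn Ll by auto
      then have "weak_series U P Q y y'"
        by (intro wsI[of l m1 "r \<union> m2"]) (simp_all add: facts)
      then show ?thesis by blast
    next
      case 3
      then have "conn m2" "adj y' m2" "adj m2 P" using link_nonadj na by blast+
      then have "weak_series U P Q y' y"
        by (intro wsI'[of m2 m1 r]) (simp_all add: facts)
      then show ?thesis by blast
    next
      case 4
      then have "conn m2" "adj y' m2" "adj m2 Q" using link_nonadj na by blast+
      then have "weak_series U P Q y y'"
        by (intro wsI[of l m1 m2]) (simp_all add: facts)
      then show ?thesis by blast
    qed
  next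
    case False
    then have "nbrs K \<inter> y = {}" using disK(3) by (auto simp: adj_def nbrs_def)
    then have nK': "nbrs K \<subseteq> l \<union> r \<union> P \<union> Q" using nK by blast
    show ?thesis
    proof (cases "adj K (r \<union> Q)")
      case True
      \<comment> \<open>\<open>K\<close> misses \<open>y\<close> but reaches both sides, so
        \<open>y'\<close> has a link to each side. A link ending in \<open>l\<close> or
        \<open>r\<close> is merged with it; a link ending in a hub is a separate second part on that
        side.\<close>
      have "nbrs K \<subseteq> (l \<union> P) \<union> (r \<union> Q)" "adj K (l \<union> P)" using nK' Kl by auto
      from links[OF this True] obtain m1 m2 where
        m: "m1 \<subseteq> K - y'" "m2 \<subseteq> K - y'" "m1 \<inter> m2 = {}" "link y' m1 (l \<union> P)" "link y' m2 (r \<union> Q)" by blast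
      have mA: "m1 \<subseteq> ?A" "m2 \<subseteq> ?A" "m1 \<inter> l = {}" "m1 \<inter> r = {}" "m2 \<inter> l = {}" "m2 \<inter> r = {}"
        using mK[OF m(1)] mK[OF m(2)] by auto
      have cPl: "conn (P \<union> X)" if "conn X" "adj X P" for X using conn_Un[of P X] that hU adj_sym by blast
      have cQr: "conn (Q \<union> X)" if "conn X" "adj X Q" for X using conn_Un[of Q X] that hU adj_sym by blast
      from m(4,5) consider "link y' m1 l" "link y' m2 r" | "link y' m1 P" "link y' m2 r"
        | "link y' m1 l" "link y' m2 Q" | "link y' m1 P" "link y' m2 Q" unfolding link_Un by blast
      then show ?thesis
      proof cases
        case 1
        then have c: "conn (l \<union> m1)" "adj y' (l \<union> m1)" "conn (r \<union> m2)" "adj y' (r \<union> m2)"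
          using link_conn Ll by auto
        obtain l' r' where n: "l \<union> m1 \<subseteq> l'" "r \<union> m2 \<subseteq> r'" "conn l'" "conn r'" "l' \<inter> r' = {}" "l' \<union> r' = ?A"
          by (rule absorb2[OF finA S(10) c(1,3)]) (use Ll mA m in auto)
        have a: "adj l' P" "adj r' Q" "adj y l'" "adj y r'" "adj y' l'" "adj y' r'"
          using adj_mono[OF Ll(7), of l' P] adj_mono[OF Ll(9), of r' Q] adj_mono[OF Ll(6), of y l']
            adj_mono[OF Ll(8), of y r'] adj_mono[OF c(2), of y' l'] adj_mono[OF c(4), of y' r'] n(1,2)
          by simp_all
        have "parallel U P Q y y'"
          by (rule parallelI[OF s h n(6,5)]) (use a n cPl cQr in auto)
        then show ?thesis by blast
      next
        case 2
        then have c: "conn m1" "adj y' m1" "adj m1 P" "conn (r \<union> m2)" "adj y' (r \<union> m2)"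
          using link_conn[OF 2(2)] link_nonadj[OF 2(1) na(3)] Ll by auto
        obtain l' n' r' where n: "l \<subseteq> l'" "m1 \<subseteq> n'" "r \<union> m2 \<subseteq> r'" "conn l'" "conn n'" "conn r'"
          "l' \<inter> n' = {}" "l' \<inter> r' = {}" "n' \<inter> r' = {}" "l' \<union> n' \<union> r' = ?A"
          by (rule absorb3[OF finA S(10) Ll(4) c(1,4)]) (use Ll mA m in auto)
        have a: "adj l' P" "adj n' P" "adj r' Q" "adj y l'" "adj y r'" "adj y' n'" "adj y' r'"
          using adj_mono[OF Ll(7), of l' P] adj_mono[OF c(3), of n' P] adj_mono[OF Ll(9), of r' Q] adj_mono[OF Ll(6), of y l']
            adj_mono[OF Ll(8), of y r'] adj_mono[OF c(2), of y' n'] adj_mono[OF c(5), of y' r'] n(1-3)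
          by simp_all
        have "conn (P \<union> (l' \<union> n'))" by (rule conn_Un_Un) (use hU n a in simp_all)
        then have "parallel U P Q y y'"
          by (intro parallelI[OF s h, of "l' \<union> n'" r']) (use a n cQr in auto)
        then show ?thesis by blast
      next
        case 3
        then have c: "conn m2" "adj y' m2" "adj m2 Q" "conn (l \<union> m1)" "adj y' (l \<union> m1)"
          using link_conn[OF 3(1)] link_nonadj[OF 3(2) na(4)] Ll by auto
        obtain l' r' n' where n: "l \<union> m1 \<subseteq> l'" "r \<subseteq> r'" "m2 \<subseteq> n'" "conn l'" "conn r'" "conn n'"
          "l' \<inter> r' = {}" "l' \<inter> n' = {}" "r' \<inter> n' = {}" "l' \<union> r' \<union> n' = ?A"
          by (rule absorb3[OF finA S(10) c(4) Ll(5) c(1)]) (use Ll mA m in auto)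
        have a: "adj l' P" "adj n' Q" "adj r' Q" "adj y l'" "adj y r'" "adj y' n'" "adj y' l'"
          using adj_mono[OF Ll(7), of l' P] adj_mono[OF c(3), of n' Q] adj_mono[OF Ll(9), of r' Q] adj_mono[OF Ll(6), of y l']
            adj_mono[OF Ll(8), of y r'] adj_mono[OF c(2), of y' n'] adj_mono[OF c(5), of y' l'] n(1-3)
          by simp_all
        have "conn (Q \<union> (r' \<union> n'))" by (rule conn_Un_Un) (use hU n a in simp_all)
        then have "parallel U P Q y y'"
          by (intro parallelI[OF s h, of l' "r' \<union> n'"]) (use a n cPl in auto)
        then show ?thesis by blast
      next
        case 4
        have c: "conn m1" "adj y' m1" "adj m1 P" "conn m2" "adj y' m2" "adj m2 Q"
          using link_nonadj[OF 4(1) na(3)] link_nonadj[OF 4(2) na(4)] by auto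
        obtain l' r' n1 n2 where n: "l \<subseteq> l'" "r \<subseteq> r'" "m1 \<subseteq> n1" "m2 \<subseteq> n2" "conn l'" "conn r'" "conn n1" "conn n2"
          "l' \<inter> r' = {}" "l' \<inter> n1 = {}" "r' \<inter> n1 = {}" "l' \<inter> n2 = {}" "r' \<inter> n2 = {}" "n1 \<inter> n2 = {}"
          "l' \<union> r' \<union> n1 \<union> n2 = ?A"
          by (rule absorb4[OF finA S(10) Ll(4,5) c(1,4)]) (use Ll mA m in auto)
        have a: "adj l' P" "adj r' Q" "adj n1 P" "adj n2 Q" "adj y l'" "adj y r'" "adj y' n1" "adj y' n2"
          using adj_mono[OF Ll(7), of l' P] adj_mono[OF Ll(9), of r' Q] adj_mono[OF c(3), of n1 P] adj_mono[OF c(6), of n2 Q]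
            adj_mono[OF Ll(6), of y l'] adj_mono[OF Ll(8), of y r'] adj_mono[OF c(2), of y' n1] adj_mono[OF c(5), of y' n2] n(1-4)
          by simp_all
        have cP: "conn (P \<union> (l' \<union> n1))" by (rule conn_Un_Un) (use hU n a in simp_all)
        have cQ: "conn (Q \<union> (r' \<union> n2))" by (rule conn_Un_Un) (use hU n a in simp_all)
        have ne: "l' \<noteq> {}" "n1 \<noteq> {}" using n conn_nonempty by auto
        \<comment> \<open>Each branch now has its own pair of connections to the hubs. As the rest
          is connected, an edge runs between the two pairs: on the same side it gives the connected
          part that \<open>parallel\<close> asks for, crosswise it gives the middle part of a
          series.\<close>
        have "adj (l' \<union> r') (?A - (l' \<union> r'))"
          by (rule connD[OF S(10)]) (use n ne in auto)
        moreover have "?A - (l' \<union> r') = n1 \<union> n2" using n by blast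
        ultimately have "adj l' n1 \<or> adj r' n2 \<or> adj l' n2 \<or> adj r' n1" by auto
        then show ?thesis
        proof (elim disjE)
          assume "adj l' n1"
          then have "conn (l' \<union> n1)" by (rule conn_Un[OF n(5,7)])
          then have "parallel U P Q y y'"
            by (intro parallelI[OF s h, of "l' \<union> n1" "r' \<union> n2"]) (use a n cP cQ in auto)
          then show ?thesis by blast
        next
          assume "adj r' n2"
          then have "conn (r' \<union> n2)" by (rule conn_Un[OF n(6,8)])
          then have "parallel U P Q y y'"
            by (intro parallelI[OF s h, of "l' \<union> n1" "r' \<union> n2"]) (use a n cP cQ in auto)
          then show ?thesis by blast
        next
          assume "adj l' n2"
          then have "conn (n2 \<union> l')" using conn_Un[OF n(8,5)] adj_sym by simp
          then have "weak_series U P Q y' y"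
            by (intro wsI'[of n1 "n2 \<union> l'" r']) (use a n in auto)
          then show ?thesis by blast
        next
          assume "adj r' n1"
          then have "conn (r' \<union> n1)" by (rule conn_Un[OF n(6,7)])
          then have "weak_series U P Q y y'"
            by (intro wsI[of l' "r' \<union> n1" n2]) (use a n in auto)
          then show ?thesis by blast
        qed
      qed
    next
      case False
      then have nrQ: "nbrs K \<subseteq> l \<union> P"
        using nK' disK KU hU by (auto simp: adj_def nbrs_def)
      show ?thesis
      proof (cases "adj K P")
        case True
        from links[OF nrQ Kl True] obtain m1 m2 where
          m: "m1 \<subseteq> K - y'" "m2 \<subseteq> K - y'" "m1 \<inter> m2 = {}" "link y' m1 l" "link y' m2 P" by blast
        have c: "conn m2" "adj y' m2" "adj m2 P" "conn (l \<union> m1)" "adj y' (l \<union> m1)"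
          using link_conn[OF m(4) Ll(4)] link_nonadj[OF m(5) na(3)] by auto
        have "weak_series U P Q y' y"
          by (rule wsI'[of m2 "l \<union> m1" r])
            (use m(3) c in \<open>simp_all add: Ll distr mK[OF m(1)] mK[OF m(2)] Int_commute\<close>)
        then show ?thesis by blast
      next
        case False
        then have nl: "nbrs K \<subseteq> l" using nrQ KU hU by (auto simp: adj_def nbrs_def)
        \<comment> \<open>\<open>K\<close> hangs on \<open>l\<close> alone, but 2-connectivity gives
          it two attachments. Cutting the path \<open>l\<close> between them makes the half near
          \<open>P\<close> the left part and the half near \<open>y\<close> the middle part, with
          \<open>y'\<close> seeing both.\<close>
        have "2 \<le> card (nbrs K)"
          using two_conn[of K] conn_nonempty[OF KP(3)] KV cVK by blast
        then obtain d e where de: "d \<in> nbrs K" "e \<in> nbrs K" "d \<noteq> e"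
          by (metis card_2_iff' card_le_Suc0_iff_eq finite_nbrs not_less_eq_eq numeral_2_eq_2)
        obtain p q where pq: "p \<union> q = l" "p \<inter> q = {}" "conn p" "conn q" "adj y p" "adj q P"
          "d \<in> p \<and> e \<in> q \<or> e \<in> p \<and> d \<in> q"
          using l_split[of d e] de nl by blast
        have "adj K p" "adj K q" using pq(7) de by (auto simp: adj_def nbrs_def)
        from links[of p q, OF _ this] nl pq(1) obtain m1 m2 where
          m: "m1 \<subseteq> K - y'" "m2 \<subseteq> K - y'" "m1 \<inter> m2 = {}" "link y' m1 p" "link y' m2 q" by blast
        have c: "conn (p \<union> m1)" "adj y' (p \<union> m1)" "conn (q \<union> m2)" "adj y' (q \<union> m2)"
          using link_conn m(4,5) pq by auto
        have pqA: "p \<subseteq> ?A" "q \<subseteq> ?A" "p \<inter> K = {}" "q \<inter> K = {}" "p \<inter> r = {}" "q \<inter> r = {}"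
          using pq(1) Ll disK by auto
        have pm: "p \<inter> m1 = {}" "p \<inter> m2 = {}" "q \<inter> m1 = {}" "q \<inter> m2 = {}" using m(1,2) pqA(3,4) by blast+
        have "weak_series U P Q y' y"
          by (rule wsI'[of "q \<union> m2" "p \<union> m1" r])
            (use m(3) pm c in \<open>simp_all add: Ll pq(2,5,6) pqA distr mK[OF m(1)] mK[OF m(2)] Int_commute\<close>)
        then show ?thesis by blast
      qed
    qed
  qed
qed

text \<open>Both connections are first thinned to paths, which the last case of
  \<open>linked_left\<close> relies on. Since the rest of \<open>U\<close> is connected, the
  component \<open>K\<close> touches \<open>l\<close> or \<open>r\<close>, and exchanging the hubs
  reduces the second case to the first.\<close>

lemma linked_series_or_parallel:
  assumes s: "split_pair U y y'" and h: "hubs U P Q" and L0: "linked (U - y - y') y P Q l0 r0"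
  shows "weak_series U P Q y y' \<or> weak_series U P Q y' y \<or> parallel U P Q y y'"
proof -
  let ?A = "U - y - y'"
  have L1: "l0 \<subseteq> ?A" "r0 \<subseteq> ?A" "l0 \<inter> r0 = {}" "conn l0" "conn r0" "adj y l0" "adj l0 P" "adj y r0" "adj r0 Q"
    using L0 unfolding linked_def by auto
  obtain l where l: "l \<subseteq> l0" "conn l" "adj y l" "adj l P"
    "\<And>c d. c \<in> l \<Longrightarrow> d \<in> l \<Longrightarrow> c \<noteq> d \<Longrightarrow> \<exists>p q. p \<union> q = l \<and> p \<inter> q = {} \<and> conn p \<and> conn q \<and>
      adj y p \<and> adj q P \<and> (c \<in> p \<and> d \<in> q \<or> d \<in> p \<and> c \<in> q)"
    by (rule path_split[OF L1(4,6,7)]) metis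
  obtain r where r: "r \<subseteq> r0" "conn r" "adj y r" "adj r Q"
    "\<And>c d. c \<in> r \<Longrightarrow> d \<in> r \<Longrightarrow> c \<noteq> d \<Longrightarrow> \<exists>p q. p \<union> q = r \<and> p \<inter> q = {} \<and> conn p \<and> conn q \<and>
      adj y p \<and> adj q Q \<and> (c \<in> p \<and> d \<in> q \<or> d \<in> p \<and> c \<in> q)"
    by (rule path_split[OF L1(5,8,9)]) metis
  have L: "linked ?A y P Q l r" unfolding linked_def using l(1-4) r(1-4) L1 by blast
  have S: "U \<subseteq> V" "y \<subseteq> U" "y' \<subseteq> U" "y \<inter> y' = {}" "conn y'" "conn ?A" "nbrs y' \<subseteq> ?A" "2 \<le> card y"
    using s unfolding split_pair_def by auto
  have lA: "l \<subseteq> ?A" "r \<subseteq> ?A" "l \<noteq> {}" "r \<noteq> {}" using l(1,2) r(1,2) L1 conn_nonempty by auto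
  obtain c where c: "c \<in> y'" using conn_nonempty S(5) by blast
  define K where "K = component (U - (l \<union> y \<union> r)) c"
  have cK: "c \<in> U - (l \<union> y \<union> r)" using c S lA by blast
  note KP = component_props[OF cK, folded K_def]
  have y'K: "y' \<subseteq> K" unfolding K_def by (rule component_max) (use S c lA in auto)
  have "2 \<le> card (nbrs y')"
  proof (rule two_conn)
    show "y' \<noteq> {}" "y' \<subseteq> V" using c S by auto
    have "card y \<le> card (V - y')" using S finite_V by (intro card_mono) auto
    then show "2 \<le> card (V - y')" using S(8) by simp
  qed
  then have "nbrs y' \<noteq> {}" by auto
  then obtain n where n: "n \<in> nbrs y'" by blast
  then obtain u where u: "u \<in> y'" "E u n" "n \<in> ?A" using S(7) by (auto simp: nbrs_def)
  have "adj K (l \<union> r)"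
  proof (cases "n \<in> l \<union> r")
    case True then show ?thesis using u y'K by (auto simp: adj_def)
  next
    case False
    then have nK: "n \<in> K" using KP(4) u y'K by (auto simp: adj_def)
    have "adj (?A \<inter> K) (?A - ?A \<inter> K)"
      by (rule connD[OF S(6)]) (use u nK lA KP(2) in auto)
    then obtain a b where ab: "a \<in> K" "a \<in> ?A" "b \<in> ?A" "b \<notin> K" "E a b" by (auto simp: adj_def)
    then have "b \<in> l \<union> r" using KP(4) by (auto simp: adj_def)
    then show ?thesis using ab by (auto simp: adj_def)
  qed
  then consider "adj K l" | "adj K r" by auto
  then show ?thesis
  proof cases
    case 1
    show ?thesis by (rule linked_left[OF s h L K_def c 1 l(5)])
  next
    case 2
    have K': "K = component (U - (r \<union> y \<union> l)) c" unfolding K_def by (simp add: Un_ac)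
    have "weak_series U Q P y y' \<or> weak_series U Q P y' y \<or> parallel U Q P y y'"
      by (rule linked_left[OF s hubs_sym[OF h] linked_flip[OF L] K' c 2 r(5)])
    then show ?thesis using weak_series_flip parallel_flip by blast
  qed
qed

theorem series_or_parallel:
  assumes s: "split_pair U y y'" and h: "hubs U P Q"
  shows "weak_series U P Q y y' \<or> weak_series U P Q y' y \<or> parallel U P Q y y'"
proof -
  have eq: "U - y' - y = U - y - y'" by blast
  consider "weak_series U P Q y y' \<or> weak_series U P Q y' y" | l r where "linked (U - y - y') y P Q l r"
    | l r where "linked (U - y' - y) y' P Q l r"
    using series_or_linked[OF s h] unfolding eq by blast
  then show ?thesis
  proof cases
    case 1 then show ?thesis by blast
  next
    case 2 then show ?thesis using linked_series_or_parallel[OF s h] by blast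
  next
    case 3
    then have "weak_series U P Q y' y \<or> weak_series U P Q y y' \<or> parallel U P Q y' y"
      using linked_series_or_parallel[OF split_pair_sym[OF s] h] by blast
    then show ?thesis using parallel_sym by blast
  qed
qed

end

section \<open>Strict series pairs and their defects\<close>

context two_conn_graph begin

text \<open>Each branch sees only its own two parts, so \<open>w\<close> can be used as a common
  hub: \<open>y\<close> lies between \<open>P \<union> l\<close> and \<open>w\<close>, and
  \<open>y'\<close> between \<open>w\<close> and \<open>Q \<union> r\<close>.\<close>

definition series :: "'a set \<Rightarrow> 'a set \<Rightarrow> 'a set \<Rightarrow> 'a set \<Rightarrow> 'a set \<Rightarrow> bool" where
  "series U P Q y y' \<longleftrightarrow> (\<exists>l w r. l \<union> w \<union> r \<subseteq> U - y - y' \<and> l \<inter> w = {} \<and> l \<inter> r = {} \<and> w \<inter> r = {} \<and>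
    nbrs y \<subseteq> l \<union> w \<and> nbrs y' \<subseteq> w \<union> r \<and> adj y l \<and> adj y w \<and> adj y' w \<and> adj y' r \<and>
    conn (P \<union> l) \<and> conn (Q \<union> r) \<and> conn w \<and> (adj w l \<or> adj w r))"

text \<open>The remaining possibility: \<open>y'\<close> hangs between \<open>w\<close> and \<open>r\<close> only, while \<open>y\<close> may see all three parts.\<close>

definition pendant :: "'a set \<Rightarrow> 'a set \<Rightarrow> 'a set \<Rightarrow> 'a set \<Rightarrow> 'a set \<Rightarrow> 'a set \<Rightarrow> 'a set \<Rightarrow> 'a set \<Rightarrow> bool" where
  "pendant U P Q y y' l w r \<longleftrightarrow> l \<union> w \<union> r = U - y - y' \<and> l \<inter> w = {} \<and> l \<inter> r = {} \<and> w \<inter> r = {} \<and>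
    conn l \<and> conn w \<and> conn r \<and> adj l P \<and> adj r Q \<and> adj y l \<and> adj y w \<and> adj y' w \<and> adj y' r \<and>
    nbrs y' \<subseteq> w \<union> r \<and> adj w r"

lemma series_flip: "series U P Q y y' \<Longrightarrow> series U Q P y' y"
  unfolding series_def
proof (elim exE)
  fix l w r
  assume "l \<union> w \<union> r \<subseteq> U - y - y' \<and> l \<inter> w = {} \<and> l \<inter> r = {} \<and> w \<inter> r = {} \<and>
    nbrs y \<subseteq> l \<union> w \<and> nbrs y' \<subseteq> w \<union> r \<and> adj y l \<and> adj y w \<and> adj y' w \<and> adj y' r \<and>
    conn (P \<union> l) \<and> conn (Q \<union> r) \<and> conn w \<and> (adj w l \<or> adj w r)"
  then show "\<exists>l w r. l \<union> w \<union> r \<subseteq> U - y' - y \<and> l \<inter> w = {} \<and> l \<inter> r = {} \<and> w \<inter> r = {} \<and>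
    nbrs y' \<subseteq> l \<union> w \<and> nbrs y \<subseteq> w \<union> r \<and> adj y' l \<and> adj y' w \<and> adj y w \<and> adj y r \<and>
    conn (Q \<union> l) \<and> conn (P \<union> r) \<and> conn w \<and> (adj w l \<or> adj w r)"
    by (intro exI[of _ r] exI[of _ w] exI[of _ l]) (simp add: Un_ac Int_commute disj_commute Diff_eq Int_left_commute Int_assoc)
qed

lemma conn_adj_Un: "conn P \<Longrightarrow> conn l \<Longrightarrow> adj l P \<Longrightarrow> conn (P \<union> l)"
  using conn_Un[of P l] adj_sym by blast

lemma nonadj_nbrs: "nbrs y \<subseteq> X \<union> Y \<Longrightarrow> \<not> adj y Y \<Longrightarrow> nbrs y \<subseteq> X"
  unfolding adj_def nbrs_def by blast

text \<open>By connectedness of the rest, \<open>w\<close> touches \<open>l\<close> or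
  \<open>r\<close>. If it touches \<open>l\<close> and \<open>y\<close> sees \<open>r\<close>,
  merging \<open>w\<close> into \<open>l\<close> makes the pair parallel; the mirrored case is
  alike. With no unwanted contact the pair is in series, and what remains is a pendant branch on the
  side that \<open>w\<close> touches.\<close>

lemma weak_series_cases:
  assumes s: "split_pair U y y'" and h: "hubs U P Q" and ws: "weak_series U P Q y y'"
  shows "parallel U P Q y y' \<or> series U P Q y y' \<or>
    (\<exists>l w r. pendant U P Q y y' l w r) \<or> (\<exists>l w r. pendant U Q P y' y l w r)"
proof -
  let ?A = "U - y - y'"
  obtain l w r where n: "l \<union> w \<union> r = ?A" "l \<inter> w = {}" "l \<inter> r = {}" "w \<inter> r = {}" "conn l" "conn w" "conn r"
    "adj l P" "adj r Q" "adj y l" "adj y w" "adj y' w" "adj y' r"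
    using ws unfolding weak_series_def by (elim exE conjE) simp
  have S: "conn ?A" "nbrs y \<subseteq> ?A" "nbrs y' \<subseteq> ?A" using s unfolding split_pair_def by simp_all
  have hU: "conn P" "conn Q" using h unfolding hubs_def by simp_all
  have ne: "l \<noteq> {}" "w \<noteq> {}" using n conn_nonempty by auto
  have "adj w (?A - w)" by (rule connD[OF S(1)]) (use n(1,2) ne in auto)
  moreover have "?A - w = l \<union> r" using n(1-4) by blast
  ultimately have w: "adj w l \<or> adj w r" by simp
  have cP: "conn (P \<union> l)" and cQ: "conn (Q \<union> r)" using conn_adj_Un hU n by simp_all
  have wl: "parallel U P Q y y'" if "adj w l" "adj y r"
  proof (rule parallelI[OF s h, of "l \<union> w" r])
    have c: "conn (l \<union> w)" using conn_Un[OF n(5,6)] that adj_sym by simp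
    then show "conn (P \<union> (l \<union> w))" using conn_adj_Un hU n by simp
    show "conn (l \<union> w) \<and> adj (l \<union> w) P \<or> conn r \<and> adj r Q" using c n by simp
  qed (use n that cQ in \<open>auto simp: Int_Un_distrib2\<close>)
  have wr: "parallel U P Q y y'" if "adj w r" "adj y' l"
  proof (rule parallelI[OF s h, of l "w \<union> r"])
    have c: "conn (w \<union> r)" using conn_Un[OF n(6,7)] that by simp
    then show "conn (Q \<union> (w \<union> r))" using conn_adj_Un hU n by simp
    show "conn l \<and> adj l P \<or> conn (w \<union> r) \<and> adj (w \<union> r) Q" using c n by simp
  qed (use n that cP in \<open>auto simp: Int_Un_distrib\<close>)
  have nl: "nbrs y' \<subseteq> w \<union> r" if "\<not> adj y' l"
    by (rule nonadj_nbrs[OF _ that]) (use S(3) n(1) in auto)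
  have nr: "nbrs y \<subseteq> l \<union> w" if "\<not> adj y r"
    by (rule nonadj_nbrs[OF _ that]) (use S(2) n(1) in auto)
  consider "adj y r" "adj w l" | "adj y' l" "adj w r" | "\<not> adj y r" "\<not> adj y' l"
    | "\<not> adj y' l" "adj w r" | "\<not> adj y r" "adj w l" using w by blast
  then show ?thesis
  proof cases
    case 1 then show ?thesis using wl by simp
  next
    case 2 then show ?thesis using wr by simp
  next
    case 3
    have "series U P Q y y'" unfolding series_def
      using n nl[OF 3(2)] nr[OF 3(1)] cP cQ w by (intro exI[of _ l] exI[of _ w] exI[of _ r]) simp
    then show ?thesis by simp
  next
    case 4
    then have "pendant U P Q y y' l w r" unfolding pendant_def using n nl by simp
    then show ?thesis by blast
  next
    case 5
    have "U - y' - y = ?A" by blast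
    then have "pendant U Q P y' y r w l" unfolding pendant_def using 5 n nr
      by (simp add: Un_ac Int_commute)
    then show ?thesis by blast
  qed
qed

lemma pair_cases:
  assumes s: "split_pair U y y'" and h: "hubs U P Q"
  shows "parallel U P Q y y' \<or> series U P Q y y' \<or> series U P Q y' y \<or>
    (\<exists>l w r. pendant U P Q y y' l w r) \<or> (\<exists>l w r. pendant U P Q y' y l w r) \<or>
    (\<exists>l w r. pendant U Q P y y' l w r) \<or> (\<exists>l w r. pendant U Q P y' y l w r)"
  using series_or_parallel[OF s h] weak_series_cases[OF s h] weak_series_cases[OF split_pair_sym[OF s] h]
    parallel_sym by metis

section \<open>Clean pairs from two levels of nesting\<close>

fun nested :: "nat \<Rightarrow> 'a set \<Rightarrow> bool" where
  "nested 0 U \<longleftrightarrow> U \<subseteq> V \<and> conn U \<and> 2 \<le> card U"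
| "nested (Suc h) U \<longleftrightarrow> (\<exists>y y'. split_pair U y y' \<and> nested h y \<and> nested h y')"

lemma split_pair_card: "split_pair U y y' \<Longrightarrow> 2 \<le> card U"
proof -
  assume s: "split_pair U y y'"
  then have "card y \<le> card U" using finite_V finite_subset unfolding split_pair_def by (intro card_mono) blast+
  then show ?thesis using s unfolding split_pair_def by linarith
qed

lemma nested_basic: "nested h U \<Longrightarrow> U \<subseteq> V \<and> conn U \<and> 2 \<le> card U"
proof (cases h)
  case (Suc k)
  assume "nested h U"
  then obtain y y' where y: "split_pair U y y'" using Suc by auto
  show ?thesis using split_pair_card[OF y] y by (simp add: split_pair_def)
qed simp

lemma nested_mono: "nested h U \<Longrightarrow> h' \<le> h \<Longrightarrow> nested h' U"
proof (induction h arbitrary: U h')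
  case (Suc h)
  then obtain y y' where y: "split_pair U y y'" "nested h y" "nested h y'" by auto
  show ?case
  proof (cases h')
    case 0 then show ?thesis using nested_basic[OF Suc.prems(1)] by simp
  next
    case (Suc k)
    then have "nested k y" "nested k y'" using Suc.IH y Suc.prems(2) by auto
    then show ?thesis using y(1) Suc by auto
  qed
qed simp

definition good_pair :: "nat \<Rightarrow> 'a set \<Rightarrow> 'a set \<Rightarrow> 'a set \<Rightarrow> bool" where
  "good_pair h U P Q \<longleftrightarrow> (\<exists>p p'. p \<subseteq> U \<and> p' \<subseteq> U \<and> p \<inter> p' = {} \<and> nested h p \<and> nested h p' \<and>
    (parallel U P Q p p' \<or> series U P Q p p'))"

lemma good_pair_flip: "good_pair h U Q P \<Longrightarrow> good_pair h U P Q"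
  unfolding good_pair_def
proof (elim exE conjE)
  fix p p' assume p: "p \<subseteq> U" "p' \<subseteq> U" "p \<inter> p' = {}" "nested h p" "nested h p'"
    and "parallel U Q P p p' \<or> series U Q P p p'"
  then have "parallel U P Q p p' \<or> series U P Q p' p" using parallel_flip series_flip by blast
  then show "\<exists>p p'. p \<subseteq> U \<and> p' \<subseteq> U \<and> p \<inter> p' = {} \<and> nested h p \<and> nested h p' \<and>
    (parallel U P Q p p' \<or> series U P Q p p')"
  proof
    assume "parallel U P Q p p'"
    then show ?thesis using p by (intro exI[of _ p] exI[of _ p']) simp
  next
    assume "series U P Q p' p"
    then show ?thesis using p by (intro exI[of _ p'] exI[of _ p]) (simp add: Int_commute)
  qed
qed

text \<open>The inner hubs \<open>L\<close> and \<open>R\<close> are connected and touch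
  \<open>P\<close> and \<open>Q\<close>, so they are simply added to the left and right parts of the
  inner configuration.\<close>

lemma good_pair_inner:
  assumes g: "good_pair h y L R" and y: "y \<subseteq> U" and LR: "L \<union> R \<subseteq> U - y" "L \<inter> R = {}"
    and c: "conn L" "conn R" "adj L P" "adj R Q" "conn P" "conn Q"
  shows "good_pair h U P Q"
proof -
  obtain p p' where p: "p \<subseteq> y" "p' \<subseteq> y" "p \<inter> p' = {}" "nested h p" "nested h p'"
    and ps: "parallel y L R p p' \<or> series y L R p p'" using g unfolding good_pair_def by (elim exE conjE) simp
  have LRp: "L \<union> R \<subseteq> U - p - p'" using LR p by blast
  have cP: "conn (P \<union> (L \<union> l))" if "conn (L \<union> l)" for l
    by (rule conn_adj_Un) (use c that in auto)
  have cQ: "conn (Q \<union> (R \<union> l))" if "conn (R \<union> l)" for l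
    by (rule conn_adj_Un) (use c that in auto)
  from ps have "parallel U P Q p p' \<or> series U P Q p p'"
  proof
    assume "parallel y L R p p'"
    then obtain l r where n: "l \<union> r \<subseteq> y - p - p'" "l \<inter> r = {}" "nbrs p \<subseteq> l \<union> r" "nbrs p' \<subseteq> l \<union> r"
      "adj p l" "adj p r" "adj p' l" "adj p' r" "conn (L \<union> l)" "conn (R \<union> r)"
      unfolding parallel_def by (elim exE conjE) simp
    have "parallel U P Q p p'" unfolding parallel_def
    proof (rule exI[of _ "L \<union> l"], rule exI[of _ "R \<union> r"], intro conjI)
      show "L \<union> l \<union> (R \<union> r) \<subseteq> U - p - p'" using n(1) LRp y by blast
      show "(L \<union> l) \<inter> (R \<union> r) = {}" using n(1,2) LR by blast
      show "conn (L \<union> l) \<and> adj (L \<union> l) P \<or> conn (R \<union> r) \<and> adj (R \<union> r) Q" using n c by simp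
    qed (use n cP cQ in auto)
    then show ?thesis ..
  next
    assume "series y L R p p'"
    then obtain l w r where n: "l \<union> w \<union> r \<subseteq> y - p - p'" "l \<inter> w = {}" "l \<inter> r = {}" "w \<inter> r = {}"
      "nbrs p \<subseteq> l \<union> w" "nbrs p' \<subseteq> w \<union> r" "adj p l" "adj p w" "adj p' w" "adj p' r"
      "conn (L \<union> l)" "conn (R \<union> r)" "conn w" "adj w l \<or> adj w r"
      unfolding series_def by (elim exE conjE) simp
    have "series U P Q p p'" unfolding series_def
    proof (rule exI[of _ "L \<union> l"], rule exI[of _ w], rule exI[of _ "R \<union> r"], intro conjI)
      show "L \<union> l \<union> w \<union> (R \<union> r) \<subseteq> U - p - p'" using n(1) LRp y by blast
      show "(L \<union> l) \<inter> w = {}" "(L \<union> l) \<inter> (R \<union> r) = {}" "w \<inter> (R \<union> r) = {}" using n(1-4) LR by blast+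
      show "adj w (L \<union> l) \<or> adj w (R \<union> r)" using n(14) by auto
    qed (use n cP cQ in auto)
    then show ?thesis ..
  qed
  then show ?thesis unfolding good_pair_def using p y by (intro exI[of _ p] exI[of _ p']) auto
qed

lemma parallelI':
  assumes "l \<union> r \<subseteq> U - y - y'" "l \<inter> r = {}" "nbrs y \<subseteq> l \<union> r" "nbrs y' \<subseteq> l \<union> r"
    "adj y l" "adj y r" "adj y' l" "adj y' r" "conn l" "conn r" "adj l P" "adj r Q" "conn P" "conn Q"
  shows "parallel U P Q y y'"
  unfolding parallel_def using assms conn_adj_Un by (intro exI[of _ l] exI[of _ r]) simp

lemma seriesI':
  assumes "l \<union> w \<union> r \<subseteq> U - y - y'" "l \<inter> w = {}" "l \<inter> r = {}" "w \<inter> r = {}"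
    "nbrs y \<subseteq> l \<union> w" "nbrs y' \<subseteq> w \<union> r" "adj y l" "adj y w" "adj y' w" "adj y' r"
    "conn l" "conn w" "conn r" "adj l P" "adj r Q" "conn P" "conn Q" "adj w l \<or> adj w r"
  shows "series U P Q y y'"
  unfolding series_def using assms conn_adj_Un by (intro exI[of _ l] exI[of _ w] exI[of _ r]) simp

text \<open>The clean pair consists of the two pendant branches \<open>z'\<close> and
  \<open>y'\<close>. Each sees only two parts of its own level, so the other inner branch
  \<open>z\<close> serves as mere connecting material between parts. Whether the free inner part
  attaches to \<open>w\<close> or passes it and attaches to \<open>r\<close> decides between series
  and parallel.\<close>

lemma pendant_pendant:
  assumes h: "hubs U P Q" and s: "split_pair U y y'" and pd: "pendant U P Q y y' l w r"
    and sz: "split_pair y z z'" and pz: "pendant y l (w \<union> r) z z' l2 w2 r2 \<or> pendant y (w \<union> r) l z z' l2 w2 r2"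
  shows "parallel U P Q z' y' \<or> series U P Q z' y'"
proof -
  have hU: "conn P" "conn Q" using h unfolding hubs_def by simp_all
  have S: "y \<subseteq> U" "y' \<subseteq> U" "y \<inter> y' = {}" "conn y" using s unfolding split_pair_def by simp_all
  have Z: "z \<subseteq> y" "z' \<subseteq> y" "z \<inter> z' = {}" "conn z" "nbrs z \<subseteq> y - z - z'" "nbrs z' \<subseteq> y - z - z'"
    using sz unfolding split_pair_def by simp_all
  have n: "l \<union> w \<union> r = U - y - y'" "l \<inter> w = {}" "l \<inter> r = {}" "w \<inter> r = {}" "conn l" "conn w" "conn r"
    "adj l P" "adj r Q" "adj y w" "adj y' w" "adj y' r" "nbrs y' \<subseteq> w \<union> r" "adj w r"
    using pd unfolding pendant_def by simp_all
  have sets: "l \<inter> y = {}" "w \<inter> y = {}" "r \<inter> y = {}" "l \<inter> y' = {}" "w \<inter> y' = {}" "r \<inter> y' = {}"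
    "l \<subseteq> U" "w \<subseteq> U" "r \<subseteq> U" using n(1) by blast+
  have D: "l \<inter> X = {}" "w \<inter> X = {}" "r \<inter> X = {}" "X \<inter> l = {}" "X \<inter> w = {}" "X \<inter> r = {}" if "X \<subseteq> y" for X
    using that sets(1-3) by blast+
  have outer: "l \<subseteq> U - z' - y'" "w \<subseteq> U - z' - y'" "r \<subseteq> U - z' - y'" using sets Z(2) by blast+
  have inn: "X \<subseteq> U - z' - y'" if "X \<subseteq> y" "X \<inter> z' = {}" for X using that S(1,3) by blast
  note distr = Int_Un_distrib Int_Un_distrib2
  \<comment> \<open>All neighbours of \<open>z\<close> and \<open>z'\<close> lie in
    \<open>y\<close>, hence an edge from \<open>w\<close> into \<open>y\<close> must end in one of
    the three inner parts.\<close>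
  have wz: "\<not> adj w z" "\<not> adj w z'"
  proof -
    have "\<not> adj x w" if "x \<subseteq> y" "nbrs x \<subseteq> y - z - z'" for x
      using that sets(2) unfolding adj_def nbrs_def by blast
    then have "\<not> adj z w" "\<not> adj z' w" using Z by simp_all
    then show "\<not> adj w z" "\<not> adj w z'" using adj_sym by blast+
  qed
  from pz show ?thesis
  proof
    assume p: "pendant y l (w \<union> r) z z' l2 w2 r2"
    have m: "l2 \<union> w2 \<union> r2 = y - z - z'" "l2 \<inter> w2 = {}" "l2 \<inter> r2 = {}" "w2 \<inter> r2 = {}" "conn l2" "conn w2" "conn r2"
      "adj l2 l" "adj r2 (w \<union> r)" "adj z l2" "adj z w2" "adj z' w2" "adj z' r2" "nbrs z' \<subseteq> w2 \<union> r2"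
      using p unfolding pendant_def by simp_all
    have zs: "l2 \<subseteq> y" "w2 \<subseteq> y" "r2 \<subseteq> y" "l2 \<inter> z = {}" "w2 \<inter> z = {}" "r2 \<inter> z = {}" "l2 \<inter> z' = {}" "w2 \<inter> z' = {}" "r2 \<inter> z' = {}"
      using m(1) by blast+
    have zc: "z \<inter> l2 = {}" "z \<inter> w2 = {}" "z \<inter> r2 = {}" "w2 \<inter> l2 = {}" "r2 \<inter> l2 = {}" "r2 \<inter> w2 = {}"
      using zs(4-6) m(2-4) by blast+
    note disj = zs zc m(2-4) n(2-4) D[OF zs(1)] D[OF zs(2)] D[OF zs(3)] D[OF Z(1)]
    note subs = outer inn[OF zs(1,7)] inn[OF zs(2,8)] inn[OF zs(3,9)] inn[OF Z(1,3)]
    have "conn (l \<union> l2)" using conn_Un[OF n(5) m(5)] m(8) adj_sym by simp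
    then have "conn (l \<union> l2 \<union> z)" using conn_Un[OF _ Z(4)] m(10) adj_sym by simp
    then have cl: "conn (l \<union> l2 \<union> z \<union> w2)" using conn_Un[OF _ m(6)] m(11) by simp
    show ?thesis
    proof (cases "adj r2 w")
      case True
      have "series U P Q z' y'"
      proof (rule seriesI'[of "l \<union> l2 \<union> z \<union> w2" "r2 \<union> w" r])
        show "l \<union> l2 \<union> z \<union> w2 \<union> (r2 \<union> w) \<union> r \<subseteq> U - z' - y'" by (simp add: subs)
        show "(l \<union> l2 \<union> z \<union> w2) \<inter> (r2 \<union> w) = {}" "(l \<union> l2 \<union> z \<union> w2) \<inter> r = {}" "(r2 \<union> w) \<inter> r = {}"
          by (simp_all add: distr disj)
        show "nbrs z' \<subseteq> l \<union> l2 \<union> z \<union> w2 \<union> (r2 \<union> w)" "nbrs y' \<subseteq> r2 \<union> w \<union> r" using m(14) n(13) by blast+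
        show "conn (r2 \<union> w)" by (rule conn_Un[OF m(7) n(6) True])
      qed (use cl m n hU in simp_all)
      then show ?thesis ..
    next
      case False
      then have r2: "adj r2 r" using m(9) by simp
      have "adj w y" using n(10) adj_sym by blast
      moreover have "y = l2 \<union> w2 \<union> r2 \<union> z \<union> z'" using m(1) Z by blast
      ultimately have "adj w (l2 \<union> w2 \<union> r2 \<union> z \<union> z')" by simp
      then have "adj w l2 \<or> adj w w2" using wz False adj_sym by auto
      then have "conn (l \<union> l2 \<union> z \<union> w2 \<union> w)" using conn_Un[OF cl n(6)] adj_sym by auto
      moreover have "conn (r2 \<union> r)" by (rule conn_Un[OF m(7) n(7) r2])
      ultimately have "parallel U P Q z' y'"
      proof (intro parallelI'[of "l \<union> l2 \<union> z \<union> w2 \<union> w" "r2 \<union> r"])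
        show "l \<union> l2 \<union> z \<union> w2 \<union> w \<union> (r2 \<union> r) \<subseteq> U - z' - y'" by (simp add: subs)
        show "(l \<union> l2 \<union> z \<union> w2 \<union> w) \<inter> (r2 \<union> r) = {}" by (simp_all add: distr disj)
        show "nbrs z' \<subseteq> l \<union> l2 \<union> z \<union> w2 \<union> w \<union> (r2 \<union> r)" "nbrs y' \<subseteq> l \<union> l2 \<union> z \<union> w2 \<union> w \<union> (r2 \<union> r)"
          using m(14) n(13) by blast+
      qed (use m n hU in simp_all)
      then show ?thesis ..
    qed
  next
    assume p: "pendant y (w \<union> r) l z z' l2 w2 r2"
    have m: "l2 \<union> w2 \<union> r2 = y - z - z'" "l2 \<inter> w2 = {}" "l2 \<inter> r2 = {}" "w2 \<inter> r2 = {}" "conn l2" "conn w2" "conn r2"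
      "adj l2 (w \<union> r)" "adj r2 l" "adj z l2" "adj z w2" "adj z' w2" "adj z' r2" "nbrs z' \<subseteq> w2 \<union> r2" "adj w2 r2"
      using p unfolding pendant_def by simp_all
    have zs: "l2 \<subseteq> y" "w2 \<subseteq> y" "r2 \<subseteq> y" "l2 \<inter> z = {}" "w2 \<inter> z = {}" "r2 \<inter> z = {}" "l2 \<inter> z' = {}" "w2 \<inter> z' = {}" "r2 \<inter> z' = {}"
      using m(1) by blast+
    have zc: "z \<inter> l2 = {}" "z \<inter> w2 = {}" "z \<inter> r2 = {}" "w2 \<inter> l2 = {}" "r2 \<inter> l2 = {}" "r2 \<inter> w2 = {}"
      using zs(4-6) m(2-4) by blast+
    note disj = zs zc m(2-4) n(2-4) D[OF zs(1)] D[OF zs(2)] D[OF zs(3)] D[OF Z(1)]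
    note subs = outer inn[OF zs(1,7)] inn[OF zs(2,8)] inn[OF zs(3,9)] inn[OF Z(1,3)]
    have cl: "conn (l \<union> r2)" using conn_Un[OF n(5) m(7)] m(9) adj_sym by simp
    have "conn (w2 \<union> z)" using conn_Un[OF m(6) Z(4)] m(11) adj_sym by simp
    then have cm: "conn (w2 \<union> z \<union> l2)" using conn_Un[OF _ m(5)] m(10) by simp
    \<comment> \<open>The middle part \<open>M\<close> always contains \<open>w2\<close> and
      \<open>w\<close>; it takes in \<open>z\<close> and \<open>l2\<close> as well when the contact
      with \<open>w\<close> runs through \<open>l2\<close>.\<close>
    have ser: "series U P Q z' y'" if M: "conn M" "w2 \<union> w \<subseteq> M" "M \<subseteq> w2 \<union> z \<union> l2 \<union> w" for M
    proof -
      have MS: "M \<subseteq> U - z' - y'" by (rule order_trans[OF M(3)]) (simp add: subs)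
      let ?B = "w2 \<union> z \<union> l2 \<union> w"
      have "l \<inter> ?B = {}" "r2 \<inter> ?B = {}" "?B \<inter> r = {}" by (simp_all add: distr disj)
      then have MD: "l \<inter> M = {}" "r2 \<inter> M = {}" "M \<inter> r = {}" using M(3) by blast+
      show ?thesis
    proof (rule seriesI'[of "l \<union> r2" M r])
      show "l \<union> r2 \<union> M \<union> r \<subseteq> U - z' - y'" using M(3) MS subs by auto
      show "(l \<union> r2) \<inter> M = {}" "(l \<union> r2) \<inter> r = {}" "M \<inter> r = {}"
        using MD by (simp_all add: distr disj)
      show "nbrs z' \<subseteq> l \<union> r2 \<union> M" "nbrs y' \<subseteq> M \<union> r" using m(14) n(13) M(2) by blast+
      show "adj z' M" "adj y' M" using adj_mono[OF m(12), of z' M] adj_mono[OF n(11), of y' M] M(2) by auto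
      have "adj M r" using adj_mono[OF n(14), of M r] M(2) by auto
      then show "adj M (l \<union> r2) \<or> adj M r" ..
    qed (use cl M m n hU in simp_all)
    qed
    consider "adj l2 w" | "adj w2 w" | "\<not> adj l2 w" "\<not> adj w2 w" by blast
    then show ?thesis
    proof cases
      case 1
      have "conn (w2 \<union> z \<union> l2 \<union> w)" using conn_Un[OF cm n(6)] 1 by simp
      then show ?thesis using ser by blast
    next
      case 2
      have "conn (w2 \<union> w)" by (rule conn_Un[OF m(6) n(6) 2])
      then show ?thesis using ser by blast
    next
      case 3
      then have l2: "adj l2 r" using m(8) by simp
      have "adj w y" using n(10) adj_sym by blast
      moreover have "y = l2 \<union> w2 \<union> r2 \<union> z \<union> z'" using m(1) Z by blast
      ultimately have "adj w (l2 \<union> w2 \<union> r2 \<union> z \<union> z')" by simp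
      then have "adj w r2" using wz 3 adj_sym by auto
      then have "conn (l \<union> r2 \<union> w)" using conn_Un[OF cl n(6)] adj_sym by auto
      moreover have "conn (w2 \<union> z \<union> l2 \<union> r)" using conn_Un[OF cm n(7)] l2 by simp
      ultimately have "parallel U P Q z' y'"
      proof (intro parallelI'[of "l \<union> r2 \<union> w" "w2 \<union> z \<union> l2 \<union> r"])
        show "l \<union> r2 \<union> w \<union> (w2 \<union> z \<union> l2 \<union> r) \<subseteq> U - z' - y'" by (simp add: subs)
        show "(l \<union> r2 \<union> w) \<inter> (w2 \<union> z \<union> l2 \<union> r) = {}" by (simp_all add: distr disj)
        show "nbrs z' \<subseteq> l \<union> r2 \<union> w \<union> (w2 \<union> z \<union> l2 \<union> r)" "nbrs y' \<subseteq> l \<union> r2 \<union> w \<union> (w2 \<union> z \<union> l2 \<union> r)"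
          using m(14) n(13) by blast+
      qed (use m n hU in simp_all)
      then show ?thesis ..
    qed
  qed
qed

text \<open>Since \<open>w\<close> touches \<open>r\<close>, their union is a hub, and
  \<open>y\<close> lies between \<open>l\<close> and this hub. The case distinction for the pair
  inside \<open>y\<close> then gives a clean pair, which is passed outwards, or a second pendant
  pair, which \<open>pendant_pendant\<close> combines with the first.\<close>

lemma good_pair_pendant:
  assumes h: "hubs U P Q" and s: "split_pair U y y'" and pd: "pendant U P Q y y' l w r"
    and sz: "split_pair y z z'" and nz: "nested k z" "nested k z'" and ny: "nested k y'"
  shows "good_pair k U P Q"
proof -
  have hU: "conn P" "conn Q" "P \<subseteq> V" "Q \<subseteq> V" "U \<inter> P = {}" "U \<inter> Q = {}" using h unfolding hubs_def by simp_all
  have S: "U \<subseteq> V" "y \<subseteq> U" "y' \<subseteq> U" "y \<inter> y' = {}" "conn y" "nbrs y \<subseteq> U - y - y'"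
    using s unfolding split_pair_def by simp_all
  have n: "l \<union> w \<union> r = U - y - y'" "l \<inter> w = {}" "l \<inter> r = {}" "w \<inter> r = {}" "conn l" "conn w" "conn r"
    "adj l P" "adj r Q" "adj y l" "adj y w" "adj w r"
    using pd unfolding pendant_def by simp_all
  have zy: "z \<subseteq> y" "z' \<subseteq> y" using sz unfolding split_pair_def by simp_all
  have cwr: "conn (w \<union> r)" by (rule conn_Un[OF n(6,7,12)])
  have hy: "hubs y l (w \<union> r)"
    unfolding hubs_def
  proof (intro conjI)
    show "l \<subseteq> V" "w \<union> r \<subseteq> V" "y \<inter> l = {}" "y \<inter> (w \<union> r) = {}" using n(1) S(1) by blast+
    show "l \<inter> (w \<union> r) = {}" using n(2,3) by blast
    show "nbrs y \<subseteq> l \<union> (w \<union> r)" using S(6) n(1) by blast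
  qed (use n cwr in simp_all)
  have inner: "good_pair k U P Q" if "good_pair k y l (w \<union> r)"
    by (rule good_pair_inner[OF that S(2)]) (use n cwr hU in auto)
  have gp: "good_pair k U P Q" if "x \<subseteq> y" "nested k x" "parallel U P Q x y' \<or> series U P Q x y'" for x
  proof -
    have "x \<subseteq> U" "x \<inter> y' = {}" using that(1) S by auto
    then show ?thesis unfolding good_pair_def using that S(3) ny by (intro exI[of _ x] exI[of _ y']) simp
  qed
  from pair_cases[OF sz hy] show ?thesis
  proof (elim disjE exE)
    assume "parallel y l (w \<union> r) z z'"
    then have "good_pair k y l (w \<union> r)" unfolding good_pair_def
      using nz zy sz unfolding split_pair_def by (intro exI[of _ z] exI[of _ z']) simp
    then show ?thesis by (rule inner)
  next
    assume "series y l (w \<union> r) z z'"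
    then have "good_pair k y l (w \<union> r)" unfolding good_pair_def
      using nz zy sz unfolding split_pair_def by (intro exI[of _ z] exI[of _ z']) simp
    then show ?thesis by (rule inner)
  next
    assume "series y l (w \<union> r) z' z"
    then have "good_pair k y l (w \<union> r)" unfolding good_pair_def
      using nz zy split_pair_sym[OF sz] unfolding split_pair_def by (intro exI[of _ z'] exI[of _ z]) simp
    then show ?thesis by (rule inner)
  next
    fix l2 w2 r2 assume "pendant y l (w \<union> r) z z' l2 w2 r2"
    then show ?thesis using gp[OF zy(2) nz(2)] pendant_pendant[OF h s pd sz] by blast
  next
    fix l2 w2 r2 assume "pendant y l (w \<union> r) z' z l2 w2 r2"
    then show ?thesis using gp[OF zy(1) nz(1)] pendant_pendant[OF h s pd split_pair_sym[OF sz]] by blast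
  next
    fix l2 w2 r2 assume "pendant y (w \<union> r) l z z' l2 w2 r2"
    then show ?thesis using gp[OF zy(2) nz(2)] pendant_pendant[OF h s pd sz] by blast
  next
    fix l2 w2 r2 assume "pendant y (w \<union> r) l z' z l2 w2 r2"
    then show ?thesis using gp[OF zy(1) nz(1)] pendant_pendant[OF h s pd split_pair_sym[OF sz]] by blast
  qed
qed

text \<open>Two levels of nesting pay for one clean pair: the second level is opened only when the
  first pair is pendant.\<close>

theorem good_pair_exists:
  assumes h: "hubs U P Q" and n: "nested (Suc (Suc k)) U"
  shows "good_pair k U P Q"
proof -
  obtain y y' z1 z2 z3 z4 where s: "split_pair U y y'" and ss: "split_pair y z1 z2" "split_pair y' z3 z4"
    and nz: "nested k z1" "nested k z2" "nested k z3" "nested k z4"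
    using n by (simp) (elim exE conjE, simp)
  have ny: "nested k y" "nested k y'"
    using nested_mono[of "Suc k" y k] nested_mono[of "Suc k" y' k] ss nz by auto
  have gp: "good_pair k U P Q" if "x \<subseteq> U" "x' \<subseteq> U" "x \<inter> x' = {}" "nested k x" "nested k x'"
    "parallel U P Q x x' \<or> series U P Q x x'" for x x'
    unfolding good_pair_def using that by (intro exI[of _ x] exI[of _ x']) simp
  have S: "y \<subseteq> U" "y' \<subseteq> U" "y \<inter> y' = {}" "y' \<inter> y = {}" using s unfolding split_pair_def by auto
  note s' = split_pair_sym[OF s] and h' = hubs_sym[OF h]
  from pair_cases[OF s h] show ?thesis
  proof (elim disjE exE)
    assume "parallel U P Q y y'" then show ?thesis using gp S ny by simp
  next
    assume "series U P Q y y'" then show ?thesis using gp S ny by simp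
  next
    assume "series U P Q y' y" then show ?thesis using gp[of y' y] S ny by simp
  next
    fix l w r assume "pendant U P Q y y' l w r"
    from good_pair_pendant[OF h s this ss(1) nz(1,2) ny(2)] show ?thesis .
  next
    fix l w r assume "pendant U P Q y' y l w r"
    from good_pair_pendant[OF h s' this ss(2) nz(3,4) ny(1)] show ?thesis .
  next
    fix l w r assume "pendant U Q P y y' l w r"
    from good_pair_pendant[OF h' s this ss(1) nz(1,2) ny(2)] show ?thesis by (rule good_pair_flip)
  next
    fix l w r assume "pendant U Q P y' y l w r"
    from good_pair_pendant[OF h' s' this ss(2) nz(3,4) ny(1)] show ?thesis by (rule good_pair_flip)
  qed
qed

end

section \<open>Apex trees and triangulations\<close>

context sym_rel begin

text \<open>
  A complete binary tree of height \<open>i\<close> with root branch set \<open>R\<close> inside \<open>Z\<close>, all of whose leaves are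
  adjacent to \<open>A\<close>.
\<close>

fun apex_tree :: "nat \<Rightarrow> 'a set \<Rightarrow> 'a set \<Rightarrow> 'a set \<Rightarrow> bool" where
  "apex_tree 0 R Z A \<longleftrightarrow> conn R \<and> R \<subseteq> Z \<and> adj R A"
| "apex_tree (Suc i) R Z A \<longleftrightarrow> (\<exists>R1 Z1 R2 Z2. apex_tree i R1 Z1 A \<and> apex_tree i R2 Z2 A \<and> conn R \<and>
    R \<union> Z1 \<union> Z2 \<subseteq> Z \<and> R \<inter> Z1 = {} \<and> R \<inter> Z2 = {} \<and> Z1 \<inter> Z2 = {} \<and> adj R R1 \<and> adj R R2)"

lemma apex_tree_root: "apex_tree i R Z A \<Longrightarrow> conn R \<and> R \<subseteq> Z"
  by (cases i) auto

lemma apex_tree_mono: "apex_tree i R Z A \<Longrightarrow> Z \<subseteq> Z' \<Longrightarrow> A \<subseteq> A' \<Longrightarrow> apex_tree i R Z' A'"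
proof (induction i arbitrary: R Z Z')
  case 0
  then have "conn R" "R \<subseteq> Z'" "adj R A'" using adj_mono[of R A R A'] by auto
  then show ?case by simp
next
  case (Suc i)
  then obtain R1 Z1 R2 Z2 where n: "apex_tree i R1 Z1 A" "apex_tree i R2 Z2 A" "conn R"
    "R \<union> Z1 \<union> Z2 \<subseteq> Z" "R \<inter> Z1 = {}" "R \<inter> Z2 = {}" "Z1 \<inter> Z2 = {}" "adj R R1" "adj R R2"
    by (simp only: apex_tree.simps) (elim exE conjE, simp)
  have "apex_tree i R1 Z1 A'" "apex_tree i R2 Z2 A'" using Suc.IH[OF n(1)] Suc.IH[OF n(2)] Suc.prems(3) by auto
  moreover have "R \<union> Z1 \<union> Z2 \<subseteq> Z'" using n(4) Suc.prems(2) by blast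
  ultimately show ?case using n unfolding apex_tree.simps
    by (intro exI[of _ R1] exI[of _ Z1] exI[of _ R2] exI[of _ Z2]) simp
qed

lemma apex_tree_grow:
  assumes "apex_tree i R Z A" "conn (R \<union> C)" "C \<inter> Z = {}"
  shows "apex_tree i (R \<union> C) (Z \<union> C) A"
proof (cases i)
  case 0
  then show ?thesis using assms by auto
next
  case (Suc k)
  then obtain R1 Z1 R2 Z2 where n: "apex_tree k R1 Z1 A" "apex_tree k R2 Z2 A" "conn R"
    "R \<union> Z1 \<union> Z2 \<subseteq> Z" "R \<inter> Z1 = {}" "R \<inter> Z2 = {}" "Z1 \<inter> Z2 = {}" "adj R R1" "adj R R2"
    using assms(1) by (simp only: apex_tree.simps) (elim exE conjE, simp)
  have "(R \<union> C) \<union> Z1 \<union> Z2 \<subseteq> Z \<union> C" "(R \<union> C) \<inter> Z1 = {}" "(R \<union> C) \<inter> Z2 = {}"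
    using n(4-6) assms(3) by blast+
  then show ?thesis unfolding Suc apex_tree.simps using n assms(2)
    by (intro exI[of _ R1] exI[of _ Z1] exI[of _ R2] exI[of _ Z2]) simp
qed

text \<open>\<open>X\<close> is the part of \<open>U\<close> by which the hub \<open>Q\<close> has
  grown, and \<open>Q \<union> X\<close> is the future apex. \<open>P\<close> is the hub from which
  the tree can be extended above its root.\<close>

definition rooted_apex :: "nat \<Rightarrow> 'a set \<Rightarrow> 'a set \<Rightarrow> 'a set \<Rightarrow> bool" where
  "rooted_apex i U P Q \<longleftrightarrow> (\<exists>R Z X. Z \<subseteq> U \<and> X \<subseteq> U \<and> Z \<inter> X = {} \<and> apex_tree i R Z (Q \<union> X) \<and>
    adj R P \<and> conn (Q \<union> X))"

lemma rooted_apexE: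
  assumes "rooted_apex i U P Q"
  obtains R Z X where "Z \<subseteq> U" "X \<subseteq> U" "Z \<inter> X = {}" "apex_tree i R Z (Q \<union> X)" "adj R P" "conn (Q \<union> X)"
  using assms unfolding rooted_apex_def by (elim exE conjE) simp

lemma conn_Un_super:
  assumes "conn (Q \<union> X)" "Q \<subseteq> Q'" "conn Q'" "Q \<noteq> {}" shows "conn (Q' \<union> X)"
proof -
  have "conn (Q' \<union> (Q \<union> X))" by (rule conn_Un_meet) (use assms in blast)+
  moreover have "Q' \<union> (Q \<union> X) = Q' \<union> X" using assms(2) by blast
  ultimately show ?thesis by simp
qed

lemma rooted_apex_mono:
  assumes "rooted_apex i U P Q" "P \<subseteq> P'" "Q \<subseteq> Q'" "conn Q'" "Q \<noteq> {}"
  shows "rooted_apex i U P' Q'"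
proof -
  obtain R Z X where n: "Z \<subseteq> U" "X \<subseteq> U" "Z \<inter> X = {}" "apex_tree i R Z (Q \<union> X)" "adj R P" "conn (Q \<union> X)"
    by (rule rooted_apexE[OF assms(1)])
  have "apex_tree i R Z (Q' \<union> X)" using apex_tree_mono[OF n(4)] assms(3) by blast
  moreover have "adj R P'" using adj_mono[OF n(5)] assms(2) by blast
  moreover have "conn (Q' \<union> X)" using conn_Un_super[OF n(6)] assms by blast
  ultimately show ?thesis unfolding rooted_apex_def using n by (intro exI[of _ R] exI[of _ Z] exI[of _ X]) simp
qed

text \<open>\<open>l\<close> may be disconnected, so the root is extended only by the component of
  \<open>l\<close> that it touches. This component reaches \<open>P\<close> because
  \<open>P \<union> l\<close> is connected. All of \<open>r\<close> goes to the apex.\<close>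

lemma rooted_apex_inner:
  assumes g: "rooted_apex i y (P \<union> l) (Q \<union> r)" and y: "y \<subseteq> U" and lr: "l \<union> r \<subseteq> U - y" "l \<inter> r = {}"
    and P: "\<not> adj y P" "conn (P \<union> l)" "P \<inter> l = {}" "P \<noteq> {}"
  shows "rooted_apex i U P Q"
proof -
  obtain R Z X where n: "Z \<subseteq> y" "X \<subseteq> y" "Z \<inter> X = {}" "apex_tree i R Z (Q \<union> r \<union> X)" "adj R (P \<union> l)" "conn (Q \<union> r \<union> X)"
    by (rule rooted_apexE[OF g])
  have R: "conn R" "R \<subseteq> Z" using apex_tree_root[OF n(4)] by simp_all
  have "\<not> adj R P" using P(1) adj_mono[of R P y P] R(2) n(1) by blast
  then obtain u v where uv: "u \<in> R" "v \<in> l" "E u v" using n(5) by (auto simp: adj_def)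
  define C where "C = component l v"
  have eq: "P \<union> l - P = l" using P(3) by blast
  note c = component_props[OF uv(2), folded C_def]
  have aC: "adj C P" using component_adj_cut[of "P \<union> l" P v] P uv(2) unfolding eq C_def by blast
  have cR: "conn (R \<union> C)" by (rule conn_Un[OF R(1) c(3)]) (use uv c(1) in \<open>auto simp: adj_def\<close>)
  have Cl: "C \<subseteq> l" by (rule c(2))
  have "apex_tree i (R \<union> C) (Z \<union> C) (Q \<union> (r \<union> X))"
    using apex_tree_grow[OF n(4) cR] Cl n(1) lr(1) by (simp add: Un_assoc) blast
  moreover have "Z \<union> C \<subseteq> U" "r \<union> X \<subseteq> U" using Cl n(1,2) y lr(1) by auto
  moreover have "(Z \<union> C) \<inter> (r \<union> X) = {}"
  proof -
    have "Z \<inter> r = {}" "C \<inter> r = {}" "C \<inter> X = {}" using Cl n(1,2) lr by auto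
    then show ?thesis using n(3) by (simp add: Int_Un_distrib Int_Un_distrib2)
  qed
  ultimately show ?thesis unfolding rooted_apex_def
    using aC n(6) by (intro exI[of _ "R \<union> C"] exI[of _ "Z \<union> C"] exI[of _ "r \<union> X"]) (simp add: Un_assoc)
qed

text \<open>\<open>l\<close> becomes the new root: as neither branch sees \<open>P\<close> directly,
  both old roots touch \<open>l\<close>. The two grown copies of the opposite hub share
  \<open>Q\<close> and unite to a single apex.\<close>

lemma rooted_apex_parallel:
  assumes g: "rooted_apex i y (P \<union> l) (Q \<union> r)" and g': "rooted_apex i y' (P \<union> l) (Q \<union> r)"
    and y: "y \<subseteq> U" "y' \<subseteq> U" "y \<inter> y' = {}" and lr: "l \<union> r \<subseteq> U - y - y'" "l \<inter> r = {}"
    and P: "\<not> adj y P" "\<not> adj y' P" "conn l" "adj l P" and Q: "Q \<noteq> {}"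
  shows "rooted_apex (Suc i) U P Q"
proof -
  obtain R Z X where n: "Z \<subseteq> y" "X \<subseteq> y" "Z \<inter> X = {}" "apex_tree i R Z (Q \<union> r \<union> X)" "adj R (P \<union> l)" "conn (Q \<union> r \<union> X)"
    by (rule rooted_apexE[OF g])
  obtain R' Z' X' where n': "Z' \<subseteq> y'" "X' \<subseteq> y'" "Z' \<inter> X' = {}" "apex_tree i R' Z' (Q \<union> r \<union> X')" "adj R' (P \<union> l)" "conn (Q \<union> r \<union> X')"
    by (rule rooted_apexE[OF g'])
  define Y where "Y = r \<union> X \<union> X'"
  have "R \<subseteq> y" "R' \<subseteq> y'" using apex_tree_root n n' by blast+
  then have aR: "adj l R" "adj l R'" using n(5) n'(5) P(1,2) adj_mono[of R P y P] adj_mono[of R' P y' P] adj_sym by auto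
  have t: "apex_tree i R Z (Q \<union> Y)" "apex_tree i R' Z' (Q \<union> Y)"
    using apex_tree_mono[OF n(4) order_refl, of "Q \<union> Y"] apex_tree_mono[OF n'(4) order_refl, of "Q \<union> Y"]
    unfolding Y_def by auto
  have cQ: "conn (Q \<union> Y)"
  proof -
    have "conn ((Q \<union> r \<union> X) \<union> (Q \<union> r \<union> X'))" by (rule conn_Un_meet[OF n(6) n'(6)]) (use Q in blast)
    moreover have "(Q \<union> r \<union> X) \<union> (Q \<union> r \<union> X') = Q \<union> Y" unfolding Y_def by blast
    ultimately show ?thesis by simp
  qed
  have ds: "l \<inter> Z = {}" "l \<inter> Z' = {}" "Z \<inter> Z' = {}" using n(1) n'(1) lr(1) y(3) by auto
  have "apex_tree (Suc i) l (l \<union> Z \<union> Z') (Q \<union> Y)" unfolding apex_tree.simps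
    using t P(3) ds aR by (intro exI[of _ R] exI[of _ Z] exI[of _ R'] exI[of _ Z']) simp
  moreover have "l \<union> Z \<union> Z' \<subseteq> U" "Y \<subseteq> U" using lr n(1,2) n'(1,2) y unfolding Y_def by auto
  moreover have "(l \<union> Z \<union> Z') \<inter> Y = {}"
  proof -
    have "l \<inter> X = {}" "l \<inter> X' = {}" "Z \<inter> r = {}" "Z' \<inter> r = {}" "Z \<inter> X' = {}" "Z' \<inter> X = {}"
      using lr(1) n(1,2) n'(1,2) y(3) by auto
    then show ?thesis using n(3) n'(3) lr(2) by (simp add: Y_def Int_Un_distrib Int_Un_distrib2)
  qed
  ultimately show ?thesis unfolding rooted_apex_def
    using cQ P(4) by (intro exI[of _ l] exI[of _ "l \<union> Z \<union> Z'"] exI[of _ Y]) simp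
qed

section \<open>Triangulations from series pairs\<close>

text \<open>
  At even stages \<open>2 * j\<close>: a model of the triangulation obtained from an edge between \<open>P\<close> and \<open>Q\<close> by
  \<open>j\<close> times adding a triangle on every outer edge, the first edge excluded. At odd stages that first
  edge is present as well.
\<close>

fun triang :: "nat \<Rightarrow> 'a set \<Rightarrow> 'a set \<Rightarrow> 'a set \<Rightarrow> bool" where
  "triang 0 P Q X \<longleftrightarrow> True"
| "triang (Suc s) P Q X \<longleftrightarrow> (if even s then
      \<exists>L R Y. L \<union> R \<union> Y \<subseteq> X \<and> L \<inter> R = {} \<and> L \<inter> Y = {} \<and> R \<inter> Y = {} \<and> conn (P \<union> L) \<and> conn (Q \<union> R) \<and>
        adj (P \<union> L) (Q \<union> R) \<and> triang s (P \<union> L) (Q \<union> R) Y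
    else
      \<exists>L W R Y Z. L \<union> W \<union> R \<union> Y \<union> Z \<subseteq> X \<and> L \<inter> W = {} \<and> L \<inter> R = {} \<and> L \<inter> Y = {} \<and> L \<inter> Z = {} \<and>
        W \<inter> R = {} \<and> W \<inter> Y = {} \<and> W \<inter> Z = {} \<and> R \<inter> Y = {} \<and> R \<inter> Z = {} \<and> Y \<inter> Z = {} \<and>
        conn (P \<union> L) \<and> conn (Q \<union> R) \<and> conn W \<and> triang s (P \<union> L) W Y \<and> triang s W (Q \<union> R) Z)"

lemma triang_evenE:
  assumes "triang (Suc s) P Q X" "even s"
  obtains L R Y where "L \<union> R \<union> Y \<subseteq> X" "L \<inter> R = {}" "L \<inter> Y = {}" "R \<inter> Y = {}" "conn (P \<union> L)" "conn (Q \<union> R)"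
    "adj (P \<union> L) (Q \<union> R)" "triang s (P \<union> L) (Q \<union> R) Y"
  using assms by (simp only: triang.simps if_True) (elim exE conjE, simp)

lemma triang_oddE:
  assumes "triang (Suc s) P Q X" "odd s"
  obtains L W R Y Z where "L \<union> W \<union> R \<union> Y \<union> Z \<subseteq> X" "L \<inter> W = {}" "L \<inter> R = {}" "L \<inter> Y = {}" "L \<inter> Z = {}"
    "W \<inter> R = {}" "W \<inter> Y = {}" "W \<inter> Z = {}" "R \<inter> Y = {}" "R \<inter> Z = {}" "Y \<inter> Z = {}"
    "conn (P \<union> L)" "conn (Q \<union> R)" "conn W" "triang s (P \<union> L) W Y" "triang s W (Q \<union> R) Z"
  using assms by (simp only: triang.simps if_False) (elim exE conjE, simp)

lemma triang_evenI:
  assumes "even s" "L \<union> R \<union> Y \<subseteq> X" "L \<inter> R = {}" "L \<inter> Y = {}" "R \<inter> Y = {}" "conn (P \<union> L)" "conn (Q \<union> R)"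
    "adj (P \<union> L) (Q \<union> R)" "triang s (P \<union> L) (Q \<union> R) Y"
  shows "triang (Suc s) P Q X"
  using assms unfolding triang.simps(2) if_P[OF assms(1)] by (intro exI[of _ L] exI[of _ R] exI[of _ Y]) simp

lemma triang_oddI:
  assumes "odd s" "L \<union> W \<union> R \<union> Y \<union> Z \<subseteq> X" "L \<inter> W = {}" "L \<inter> R = {}" "L \<inter> Y = {}" "L \<inter> Z = {}"
    "W \<inter> R = {}" "W \<inter> Y = {}" "W \<inter> Z = {}" "R \<inter> Y = {}" "R \<inter> Z = {}" "Y \<inter> Z = {}"
    "conn (P \<union> L)" "conn (Q \<union> R)" "conn W" "triang s (P \<union> L) W Y" "triang s W (Q \<union> R) Z"
  shows "triang (Suc s) P Q X"
  using assms unfolding triang.simps(2) if_not_P[OF assms(1)]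
  by (intro exI[of _ L] exI[of _ W] exI[of _ R] exI[of _ Y] exI[of _ Z]) simp

lemma triang_mono:
  assumes "triang s P Q X" "P \<subseteq> P'" "Q \<subseteq> Q'" "X \<subseteq> X'" "conn P'" "conn Q'" "P \<noteq> {}" "Q \<noteq> {}"
  shows "triang s P' Q' X'"
  using assms
proof (induction s arbitrary: P Q X P' Q' X')
  case (Suc s)
  note c = conn_Un_super[OF _ Suc.prems(2) Suc.prems(5,7)] conn_Un_super[OF _ Suc.prems(3) Suc.prems(6,8)]
  show ?case
  proof (cases "even s")
    case True
    obtain L R Y where n: "L \<union> R \<union> Y \<subseteq> X" "L \<inter> R = {}" "L \<inter> Y = {}" "R \<inter> Y = {}" "conn (P \<union> L)" "conn (Q \<union> R)"
      "adj (P \<union> L) (Q \<union> R)" "triang s (P \<union> L) (Q \<union> R) Y" by (rule triang_evenE[OF Suc.prems(1) True])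
    show ?thesis
    proof (rule triang_evenI[OF True, of L R Y])
      show "L \<union> R \<union> Y \<subseteq> X'" using n(1) Suc.prems(4) by blast
      show "adj (P' \<union> L) (Q' \<union> R)" by (rule adj_mono[OF n(7)]) (use Suc.prems in blast)+
      show "triang s (P' \<union> L) (Q' \<union> R) Y"
        by (rule Suc.IH[OF n(8)]) (use Suc.prems c n in auto)
    qed (use n c in simp_all)
  next
    case False
    obtain L W R Y Z where n: "L \<union> W \<union> R \<union> Y \<union> Z \<subseteq> X" "L \<inter> W = {}" "L \<inter> R = {}" "L \<inter> Y = {}" "L \<inter> Z = {}"
      "W \<inter> R = {}" "W \<inter> Y = {}" "W \<inter> Z = {}" "R \<inter> Y = {}" "R \<inter> Z = {}" "Y \<inter> Z = {}"
      "conn (P \<union> L)" "conn (Q \<union> R)" "conn W" "triang s (P \<union> L) W Y" "triang s W (Q \<union> R) Z"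
      by (rule triang_oddE[OF Suc.prems(1) False])
    have W: "W \<noteq> {}" using conn_nonempty n(14) by blast
    show ?thesis
    proof (rule triang_oddI[OF False, of L W R Y Z])
      show "L \<union> W \<union> R \<union> Y \<union> Z \<subseteq> X'" using n(1) Suc.prems(4) by blast
      show "triang s (P' \<union> L) W Y"
        by (rule Suc.IH[OF n(15)]) (use Suc.prems c n W in auto)
      show "triang s W (Q' \<union> R) Z"
        by (rule Suc.IH[OF n(16)]) (use Suc.prems c n W in auto)
    qed (use n c in simp_all)
  qed
qed simp

lemma triang_inner:
  assumes g: "triang s (P \<union> l) (Q \<union> r) y" and U: "l \<union> r \<union> y \<subseteq> U" "l \<inter> r = {}" "l \<inter> y = {}" "r \<inter> y = {}"
  shows "triang s P Q U"
proof (cases s)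
  case (Suc k)
  note g = g[unfolded Suc]
  show ?thesis
  proof (cases "even k")
    case True
    obtain L R Y where n: "L \<union> R \<union> Y \<subseteq> y" "L \<inter> R = {}" "L \<inter> Y = {}" "R \<inter> Y = {}" "conn (P \<union> l \<union> L)" "conn (Q \<union> r \<union> R)"
      "adj (P \<union> l \<union> L) (Q \<union> r \<union> R)" "triang k (P \<union> l \<union> L) (Q \<union> r \<union> R) Y" by (rule triang_evenE[OF g True])
    show ?thesis unfolding Suc
    proof (rule triang_evenI[OF True, of "l \<union> L" "r \<union> R" Y])
      show "l \<union> L \<union> (r \<union> R) \<union> Y \<subseteq> U" using n(1) U(1) by blast
      show "(l \<union> L) \<inter> (r \<union> R) = {}" "(l \<union> L) \<inter> Y = {}" "(r \<union> R) \<inter> Y = {}" using n(1-4) U(2-4) by blast+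
    qed (use n in \<open>simp_all only: Un_assoc\<close>)
  next
    case False
    obtain L W R Y Z where n: "L \<union> W \<union> R \<union> Y \<union> Z \<subseteq> y" "L \<inter> W = {}" "L \<inter> R = {}" "L \<inter> Y = {}" "L \<inter> Z = {}"
      "W \<inter> R = {}" "W \<inter> Y = {}" "W \<inter> Z = {}" "R \<inter> Y = {}" "R \<inter> Z = {}" "Y \<inter> Z = {}"
      "conn (P \<union> l \<union> L)" "conn (Q \<union> r \<union> R)" "conn W" "triang k (P \<union> l \<union> L) W Y" "triang k W (Q \<union> r \<union> R) Z"
      by (rule triang_oddE[OF g False])
    have D: "l \<inter> X = {}" "r \<inter> X = {}" "X \<inter> r = {}" "X \<inter> l = {}" if "X \<subseteq> y" for X using that U by blast+
    have sub: "L \<subseteq> y" "W \<subseteq> y" "R \<subseteq> y" "Y \<subseteq> y" "Z \<subseteq> y" using n(1) by auto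
    show ?thesis unfolding Suc
    proof (rule triang_oddI[OF False, of "l \<union> L" W "r \<union> R" Y Z])
      show "l \<union> L \<union> W \<union> (r \<union> R) \<union> Y \<union> Z \<subseteq> U" using sub U(1) by auto
    qed (use n(12-16) in \<open>simp_all add: Un_assoc n(2-11) U(2) D[OF sub(1)] D[OF sub(2)] D[OF sub(3)] D[OF sub(4)] D[OF sub(5)]
        Int_Un_distrib Int_Un_distrib2\<close>)
  qed
qed simp

text \<open>For odd \<open>s\<close> the part \<open>w\<close> is the new corner of a triangle and
  both branches are kept. For even \<open>s\<close> the pair is spent on the edge between the two
  ends: \<open>w\<close> and one branch are merged into the hub opposite to the part that
  \<open>w\<close> touches, and only the other branch is kept.\<close>

lemma triang_series:
  assumes g: "triang s (P \<union> l) w y" "triang s w (Q \<union> r) y'"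
    and U: "l \<union> w \<union> r \<subseteq> U - y - y'" "y \<subseteq> U" "y' \<subseteq> U" "y \<inter> y' = {}" "l \<inter> w = {}" "l \<inter> r = {}" "w \<inter> r = {}"
    and c: "conn (P \<union> l)" "conn (Q \<union> r)" "conn w" "conn y" "conn y'"
    and a: "adj y l" "adj y w" "adj y' w" "adj y' r" "adj w l \<or> adj w r" and ne: "P \<noteq> {}" "Q \<noteq> {}"
  shows "triang (Suc s) P Q U"
proof -
  have ds: "l \<inter> y = {}" "w \<inter> y = {}" "r \<inter> y = {}" "l \<inter> y' = {}" "w \<inter> y' = {}" "r \<inter> y' = {}"
    "y \<inter> l = {}" "y \<inter> w = {}" "y \<inter> r = {}" "y' \<inter> l = {}" "y' \<inter> w = {}" "y' \<inter> r = {}" "w \<inter> l = {}" "y' \<inter> y = {}"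
    "l \<subseteq> U" "w \<subseteq> U" "r \<subseteq> U"
    using U by auto
  note distr = Int_Un_distrib Int_Un_distrib2
  have wne: "w \<noteq> {}" "P \<union> l \<noteq> {}" "Q \<union> r \<noteq> {}" using conn_nonempty c by auto
  show ?thesis
  proof (cases "even s")
    case False
    show ?thesis
      by (rule triang_oddI[OF False, of l w r y y']) (use U(2-7) g c in \<open>simp_all add: ds\<close>)
  next
    case True
    from a(5) show ?thesis
    proof
      assume wl: "adj w l"
      have "conn (Q \<union> r \<union> y')" using conn_Un[OF c(2,5)] a(4) adj_sym by auto
      then have "conn (Q \<union> r \<union> y' \<union> w)" using conn_Un[OF _ c(3)] a(3) by auto
      then have cR: "conn (Q \<union> (w \<union> y' \<union> r))" by (simp add: Un_ac)
      have "triang s (P \<union> l) (Q \<union> (w \<union> y' \<union> r)) y"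
        by (rule triang_mono[OF g(1)]) (use cR c wne in auto)
      then show ?thesis
        by (intro triang_evenI[OF True, of l "w \<union> y' \<union> r" y])
          (use U(2-7) c cR wl adj_sym[of w l] in \<open>simp_all add: ds distr\<close>)
    next
      assume wr: "adj w r"
      have "conn (P \<union> l \<union> y)" using conn_Un[OF c(1,4)] a(1) adj_sym by auto
      then have "conn (P \<union> l \<union> y \<union> w)" using conn_Un[OF _ c(3)] a(2) by auto
      then have cL: "conn (P \<union> (l \<union> y \<union> w))" by (simp add: Un_ac)
      have "triang s (P \<union> (l \<union> y \<union> w)) (Q \<union> r) y'"
        by (rule triang_mono[OF g(2)]) (use cL c wne in auto)
      then show ?thesis
        by (intro triang_evenI[OF True, of "l \<union> y \<union> w" r y'])
          (use U(2-7) c cL wr in \<open>simp_all add: ds distr\<close>)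
    qed
  qed
qed

end

section \<open>The induction over two tree heights and the triangulation stage\<close>

context two_conn_graph begin

text \<open>The nesting depth is twice \<open>i + j + s\<close> because
  \<open>good_pair_exists\<close> uses two levels. A parallel pair lowers \<open>i\<close> or
  \<open>j\<close> according to the side on which its part is connected; a series pair lowers
  \<open>s\<close>.\<close>

theorem apex_or_triang:
  assumes "nested (2 * (i + j + s)) U" "hubs U P Q"
  shows "rooted_apex i U P Q \<or> rooted_apex j U Q P \<or> triang s P Q U"
  using assms
proof (induction "i + j + s" arbitrary: i j s U P Q)
  case 0 then show ?case by simp
next
  case (Suc n)
  have hU: "conn P" "conn Q" "P \<subseteq> V" "Q \<subseteq> V" "P \<inter> Q = {}" "U \<inter> P = {}" "U \<inter> Q = {}" "adj U P" "adj U Q"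
    using Suc.prems(2) unfolding hubs_def by simp_all
  have U: "conn U" "U \<subseteq> V" using nested_basic[OF Suc.prems(1)] by simp_all
  have ne: "P \<noteq> {}" "Q \<noteq> {}" using hU conn_nonempty by simp_all
  have base: "rooted_apex 0 U X Y" if "adj U X" "adj U Y" "conn Y" for X Y
    unfolding rooted_apex_def using that U(1) by (intro exI[of _ U] exI[of _ U] exI[of _ "{}"]) simp
  show ?case
  proof (cases "i = 0 \<or> j = 0 \<or> s = 0")
    case True
    then show ?thesis using base hU by auto
  next
    case False
    have "nested (Suc (Suc (2 * n))) U" using Suc.prems(1) Suc.hyps(2)[symmetric] by simp
    from good_pair_exists[OF Suc.prems(2) this]
    obtain p p' where p: "p \<subseteq> U" "p' \<subseteq> U" "p \<inter> p' = {}" "nested (2 * n) p" "nested (2 * n) p'"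
      and ps: "parallel U P Q p p' \<or> series U P Q p p'" unfolding good_pair_def by (elim exE conjE) simp
    have pc: "conn p" "conn p'" using nested_basic p by simp_all
    have IH: "rooted_apex i' q P' Q' \<or> rooted_apex j' q Q' P' \<or> triang s' P' Q' q"
      if "i' + j' + s' = n" "nested (2 * n) q" "hubs q P' Q'" for i' j' s' q P' Q'
      using Suc.hyps(1)[of i' j' s' q P' Q'] that by simp
    have nonadj: "\<not> adj x X" if "x \<subseteq> U" "nbrs x \<subseteq> B" "B \<subseteq> U" "U \<inter> X = {}" for x X B
      using that unfolding adj_def nbrs_def by blast
    from ps show ?thesis
    proof
      assume "parallel U P Q p p'"
      then obtain l r where n: "l \<union> r \<subseteq> U - p - p'" "l \<inter> r = {}" "nbrs p \<subseteq> l \<union> r" "nbrs p' \<subseteq> l \<union> r"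
        "adj p l" "adj p r" "adj p' l" "adj p' r" "conn (P \<union> l)" "conn (Q \<union> r)"
        "conn l \<and> adj l P \<or> conn r \<and> adj r Q" unfolding parallel_def by (elim exE conjE) simp
      have lU: "l \<union> r \<subseteq> U" "l \<subseteq> U" "r \<subseteq> U" using n(1) by auto
      have hubs_p: "hubs q (P \<union> l) (Q \<union> r)" if "q \<subseteq> U" "l \<union> r \<subseteq> U - q" "nbrs q \<subseteq> l \<union> r" "adj q l" "adj q r" for q
        unfolding hubs_def
      proof (intro conjI)
        show "P \<union> l \<subseteq> V" "Q \<union> r \<subseteq> V" using hU lU U by auto
        show "(P \<union> l) \<inter> (Q \<union> r) = {}" using hU(5-7) n(2) lU by blast
        show "q \<inter> (P \<union> l) = {}" "q \<inter> (Q \<union> r) = {}" using hU(6,7) that(1,2) by blast+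
        show "nbrs q \<subseteq> P \<union> l \<union> (Q \<union> r)" using that(3) by blast
      qed (use that n in simp_all)
      have s1: "l \<union> r \<subseteq> U - p" "l \<union> r \<subseteq> U - p'" "l \<inter> p = {}" "r \<inter> p = {}" "l \<inter> p' = {}" "r \<inter> p' = {}"
        using n(1) by auto
      have h1: "hubs p (P \<union> l) (Q \<union> r)" by (rule hubs_p) (use p n s1 in simp_all)
      have h2: "hubs p' (P \<union> l) (Q \<union> r)" by (rule hubs_p) (use p n s1 in simp_all)
      have na: "\<not> adj p P" "\<not> adj p Q" "\<not> adj p' P" "\<not> adj p' Q"
        using nonadj[OF p(1) n(3) lU(1)] nonadj[OF p(2) n(4) lU(1)] hU by simp_all
      have Pl: "P \<inter> l = {}" "Q \<inter> r = {}" using hU(6,7) lU by auto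
      have t: "triang s P Q U" if "triang s (P \<union> l) (Q \<union> r) q" "q = p \<or> q = p'" for q
        by (rule triang_inner[OF that(1)]) (use that(2) p(1,2) lU n(2) s1 in auto)
      have rl: "r \<inter> l = {}" "r \<union> l \<subseteq> U - p - p'" using n(1,2) by auto
      have aP: "rooted_apex k U P Q" if "rooted_apex k q (P \<union> l) (Q \<union> r)" "q = p \<or> q = p'" for q k
        by (rule rooted_apex_inner[OF that(1)]) (use that(2) p(1,2) s1 n na Pl ne in auto)
      have aQ: "rooted_apex k U Q P" if "rooted_apex k q (Q \<union> r) (P \<union> l)" "q = p \<or> q = p'" for q k
        by (rule rooted_apex_inner[OF that(1)]) (use that(2) p(1,2) s1 rl n na Pl ne in auto)
      from n(11) show ?thesis
      proof
        assume l: "conn l \<and> adj l P"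
        \<comment> \<open>Only \<open>i\<close> is lowered for the two branches. Trees of height
          \<open>i'\<close> in both of them combine under \<open>l\<close>; any other outcome in a
          single branch already has its full size and is carried outwards.\<close>
        obtain i' where i': "i = Suc i'" using False by (cases i) auto
        have "i' + j + s = n" using Suc.hyps(2) i' by simp
        from IH[OF this p(4) h1] IH[OF this p(5) h2] show ?thesis
          using t aQ rooted_apex_parallel[of i' p P l Q r p' U] p(1-3) n(1,2) na l ne unfolding i' by metis
      next
        assume r: "conn r \<and> adj r Q"
        obtain j' where j': "j = Suc j'" using False by (cases j) auto
        have "i + j' + s = n" using Suc.hyps(2) j' by simp
        from IH[OF this p(4) h1] IH[OF this p(5) h2] show ?thesis
          using t aP rooted_apex_parallel[of j' p Q r P l p' U] p(1-3) rl na r ne unfolding j' by metis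
      qed
    next
      assume "series U P Q p p'"
      then obtain l w r where n: "l \<union> w \<union> r \<subseteq> U - p - p'" "l \<inter> w = {}" "l \<inter> r = {}" "w \<inter> r = {}"
        "nbrs p \<subseteq> l \<union> w" "nbrs p' \<subseteq> w \<union> r" "adj p l" "adj p w" "adj p' w" "adj p' r"
        "conn (P \<union> l)" "conn (Q \<union> r)" "conn w" "adj w l \<or> adj w r"
        unfolding series_def by (elim exE conjE) simp
      have lU: "l \<subseteq> U" "r \<subseteq> U" "w \<subseteq> U" "l \<union> w \<subseteq> U" "w \<union> r \<subseteq> U" using n(1) by auto
      have s1: "l \<inter> p = {}" "r \<inter> p = {}" "w \<inter> p = {}" "l \<inter> p' = {}" "r \<inter> p' = {}" "w \<inter> p' = {}"
        using n(1) by auto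
      have wne: "w \<noteq> {}" using n(13) conn_nonempty by blast
      have h1: "hubs p (P \<union> l) w" unfolding hubs_def
      proof (intro conjI)
        show "P \<union> l \<subseteq> V" "w \<subseteq> V" using hU lU U by auto
        show "(P \<union> l) \<inter> w = {}" using hU(6) n(2) lU by blast
        show "p \<inter> (P \<union> l) = {}" "p \<inter> w = {}" using hU(6) p(1) s1 by blast+
        show "nbrs p \<subseteq> P \<union> l \<union> w" using n(5) by blast
      qed (use n in simp_all)
      have h2: "hubs p' w (Q \<union> r)" unfolding hubs_def
      proof (intro conjI)
        show "Q \<union> r \<subseteq> V" "w \<subseteq> V" using hU lU U by auto
        show "w \<inter> (Q \<union> r) = {}" using hU(7) n(4) lU by blast
        show "p' \<inter> (Q \<union> r) = {}" "p' \<inter> w = {}" using hU(7) p(2) s1 by blast+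
        show "nbrs p' \<subseteq> w \<union> (Q \<union> r)" using n(6) by blast
      qed (use n in simp_all)
      have na: "\<not> adj p P" "\<not> adj p Q" "\<not> adj p' P" "\<not> adj p' Q"
        using nonadj[OF p(1) n(5) lU(4)] nonadj[OF p(2) n(6) lU(5)] hU by simp_all
      \<comment> \<open>For an apex tree found in one branch only, the hub \<open>w\<close> has to
        be joined to an outer hub through the other branch: \<open>L\<close> brings \<open>w\<close>
        to \<open>P\<close> when the tree lies in \<open>p'\<close>, and \<open>R\<close> brings it
        to \<open>Q\<close> when the tree lies in \<open>p\<close>.\<close>
      define L where "L = l \<union> p \<union> w"
      define R where "R = w \<union> p' \<union> r"
      have "conn (P \<union> l \<union> p)" using conn_Un[OF n(11) pc(1)] n(7) adj_sym by auto
      then have "conn (P \<union> l \<union> p \<union> w)" using conn_Un[OF _ n(13)] n(8) by auto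
      then have cL: "conn (P \<union> L)" by (simp add: L_def Un_ac)
      have "conn (Q \<union> r \<union> p')" using conn_Un[OF n(12) pc(2)] n(10) adj_sym by auto
      then have "conn (Q \<union> r \<union> p' \<union> w)" using conn_Un[OF _ n(13)] n(9) by auto
      then have cR: "conn (Q \<union> R)" by (simp add: R_def Un_ac)
      have sL: "L \<union> r \<subseteq> U - p'" "L \<inter> r = {}" "r \<union> L \<subseteq> U - p'" "r \<inter> L = {}" "P \<inter> L = {}" "P \<inter> l = {}" "Q \<inter> r = {}"
        using lU p s1 n(3,4) hU(6,7) unfolding L_def by auto
      have sR: "l \<union> R \<subseteq> U - p" "l \<inter> R = {}" "R \<union> l \<subseteq> U - p" "R \<inter> l = {}" "Q \<inter> R = {}"
        using lU p s1 n(2,3) hU(6,7) unfolding R_def by auto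
      have e: "rooted_apex i U P Q" if "rooted_apex i p (P \<union> l) w"
      proof -
        have "rooted_apex i p (P \<union> l) (Q \<union> R)"
          by (rule rooted_apex_mono[OF that]) (use cR wne in \<open>auto simp: R_def\<close>)
        then show ?thesis by (rule rooted_apex_inner) (use p sR na n sL ne in simp_all)
      qed
      have e': "rooted_apex i U P Q" if "rooted_apex i p' w (Q \<union> r)"
      proof -
        have "rooted_apex i p' (P \<union> L) (Q \<union> r)"
          by (rule rooted_apex_mono[OF that]) (use n ne in \<open>auto simp: L_def\<close>)
        then show ?thesis by (rule rooted_apex_inner) (use p sL na cL ne in simp_all)
      qed
      have f: "rooted_apex j U Q P" if "rooted_apex j p w (P \<union> l)"
      proof -
        have "rooted_apex j p (Q \<union> R) (P \<union> l)"
          by (rule rooted_apex_mono[OF that]) (use n ne in \<open>auto simp: R_def\<close>)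
        then show ?thesis by (rule rooted_apex_inner) (use p sR na cR ne in simp_all)
      qed
      have f': "rooted_apex j U Q P" if "rooted_apex j p' (Q \<union> r) w"
      proof -
        have "rooted_apex j p' (Q \<union> r) (P \<union> L)"
          by (rule rooted_apex_mono[OF that]) (use cL wne in \<open>auto simp: L_def\<close>)
        then show ?thesis by (rule rooted_apex_inner) (use p sL na n ne in simp_all)
      qed
      obtain s' where s': "s = Suc s'" using False by (cases s) auto
      have "i + j + s' = n" using Suc.hyps(2) s' by simp
      from IH[OF this p(4) h1] IH[OF this p(5) h2] show ?thesis
      proof (elim disjE)
        assume t: "triang s' (P \<union> l) w p" "triang s' w (Q \<union> r) p'"
        have "triang s P Q U" unfolding s'
          by (rule triang_series[OF t n(1) p(1-3) n(2-4) n(11-13) pc n(7-10) n(14) ne])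
        then show ?thesis by simp
      qed (use e e' f f' in simp_all)
    qed
  qed
qed

end

section \<open>Forests in apex trees and non-crossing graphs in triangulations\<close>

context sym_rel begin

text \<open>Contract a path from the root down to one leaf.\<close>

lemma apex_tree_branch: "apex_tree i R Z A \<Longrightarrow> \<exists>C. R \<subseteq> C \<and> C \<subseteq> Z \<and> conn C \<and> adj C A"
proof (induction i arbitrary: R Z)
  case 0 then show ?case by (intro exI[of _ R]) simp
next
  case (Suc i)
  then obtain R1 Z1 where n: "apex_tree i R1 Z1 A" "conn R" "R \<union> Z1 \<subseteq> Z" "adj R R1"
    by (simp only: apex_tree.simps) (elim exE conjE, simp)
  from Suc.IH[OF n(1)] obtain C where C: "R1 \<subseteq> C" "C \<subseteq> Z1" "conn C" "adj C A" by (elim exE conjE)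
  have "conn (R \<union> C)" using conn_Un[OF n(2) C(3)] adj_mono[OF n(4) order_refl C(1)] by simp
  then show ?case using C n by (intro exI[of _ "R \<union> C"]) auto
qed

text \<open>Acyclicity in the form that the induction uses: after deleting \<open>r\<close>, each
  component is attached to \<open>r\<close> by at most one edge.\<close>

definition acyclic_on :: "'a set \<Rightarrow> bool" where
  "acyclic_on X \<longleftrightarrow> (\<forall>r\<in>X. \<forall>C\<subseteq>X - {r}. conn C \<longrightarrow> (\<forall>a\<in>C. \<forall>b\<in>C. E r a \<longrightarrow> E r b \<longrightarrow> a = b))"

lemma acyclic_onD:
  assumes "acyclic_on X" "r \<in> X" "C \<subseteq> X - {r}" "conn C" "a \<in> C" "b \<in> C" "E r a" "E r b"
  shows "a = b"
  using assms unfolding acyclic_on_def by simp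

lemma acyclic_on_subset: "acyclic_on X \<Longrightarrow> Y \<subseteq> X \<Longrightarrow> acyclic_on Y"
  unfolding acyclic_on_def by (meson Diff_mono order_refl order_trans subsetD)

text \<open>Split off a component \<open>K\<close> of \<open>X - {r}\<close>. It contains at most
  one neighbour of \<open>r\<close>, which becomes the root for one subtree; \<open>X - K\<close>
  goes into the other subtree, again with root \<open>r\<close>, and \<open>R\<close> joins the
  branch set of \<open>r\<close>. Both pieces are smaller, so one level of height is spent per
  vertex.\<close>

lemma forest_in_apex_tree:
  assumes F: "sym_rel F" and "apex_tree i R Z A" "finite X" "r \<in> X" "card X \<le> Suc i" "sym_rel.acyclic_on F X"
  shows "\<exists>\<mu>. (\<forall>x\<in>X. conn (\<mu> x) \<and> \<mu> x \<subseteq> Z \<and> adj (\<mu> x) A) \<and> disjoint_family_on \<mu> X \<and>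
    (\<forall>x\<in>X. \<forall>y\<in>X. F x y \<longrightarrow> x \<noteq> y \<longrightarrow> adj (\<mu> x) (\<mu> y)) \<and> R \<subseteq> \<mu> r"
proof -
  interpret F: sym_rel F by (rule F)
  show ?thesis using assms(2-)
  proof (induction i arbitrary: R Z X r)
    case (0 R Z X r)
    then have X: "X = {r}" using card_le_Suc0_iff_eq[of X] by auto
    from apex_tree_branch[OF 0(1)] obtain C where "R \<subseteq> C" "C \<subseteq> Z" "conn C" "adj C A" by (elim exE conjE)
    then show ?case unfolding X by (intro exI[of _ "\<lambda>_. C"]) (auto simp: disjoint_family_on_def)
  next
    case (Suc i R Z X r)
    show ?case
    proof (cases "X = {r}")
      case True
      from apex_tree_branch[OF Suc.prems(1)] obtain C where "R \<subseteq> C" "C \<subseteq> Z" "conn C" "adj C A" by (elim exE conjE)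
      then show ?thesis unfolding True by (intro exI[of _ "\<lambda>_. C"]) (auto simp: disjoint_family_on_def)
    next
      case False
      then obtain c where c: "c \<in> X - {r}" using Suc.prems(3) by auto
      define K where "K = F.component (X - {r}) c"
      note K = F.component_props[OF c, folded K_def]
      \<comment> \<open>If \<open>K\<close> contains no neighbour of \<open>r\<close>, any of its
        vertices can be its root.\<close>
      obtain c' where c': "c' \<in> K" "\<And>a. a \<in> K \<Longrightarrow> F r a \<Longrightarrow> a = c'"
      proof (cases "\<exists>a\<in>K. F r a")
        case True
        then obtain b where b: "b \<in> K" "F r b" by blast
        have "a = b" if "a \<in> K" "F r a" for a
          by (rule F.acyclic_onD[OF Suc.prems(5,3) K(2,3) that(1) b(1) that(2) b(2)])
        then show thesis using that b by blast
      next
        case False then show thesis using that K(1) by blast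
      qed
      obtain R1 Z1 R2 Z2 where n: "apex_tree i R1 Z1 A" "apex_tree i R2 Z2 A" "conn R"
        "R \<union> Z1 \<union> Z2 \<subseteq> Z" "R \<inter> Z1 = {}" "R \<inter> Z2 = {}" "Z1 \<inter> Z2 = {}" "adj R R1" "adj R R2"
        using Suc.prems(1) by (simp only: apex_tree.simps) (elim exE conjE, simp)
      define X' where "X' = X - K"
      have KX: "K \<subseteq> X" "r \<notin> K" "r \<in> X'" "X' \<subseteq> X" "c \<notin> X'" using K(1,2) Suc.prems(3) by (auto simp: X'_def)
      have fin: "finite K" "finite X'" using KX Suc.prems(2) finite_subset by blast+
      have "card K < card X" "card X' < card X"
        using KX Suc.prems(2,3) c by (auto intro!: psubset_card_mono)
      then have card: "card K \<le> Suc i" "card X' \<le> Suc i" using Suc.prems(4) by simp_all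
      from Suc.IH[OF n(1) fin(1) c'(1) card(1) F.acyclic_on_subset[OF Suc.prems(5) KX(1)]]
      obtain \<mu>1 where m1: "\<forall>x\<in>K. conn (\<mu>1 x) \<and> \<mu>1 x \<subseteq> Z1 \<and> adj (\<mu>1 x) A" "disjoint_family_on \<mu>1 K"
        "\<forall>x\<in>K. \<forall>y\<in>K. F x y \<longrightarrow> x \<noteq> y \<longrightarrow> adj (\<mu>1 x) (\<mu>1 y)" "R1 \<subseteq> \<mu>1 c'" by (elim exE conjE)
      from Suc.IH[OF n(2) fin(2) KX(3) card(2) F.acyclic_on_subset[OF Suc.prems(5) KX(4)]]
      obtain \<mu>2 where m2: "\<forall>x\<in>X'. conn (\<mu>2 x) \<and> \<mu>2 x \<subseteq> Z2 \<and> adj (\<mu>2 x) A" "disjoint_family_on \<mu>2 X'"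
        "\<forall>x\<in>X'. \<forall>y\<in>X'. F x y \<longrightarrow> x \<noteq> y \<longrightarrow> adj (\<mu>2 x) (\<mu>2 y)" "R2 \<subseteq> \<mu>2 r" by (elim exE conjE)
      define \<mu> where "\<mu> x = (if x \<in> K then \<mu>1 x else if x = r then \<mu>2 r \<union> R else \<mu>2 x)" for x
      have mK: "\<mu> x = \<mu>1 x" if "x \<in> K" for x using that by (simp add: \<mu>_def)
      have mX: "\<mu>2 x \<subseteq> \<mu> x" "\<mu> x \<subseteq> \<mu>2 x \<union> R" "x \<noteq> r \<Longrightarrow> \<mu> x = \<mu>2 x" if "x \<in> X'" for x
        using that by (auto simp: \<mu>_def X'_def)
      have mr: "\<mu> r = \<mu>2 r \<union> R" using KX(2) by (simp add: \<mu>_def)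
      have cr: "conn (\<mu> r)"
        unfolding mr using conn_Un[of "\<mu>2 r" R] m2(1,4) KX(3) n(3) adj_mono[OF n(9) order_refl m2(4)] adj_sym by blast
      have Zs: "R \<subseteq> Z" "Z1 \<subseteq> Z" "Z2 \<subseteq> Z" using n(4) by auto
      have XKX: "X = K \<union> X'" using KX by (auto simp: X'_def)
      show ?thesis
      proof (intro exI[of _ \<mu>] conjI ballI impI)
        fix x assume "x \<in> X"
        then consider "x \<in> K" | "x \<in> X'" "x \<noteq> r" | "x = r" unfolding XKX by blast
        then have "conn (\<mu> x) \<and> \<mu> x \<subseteq> Z \<and> adj (\<mu> x) A"
        proof cases
          case 1 then show ?thesis using m1(1)[rule_format, OF 1] mK[OF 1] Zs by auto
        next
          case 2 then show ?thesis using m2(1)[rule_format, OF 2(1)] mX(3)[OF 2] Zs by auto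
        next
          case 3 then show ?thesis using m2(1)[rule_format, OF KX(3)] cr mr Zs by auto
        qed
        then show "conn (\<mu> x)" "\<mu> x \<subseteq> Z" "adj (\<mu> x) A" by simp_all
      next
        show "R \<subseteq> \<mu> r" using mr by simp
        show "disjoint_family_on \<mu> X" unfolding disjoint_family_on_def
        proof (intro ballI impI)
          fix x y assume xy: "x \<in> X" "y \<in> X" "x \<noteq> y"
          have cross: "\<mu> a \<inter> \<mu> b = {}" if "a \<in> K" "b \<in> X'" for a b
          proof -
            have "\<mu> a \<subseteq> Z1" using m1(1)[rule_format, OF that(1)] mK[OF that(1)] by simp
            moreover have "\<mu> b \<subseteq> Z2 \<union> R" using m2(1)[rule_format, OF that(2)] mX(2)[OF that(2)] by blast
            ultimately show ?thesis using n(5,7) by blast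
          qed
          have X'X': "\<mu> a \<inter> \<mu> b = {}" if "a \<in> X'" "b \<in> X'" "a \<noteq> b" "a \<noteq> r" for a b
          proof -
            have "\<mu>2 a \<inter> \<mu>2 b = {}" using m2(2) that by (simp add: disjoint_family_on_def)
            moreover have "\<mu>2 a \<inter> R = {}" using m2(1)[rule_format, OF that(1)] n(6) by blast
            ultimately show ?thesis using mX(3)[OF that(1,4)] mX(2)[OF that(2)] by blast
          qed
          consider "x \<in> K" "y \<in> K" | "x \<in> K" "y \<in> X'" | "y \<in> K" "x \<in> X'" | "x \<in> X'" "y \<in> X'"
            using xy unfolding XKX by blast
          then show "\<mu> x \<inter> \<mu> y = {}"
          proof cases
            case 1 then show ?thesis using m1(2) xy(3) mK by (simp add: disjoint_family_on_def)
          next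
            case 2 then show ?thesis by (rule cross)
          next
            case 3 then show ?thesis using cross by blast
          next
            case 4 then show ?thesis using X'X'[of x y] X'X'[of y x] xy(3) by blast
          qed
        qed
      next
        fix x y assume xy: "x \<in> X" "y \<in> X" "F x y" "x \<noteq> y"
        have cross: "adj (\<mu> a) (\<mu> b)" if ab: "a \<in> K" "b \<in> X'" "F a b" for a b
        proof -
          have "b = r"
          proof (rule ccontr)
            assume "b \<noteq> r"
            then have "b \<in> X - {r} - K" using ab(2) by (auto simp: X'_def)
            then show False using K(4) ab(1,3) by (auto simp: F.adj_def)
          qed
          then have "a = c'" using c'(2) ab F.sym by blast
          have "adj (\<mu>1 c') R" using adj_mono[OF n(8) order_refl m1(4)] adj_sym by blast
          then show ?thesis using \<open>a = c'\<close> \<open>b = r\<close> mK[OF c'(1)] mr by simp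
        qed
        consider "x \<in> K" "y \<in> K" | "x \<in> K" "y \<in> X'" | "y \<in> K" "x \<in> X'" | "x \<in> X'" "y \<in> X'"
          using xy unfolding XKX by blast
        then show "adj (\<mu> x) (\<mu> y)"
        proof cases
          case 1 then show ?thesis using m1(3) xy mK by simp
        next
          case 2 then show ?thesis using cross xy by simp
        next
          case 3 then show ?thesis using cross[of y x] xy F.sym adj_sym by blast
        next
          case 4
          then have "adj (\<mu>2 x) (\<mu>2 y)" using m2(3) xy by simp
          then show ?thesis by (rule adj_mono) (use 4 mX(1) in simp_all)
        qed
      qed
    qed
  qed
qed

lemma noncrossing_edge:
  fixes a :: nat
  assumes "conn P" "conn Q" "P \<inter> Q = {}"
  shows "\<exists>\<mu>. (\<forall>i\<in>{a..Suc a}. conn (\<mu> i)) \<and> disjoint_family_on \<mu> {a..Suc a} \<and> P \<subseteq> \<mu> a \<and> \<mu> a \<subseteq> P \<union> X \<and>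
    Q \<subseteq> \<mu> (Suc a) \<and> \<mu> (Suc a) \<subseteq> Q \<union> X \<and> (\<forall>i. a < i \<longrightarrow> i < Suc a \<longrightarrow> \<mu> i \<subseteq> X) \<and>
    (\<forall>x y. a \<le> x \<longrightarrow> x < y \<longrightarrow> y \<le> Suc a \<longrightarrow> N x y \<longrightarrow> (x, y) \<noteq> (a, Suc a) \<longrightarrow> adj (\<mu> x) (\<mu> y))"
proof -
  have "{a..Suc a} = {a, Suc a}" by auto
  moreover have "(x, y) = (a, Suc a)" if "a \<le> x" "x < y" "y \<le> Suc a" for x y using that by simp
  ultimately show ?thesis using assms
    by (intro exI[of _ "\<lambda>i. if i = a then P else Q"]) (simp add: disjoint_family_on_def Int_commute)
qed

text \<open>The pair \<open>(a, b)\<close> is excluded because an even stage lacks its first edge.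
  The chosen \<open>w\<close> lies under no edge except possibly this one, so it becomes the corner
  of the triangle on \<open>a\<close> and \<open>b\<close>, and the intervals on both sides are
  independent. Each is shorter by at least one, hence \<open>j\<close> layers suffice for
  \<open>b \<le> Suc (a + j)\<close>.\<close>

lemma noncrossing_in_triang:
  fixes N :: "nat \<Rightarrow> nat \<Rightarrow> bool"
  assumes nc: "\<And>a b c d. a < b \<Longrightarrow> b < c \<Longrightarrow> c < d \<Longrightarrow> N a c \<Longrightarrow> N b d \<Longrightarrow> False"
    and "triang (2 * j) P Q X" "conn P" "conn Q" "P \<inter> Q = {}" "X \<inter> P = {}" "X \<inter> Q = {}" "a < b" "b \<le> Suc (a + j)"
  shows "\<exists>\<mu>. (\<forall>i\<in>{a..b}. conn (\<mu> i)) \<and> disjoint_family_on \<mu> {a..b} \<and> P \<subseteq> \<mu> a \<and> \<mu> a \<subseteq> P \<union> X \<and>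
    Q \<subseteq> \<mu> b \<and> \<mu> b \<subseteq> Q \<union> X \<and> (\<forall>i. a < i \<longrightarrow> i < b \<longrightarrow> \<mu> i \<subseteq> X) \<and>
    (\<forall>x y. a \<le> x \<longrightarrow> x < y \<longrightarrow> y \<le> b \<longrightarrow> N x y \<longrightarrow> (x, y) \<noteq> (a, b) \<longrightarrow> adj (\<mu> x) (\<mu> y))"
  using assms(2-)
proof (induction j arbitrary: P Q X a b)
  case 0
  then have "b = Suc a" by simp
  then show ?case using noncrossing_edge[OF 0(2-4)] by simp
next
  case (Suc j)
  show ?case
  proof (cases "b = Suc a")
    case True
    then show ?thesis using noncrossing_edge[OF Suc.prems(2-4)] by simp
  next
    case False
    define S where "S = {i. a < i \<and> i < b \<and> N a i}"
    have finS: "finite S" by (rule finite_subset[of _ "{..<b}"]) (auto simp: S_def)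
    \<comment> \<open>The largest neighbour of \<open>a\<close> before \<open>b\<close>: an edge
      over it from \<open>a\<close> would contradict maximality, any other would cross the edge from
      \<open>a\<close> to \<open>w\<close>. Without such a neighbour \<open>Suc a\<close> works,
      since an edge over it must start in \<open>a\<close>.\<close>
    define w where "w = (if S = {} then Suc a else Max S)"
    have wS: "w \<in> S" if "S \<noteq> {}" using that Max_in[OF finS] by (simp add: w_def)
    have "a < w \<and> w < b"
    proof (cases "S = {}")
      case True then show ?thesis using Suc.prems(7) False by (simp add: w_def)
    next
      case False then show ?thesis using wS by (simp add: S_def)
    qed
    then have w: "a < w" "w < b" by simp_all
    have over: "x = a \<and> y = b" if xy: "a \<le> x" "x < w" "w < y" "y \<le> b" "N x y" for x y
    proof (cases "x = a")
      case True
      have "y = b"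
      proof (rule ccontr)
        assume "y \<noteq> b"
        then have "y \<in> S" using xy True w by (simp add: S_def)
        then have "S \<noteq> {}" "y \<le> Max S" using Max_ge[OF finS] by auto
        then show False using xy(3) by (simp add: w_def)
      qed
      then show ?thesis using True by simp
    next
      case False
      then have "S \<noteq> {}" using xy by (auto simp: w_def)
      then have "N a w" using wS by (simp add: S_def)
      then show ?thesis using nc[of a x w y] xy False by auto
    qed
    have t: "triang (Suc (Suc (2 * j))) P Q X" using Suc.prems(1) by simp
    obtain L W R Y Z where n: "L \<union> W \<union> R \<union> Y \<union> Z \<subseteq> X" "L \<inter> W = {}" "L \<inter> R = {}" "L \<inter> Y = {}" "L \<inter> Z = {}"
      "W \<inter> R = {}" "W \<inter> Y = {}" "W \<inter> Z = {}" "R \<inter> Y = {}" "R \<inter> Z = {}" "Y \<inter> Z = {}"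
      "conn (P \<union> L)" "conn (Q \<union> R)" "conn W" "triang (Suc (2 * j)) (P \<union> L) W Y" "triang (Suc (2 * j)) W (Q \<union> R) Z"
      by (rule triang_oddE[OF t]) simp_all
    obtain L1 R1 Y1 where n1: "L1 \<union> R1 \<union> Y1 \<subseteq> Y" "L1 \<inter> R1 = {}" "L1 \<inter> Y1 = {}" "R1 \<inter> Y1 = {}"
      "conn (P \<union> L \<union> L1)" "conn (W \<union> R1)" "adj (P \<union> L \<union> L1) (W \<union> R1)" "triang (2 * j) (P \<union> L \<union> L1) (W \<union> R1) Y1"
      by (rule triang_evenE[OF n(15)]) simp_all
    obtain L2 R2 Z1 where n2: "L2 \<union> R2 \<union> Z1 \<subseteq> Z" "L2 \<inter> R2 = {}" "L2 \<inter> Z1 = {}" "R2 \<inter> Z1 = {}"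
      "conn (W \<union> L2)" "conn (Q \<union> R \<union> R2)" "adj (W \<union> L2) (Q \<union> R \<union> R2)" "triang (2 * j) (W \<union> L2) (Q \<union> R \<union> R2) Z1"
      by (rule triang_evenE[OF n(16)]) simp_all
    have s: "L \<subseteq> X" "W \<subseteq> X" "R \<subseteq> X" "Y \<subseteq> X" "Z \<subseteq> X" using n(1) by auto
    have s1: "L1 \<subseteq> Y" "R1 \<subseteq> Y" "Y1 \<subseteq> Y" "L2 \<subseteq> Z" "R2 \<subseteq> Z" "Z1 \<subseteq> Z" using n1(1) n2(1) by auto
    have PX: "P \<inter> A = {}" "A \<inter> P = {}" "Q \<inter> A = {}" "A \<inter> Q = {}" if "A \<subseteq> X" for A using that Suc.prems(5,6) by blast+
    have YY: "B \<inter> A = {}" "A \<inter> B = {}" if "A \<subseteq> Y" "B = L \<or> B = W \<or> B = R \<or> B \<subseteq> Z" for A B using that n(4,7,9,11) by auto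
    have ZZ: "B \<inter> A = {}" "A \<inter> B = {}" if "A \<subseteq> Z" "B = L \<or> B = W \<or> B = R" for A B using that n(5,8,10) by auto
    note distr = Int_Un_distrib Int_Un_distrib2
    have sX: "L1 \<subseteq> X" "R1 \<subseteq> X" "Y1 \<subseteq> X" "L2 \<subseteq> X" "R2 \<subseteq> X" "Z1 \<subseteq> X" using s s1 by auto
    have "(P \<union> L \<union> L1) \<inter> (W \<union> R1) = {}" "Y1 \<inter> (P \<union> L \<union> L1) = {}" "Y1 \<inter> (W \<union> R1) = {}"
      using n(2) n1(2-4) by (auto simp: distr PX s sX YY s1)
    from Suc.IH[OF n1(8,5,6) this w(1)] Suc.prems(8) w
    obtain \<mu>1 where m1: "\<forall>i\<in>{a..w}. conn (\<mu>1 i)" "disjoint_family_on \<mu>1 {a..w}" "P \<union> L \<union> L1 \<subseteq> \<mu>1 a" "\<mu>1 a \<subseteq> P \<union> L \<union> L1 \<union> Y1"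
      "W \<union> R1 \<subseteq> \<mu>1 w" "\<mu>1 w \<subseteq> W \<union> R1 \<union> Y1" "\<forall>i. a < i \<longrightarrow> i < w \<longrightarrow> \<mu>1 i \<subseteq> Y1"
      "\<forall>x y. a \<le> x \<longrightarrow> x < y \<longrightarrow> y \<le> w \<longrightarrow> N x y \<longrightarrow> (x, y) \<noteq> (a, w) \<longrightarrow> adj (\<mu>1 x) (\<mu>1 y)"
      by (auto elim!: exE)
    have "(W \<union> L2) \<inter> (Q \<union> R \<union> R2) = {}" "Z1 \<inter> (W \<union> L2) = {}" "Z1 \<inter> (Q \<union> R \<union> R2) = {}"
      using n(6) n2(2-4) by (auto simp: distr PX s sX ZZ s1)
    from Suc.IH[OF n2(8,5,6) this w(2)] Suc.prems(8) w
    obtain \<mu>2 where m2: "\<forall>i\<in>{w..b}. conn (\<mu>2 i)" "disjoint_family_on \<mu>2 {w..b}" "W \<union> L2 \<subseteq> \<mu>2 w" "\<mu>2 w \<subseteq> W \<union> L2 \<union> Z1"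
      "Q \<union> R \<union> R2 \<subseteq> \<mu>2 b" "\<mu>2 b \<subseteq> Q \<union> R \<union> R2 \<union> Z1" "\<forall>i. w < i \<longrightarrow> i < b \<longrightarrow> \<mu>2 i \<subseteq> Z1"
      "\<forall>x y. w \<le> x \<longrightarrow> x < y \<longrightarrow> y \<le> b \<longrightarrow> N x y \<longrightarrow> (x, y) \<noteq> (w, b) \<longrightarrow> adj (\<mu>2 x) (\<mu>2 y)"
      by (auto elim!: exE)
    define \<mu> where "\<mu> i = (if i < w then \<mu>1 i else if i = w then \<mu>1 w \<union> \<mu>2 w else \<mu>2 i)" for i
    have low: "\<mu>1 i \<subseteq> P \<union> L \<union> Y" if "a \<le> i" "i < w" for i
    proof (cases "i = a")
      case True
      have "P \<union> L \<union> L1 \<union> Y1 \<subseteq> P \<union> L \<union> Y" using s1 by auto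
      then show ?thesis using order_trans[OF m1(4)] True by blast
    next
      case False
      then have "\<mu>1 i \<subseteq> Y1" using m1(7) that by simp
      then show ?thesis using s1(3) by auto
    qed
    have high: "\<mu>2 i \<subseteq> Q \<union> R \<union> Z" if "w < i" "i \<le> b" for i
    proof (cases "i = b")
      case True
      have "Q \<union> R \<union> R2 \<union> Z1 \<subseteq> Q \<union> R \<union> Z" using s1 by auto
      then show ?thesis using order_trans[OF m2(6)] True by blast
    next
      case False
      then have "\<mu>2 i \<subseteq> Z1" using m2(7) that by simp
      then show ?thesis using s1(6) by auto
    qed
    have mid: "\<mu>1 w \<subseteq> W \<union> Y" "\<mu>2 w \<subseteq> W \<union> Z" using m1(6) m2(4) s1 by auto
    have e1: "adj (\<mu>1 x) (\<mu>1 y)" if "a \<le> x" "x < y" "y \<le> w" "N x y" for x y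
      using that m1(8) adj_mono[OF n1(7) m1(3,5)] by (cases "(x, y) = (a, w)") auto
    have e2: "adj (\<mu>2 x) (\<mu>2 y)" if "w \<le> x" "x < y" "y \<le> b" "N x y" for x y
      using that m2(8) adj_mono[OF n2(7) m2(3,5)] by (cases "(x, y) = (w, b)") auto
    have Wne: "W \<noteq> {}" using conn_nonempty n(14) by blast
    have "\<mu>1 w \<inter> \<mu>2 w \<noteq> {}" using m1(5) m2(3) Wne by blast
    moreover have "conn (\<mu>1 w)" "conn (\<mu>2 w)" using m1(1) m2(1) w by simp_all
    ultimately have cw: "conn (\<mu> w)" unfolding \<mu>_def using conn_Un_meet[of "\<mu>1 w" "\<mu>2 w"] by simp
    have key: "(P \<union> L \<union> Y) \<inter> (W \<union> Z) = {}" "(P \<union> L \<union> Y) \<inter> (Q \<union> R \<union> Z) = {}" "(W \<union> Y) \<inter> (Q \<union> R \<union> Z) = {}"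
      using n(2-11) Suc.prems(4) by (auto simp: distr PX s)
    have d: "\<mu> x \<inter> \<mu> y = {}" if xy: "a \<le> x" "x < y" "y \<le> b" for x y
    proof -
      have d1: "\<mu>1 x \<inter> \<mu>1 y = {}" if "y \<le> w" using m1(2) xy that by (simp add: disjoint_family_on_def)
      have d2: "\<mu>2 x \<inter> \<mu>2 y = {}" if "w \<le> x" using m2(2) xy that by (simp add: disjoint_family_on_def)
      consider "y < w" | "y = w" | "x < w" "w < y" | "x = w" | "w < x" using xy by linarith
      then show ?thesis
      proof cases
        case 1 then show ?thesis using d1 xy by (simp add: \<mu>_def)
      next
        case 2
        have "\<mu>1 x \<inter> \<mu>2 w = {}" using low[of x] mid(2) key(1) xy 2 by blast
        then show ?thesis using d1 xy 2 by (simp add: \<mu>_def Int_Un_distrib)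
      next
        case 3
        have "\<mu>1 x \<inter> \<mu>2 y = {}" using low[of x] high[of y] key(2) xy 3 by blast
        then show ?thesis using 3 by (simp add: \<mu>_def)
      next
        case 4
        have "\<mu>1 w \<inter> \<mu>2 y = {}" using mid(1) high[of y] key(3) xy 4 by blast
        then show ?thesis using d2 xy 4 by (simp add: \<mu>_def Int_Un_distrib2)
      next
        case 5 then show ?thesis using d2 xy by (simp add: \<mu>_def)
      qed
    qed
    show ?thesis
    proof (intro exI[of _ \<mu>] conjI allI ballI impI)
      fix i assume i: "i \<in> {a..b}"
      consider "i < w" | "i = w" | "w < i" by linarith
      then show "conn (\<mu> i)"
        by cases (use i m1(1) m2(1) cw in \<open>auto simp: \<mu>_def\<close>)
    next
      show "disjoint_family_on \<mu> {a..b}" unfolding disjoint_family_on_def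
      proof (intro ballI impI)
        fix x y assume "x \<in> {a..b}" "y \<in> {a..b}" "x \<noteq> y"
        then show "\<mu> x \<inter> \<mu> y = {}" using d[of x y] d[of y x] by (cases "x < y") auto
      qed
    next
      have ab: "\<mu> a = \<mu>1 a" "\<mu> b = \<mu>2 b" using w by (simp_all add: \<mu>_def)
      show "P \<subseteq> \<mu> a" "Q \<subseteq> \<mu> b" using m1(3) m2(5) unfolding ab by simp_all
      have "P \<union> L \<union> Y \<subseteq> P \<union> X" "Q \<union> R \<union> Z \<subseteq> Q \<union> X" using s by auto
      then show "\<mu> a \<subseteq> P \<union> X" "\<mu> b \<subseteq> Q \<union> X"
        using order_trans[OF low[of a]] order_trans[OF high[of b]] w unfolding ab by simp_all
    next
      fix i assume i: "a < i" "i < b"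
      consider "i < w" | "i = w" | "w < i" by linarith
      then show "\<mu> i \<subseteq> X"
      proof cases
        case 1
        then have "\<mu>1 i \<subseteq> Y1" using m1(7) i by simp
        then show ?thesis using 1 sX(3) by (auto simp: \<mu>_def)
      next
        case 2 then show ?thesis using mid s by (auto simp: \<mu>_def)
      next
        case 3
        then have "\<mu>2 i \<subseteq> Z1" using m2(7) i by simp
        then show ?thesis using 3 sX(6) by (auto simp: \<mu>_def)
      qed
    next
      fix x y assume xy: "a \<le> x" "x < y" "y \<le> b" "N x y" "(x, y) \<noteq> (a, b)"
      consider "y \<le> w" | "w \<le> x" | "x < w" "w < y" by linarith
      then show "adj (\<mu> x) (\<mu> y)"
      proof cases
        case 1
        have "adj (\<mu>1 x) (\<mu>1 y)" using e1 xy 1 by simp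
        then show ?thesis by (rule adj_mono) (use xy 1 in \<open>auto simp: \<mu>_def\<close>)
      next
        case 2
        have "adj (\<mu>2 x) (\<mu>2 y)" using e2 xy 2 by simp
        then show ?thesis by (rule adj_mono) (use xy 2 in \<open>auto simp: \<mu>_def\<close>)
      next
        case 3 then show ?thesis using over xy by auto
      qed
    qed
  qed
qed

end

section \<open>From binary trees to nested branches\<close>

context sym_rel begin

text \<open>\<open>U\<close> is exactly the union of the branch sets, because the complement of a
  subtree will have to be known and connected.\<close>

fun bintree :: "nat \<Rightarrow> 'a set \<Rightarrow> 'a set \<Rightarrow> bool" where
  "bintree 0 R U \<longleftrightarrow> conn R \<and> U = R"
| "bintree (Suc t) R U \<longleftrightarrow> (\<exists>R1 U1 R2 U2. bintree t R1 U1 \<and> bintree t R2 U2 \<and> conn R \<and> U = R \<union> U1 \<union> U2 \<and>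
    R \<inter> U1 = {} \<and> R \<inter> U2 = {} \<and> U1 \<inter> U2 = {} \<and> adj R R1 \<and> adj R R2)"

lemma bintree_SucE:
  assumes "bintree (Suc t) R U"
  obtains R1 U1 R2 U2 where "bintree t R1 U1" "bintree t R2 U2" "conn R" "U = R \<union> U1 \<union> U2"
    "R \<inter> U1 = {}" "R \<inter> U2 = {}" "U1 \<inter> U2 = {}" "adj R R1" "adj R R2"
  using assms by (simp only: bintree.simps) (elim exE conjE, simp)

lemma bintree_conn: "bintree t R U \<Longrightarrow> conn U \<and> conn R \<and> R \<subseteq> U"
proof (induction t arbitrary: R U)
  case (Suc t)
  obtain R1 U1 R2 U2 where n: "bintree t R1 U1" "bintree t R2 U2" "conn R" "U = R \<union> U1 \<union> U2"
    "R \<inter> U1 = {}" "R \<inter> U2 = {}" "U1 \<inter> U2 = {}" "adj R R1" "adj R R2" by (rule bintree_SucE[OF Suc.prems])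
  note c1 = Suc.IH[OF n(1)] and c2 = Suc.IH[OF n(2)]
  have a: "adj R U1" "adj R U2" using adj_mono[OF n(8), of R U1] adj_mono[OF n(9), of R U2] c1 c2 by simp_all
  have "conn (R \<union> U1)" using conn_Un n(3) c1 a by simp
  then have "conn (R \<union> U1 \<union> U2)" using conn_Un[of "R \<union> U1" U2] c2 a by simp
  then show ?case using n by auto
qed simp

text \<open>Consider the subtrees hanging at depth \<open>d\<close>. If all of them touch
  \<open>A\<close>, contracting each to a leaf gives an apex tree. Otherwise some subtree
  \<open>y\<close> misses \<open>A\<close>, and what is left after its removal is connected and
  contains the root; the case \<open>y = U\<close> arises only for \<open>d = 0\<close>.\<close>

lemma bintree_escape:
  assumes "bintree (d + t) R U"
  shows "(\<exists>R'. R \<subseteq> R' \<and> apex_tree d R' U A) \<or>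
    (\<exists>S y. bintree t S y \<and> y \<subseteq> U \<and> \<not> adj y A \<and>
      (y = U \<and> S = R \<or> R \<subseteq> U - y \<and> conn (U - y) \<and> adj S (U - y)))"
  using assms
proof (induction d arbitrary: R U)
  case 0
  then have c: "conn U" "R \<subseteq> U" and b: "bintree t R U" using bintree_conn[of t R U] by simp_all
  show ?case
  proof (cases "adj U A")
    case True then show ?thesis using c by (intro disjI1 exI[of _ U]) simp
  next
    case False then show ?thesis using b by (intro disjI2 exI[of _ R] exI[of _ U]) simp
  qed
next
  case (Suc d)
  have "bintree (Suc (d + t)) R U" using Suc.prems by simp
  then obtain R1 U1 R2 U2 where n: "bintree (d + t) R1 U1" "bintree (d + t) R2 U2" "conn R" "U = R \<union> U1 \<union> U2"
    "R \<inter> U1 = {}" "R \<inter> U2 = {}" "U1 \<inter> U2 = {}" "adj R R1" "adj R R2" by (rule bintree_SucE)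
  have step: "\<exists>S y. bintree t S y \<and> y \<subseteq> U \<and> \<not> adj y A \<and> (y = U \<and> S = R \<or> R \<subseteq> U - y \<and> conn (U - y) \<and> adj S (U - y))"
    if ex: "\<exists>S y. bintree t S y \<and> y \<subseteq> W1 \<and> \<not> adj y A \<and> (y = W1 \<and> S = S1 \<or> S1 \<subseteq> W1 - y \<and> conn (W1 - y) \<and> adj S (W1 - y))"
      and o: "bintree (d + t) S1 W1" "bintree (d + t) S2 W2" "U = R \<union> W1 \<union> W2"
        "R \<inter> W1 = {}" "W1 \<inter> W2 = {}" "adj R S1" "adj R S2" for S1 W1 S2 W2
  proof -
    from ex obtain S y where W: "bintree t S y" "y \<subseteq> W1" "\<not> adj y A"
      "y = W1 \<and> S = S1 \<or> S1 \<subseteq> W1 - y \<and> conn (W1 - y) \<and> adj S (W1 - y)" by (elim exE conjE)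
    note c1 = bintree_conn[OF o(1)] and c2 = bintree_conn[OF o(2)]
    have cR: "conn (R \<union> W2)" using conn_Un[OF n(3)] c2 adj_mono[OF o(7), of R W2] by simp
    have RU: "R \<subseteq> U - y" using o(3,4) W(2) by blast
    from W(4) have "conn (U - y) \<and> adj S (U - y)"
    proof
      assume y: "y = W1 \<and> S = S1"
      have eq: "U - y = R \<union> W2" using y o(3-5) by blast
      show ?thesis unfolding eq using cR y o(6) adj_sym[of R S1] by simp
    next
      assume f: "S1 \<subseteq> W1 - y \<and> conn (W1 - y) \<and> adj S (W1 - y)"
      have eq: "U - y = R \<union> W2 \<union> (W1 - y)" using o(3-5) W(2) by blast
      have "adj (R \<union> W2) (W1 - y)" using adj_mono[OF o(6), of "R \<union> W2" "W1 - y"] f by simp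
      then show ?thesis unfolding eq using conn_Un[OF cR, of "W1 - y"] f by simp
    qed
    moreover have "y \<subseteq> U" using W(2) o(3) by blast
    ultimately show ?thesis using W(1,3) RU by (intro exI[of _ S] exI[of _ y]) simp
  qed
  have eq: "U = R \<union> U2 \<union> U1" "U2 \<inter> U1 = {}" using n(4,7) by auto
  from Suc.IH[OF n(1)] show ?case
  proof
    assume "\<exists>S y. bintree t S y \<and> y \<subseteq> U1 \<and> \<not> adj y A \<and> (y = U1 \<and> S = R1 \<or> R1 \<subseteq> U1 - y \<and> conn (U1 - y) \<and> adj S (U1 - y))"
    from step[OF this n(1,2,4,5,7,8,9)] show ?thesis by (rule disjI2)
  next
    assume a1: "\<exists>R'. R1 \<subseteq> R' \<and> apex_tree d R' U1 A"
    from Suc.IH[OF n(2)] show ?thesis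
    proof
      assume "\<exists>S y. bintree t S y \<and> y \<subseteq> U2 \<and> \<not> adj y A \<and> (y = U2 \<and> S = R2 \<or> R2 \<subseteq> U2 - y \<and> conn (U2 - y) \<and> adj S (U2 - y))"
      from step[OF this n(2,1) eq(1) n(6) eq(2) n(9,8)] show ?thesis by (rule disjI2)
    next
      assume "\<exists>R'. R2 \<subseteq> R' \<and> apex_tree d R' U2 A"
      then obtain R1' R2' where r: "R1 \<subseteq> R1'" "apex_tree d R1' U1 A" "R2 \<subseteq> R2'" "apex_tree d R2' U2 A"
        using a1 by (elim exE conjE)
      have "adj R R1'" "adj R R2'" using adj_mono[OF n(8) order_refl r(1)] adj_mono[OF n(9) order_refl r(3)] .
      then have "apex_tree (Suc d) R U A" unfolding apex_tree.simps
        using r n by (intro exI[of _ R1'] exI[of _ U1] exI[of _ R2'] exI[of _ U2]) simp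
      then show ?thesis by (intro disjI1 exI[of _ R]) simp
    qed
  qed
qed

text \<open>The nodes below \<open>a\<close> up to depth \<open>t\<close> in the numbering with children \<open>2 * a\<close> and \<open>2 * a + 1\<close>.\<close>

fun below :: "nat \<Rightarrow> nat \<Rightarrow> nat set" where
  "below 0 a = {a}"
| "below (Suc t) a = insert a (below t (2 * a) \<union> below t (2 * a + 1))"

lemma div_power_Suc: "k div 2 ^ Suc i = k div 2 ^ i div (2::nat)"
  by (simp only: power_Suc2 div_mult2_eq)

lemma below_div: "k \<in> below t a \<Longrightarrow> \<exists>i. k div 2 ^ i = a"
proof (induction t arbitrary: a)
  case 0 then show ?case by (auto intro: exI[of _ 0])
next
  case (Suc t)
  then consider "k = a" | "k \<in> below t (2 * a)" | "k \<in> below t (2 * a + 1)" by auto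
  then show ?case
  proof cases
    case 1 then show ?thesis by (auto intro: exI[of _ 0])
  next
    case 2
    from Suc.IH[OF 2] obtain i where "k div 2 ^ i = 2 * a" ..
    then have "k div 2 ^ Suc i = a" unfolding div_power_Suc by simp
    then show ?thesis ..
  next
    case 3
    from Suc.IH[OF 3] obtain i where "k div 2 ^ i = 2 * a + 1" ..
    then have "k div 2 ^ Suc i = a" unfolding div_power_Suc by simp
    then show ?thesis ..
  qed
qed

text \<open>Ancestors arise by repeated halving. A common descendant of both children would have
  \<open>2 * a\<close> and \<open>2 * a + 1\<close> among its ancestors; at the same distance they
  would be equal, and otherwise the farther one would be at most half of the nearer one.\<close>

lemma below_disjoint:
  assumes "1 \<le> a"
  shows "a \<notin> below t (2 * a)" "a \<notin> below t (2 * a + 1)" "below t (2 * a) \<inter> below t (2 * a + 1) = {}"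
proof -
  have no: False if "a div 2 ^ i = b" "a < b" for i b using that div_le_dividend[of a "2 ^ i"] by simp
  show "a \<notin> below t (2 * a)" "a \<notin> below t (2 * a + 1)"
    using below_div no assms by fastforce+
  have cmp: "k div 2 ^ j \<le> (k div 2 ^ i) div 2" if "i < j" for i j k :: nat
  proof -
    have "(2::nat) ^ j = 2 ^ Suc i * 2 ^ (j - Suc i)"
      using that by (metis Suc_leI le_add_diff_inverse power_add)
    then have "k div 2 ^ j = (k div 2 ^ Suc i) div 2 ^ (j - Suc i)" by (simp only: div_mult2_eq)
    also have "\<dots> \<le> k div 2 ^ Suc i" by (rule div_le_dividend)
    also have "\<dots> = (k div 2 ^ i) div 2" by (rule div_power_Suc)
    finally show ?thesis .
  qed
  show "below t (2 * a) \<inter> below t (2 * a + 1) = {}"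
  proof (rule ccontr)
    assume "below t (2 * a) \<inter> below t (2 * a + 1) \<noteq> {}"
    then obtain k where "k \<in> below t (2 * a)" "k \<in> below t (2 * a + 1)" by blast
    then obtain i j where ij: "k div 2 ^ i = 2 * a" "k div 2 ^ j = 2 * a + 1" using below_div by metis
    then consider "i < j" | "j < i" | "i = j" by linarith
    then show False using cmp[of i j k] cmp[of j i k] ij assms by cases auto
  qed
qed

lemma below_bounds: "1 \<le> a \<Longrightarrow> k \<in> below t a \<Longrightarrow> a \<le> k \<and> k < (a + 1) * 2 ^ t"
proof (induction t arbitrary: a)
  case (Suc t)
  have "a < (a + 1) * (2 * 2 ^ t)" using mult_le_mono2[of 1 "2 * 2 ^ t" "a + 1"] by simp
  then show ?case using Suc.IH[of "2 * a"] Suc.IH[of "2 * a + 1"] Suc.prems by (auto simp: algebra_simps)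
qed simp

lemma below_parent: "k \<in> below t a \<Longrightarrow> k \<noteq> a \<Longrightarrow> k div 2 \<in> below t a"
proof (induction t arbitrary: a)
  case (Suc t)
  have "b div 2 = a" if "b = 2 * a \<or> b = 2 * a + 1" for b using that by auto
  moreover from Suc.prems obtain b where "b = 2 * a \<or> b = 2 * a + 1" "k \<in> below t b" by auto
  ultimately show ?case using Suc.IH[of b] by (cases "k = b") auto
qed simp

lemma bintree_of_model:
  assumes "1 \<le> a" "\<And>k. k \<in> below t a \<Longrightarrow> conn (B k)" "disjoint_family_on B (below t a)"
    "\<And>k. k \<in> below t a \<Longrightarrow> k \<noteq> a \<Longrightarrow> adj (B k) (B (k div 2))"
  shows "bintree t (B a) (\<Union>k\<in>below t a. B k)"
  using assms
proof (induction t arbitrary: a)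
  case (Suc t)
  have a: "a \<in> below (Suc t) a" by simp
  have sub: "below t (2 * a) \<subseteq> below (Suc t) a" "below t (2 * a + 1) \<subseteq> below (Suc t) a" by auto
  have root: "b \<in> below t b" for b by (cases t) auto
  note bd = below_disjoint[OF Suc.prems(1), of t]
  have disj: "(\<Union>k\<in>I. B k) \<inter> (\<Union>k\<in>J. B k) = {}" if "I \<subseteq> below (Suc t) a" "J \<subseteq> below (Suc t) a" "I \<inter> J = {}" for I J
  proof (rule equals0I)
    fix x assume "x \<in> (\<Union>k\<in>I. B k) \<inter> (\<Union>k\<in>J. B k)"
    then obtain i j where ij: "i \<in> I" "j \<in> J" "x \<in> B i" "x \<in> B j" by blast
    then have "i \<noteq> j" using that(3) by blast
    then have "B i \<inter> B j = {}" using Suc.prems(3) ij(1,2) that(1,2) unfolding disjoint_family_on_def by (meson subsetD)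
    then show False using ij by blast
  qed
  have sub_tree: "bintree t (B b) (\<Union>k\<in>below t b. B k)" if b: "b = 2 * a \<or> b = 2 * a + 1" for b
  proof (rule Suc.IH)
    have s: "below t b \<subseteq> below (Suc t) a" using b sub by auto
    show "1 \<le> b" using b Suc.prems(1) by auto
    show "disjoint_family_on B (below t b)" using disjoint_family_on_mono[OF s Suc.prems(3)] .
    have "a \<notin> below t b" using b bd by auto
    then show "adj (B k) (B (k div 2))" if "k \<in> below t b" "k \<noteq> b" for k using Suc.prems(4)[of k] s that by auto
    show "conn (B k)" if "k \<in> below t b" for k using Suc.prems(2) s that by blast
  qed
  have adjs: "adj (B a) (B b)" if b: "b = 2 * a \<or> b = 2 * a + 1" for b
  proof -
    have "b \<in> below (Suc t) a" "b \<noteq> a" "b div 2 = a" using b root[of b] Suc.prems(1) by auto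
    then show ?thesis using Suc.prems(4)[of b] adj_sym by simp
  qed
  have "bintree (Suc t) (B a) (B a \<union> (\<Union>k\<in>below t (2 * a). B k) \<union> (\<Union>k\<in>below t (2 * a + 1). B k))"
    unfolding bintree.simps
  proof (intro exI conjI)
    show "bintree t (B (2 * a)) (\<Union>k\<in>below t (2 * a). B k)" "bintree t (B (2 * a + 1)) (\<Union>k\<in>below t (2 * a + 1). B k)"
      using sub_tree by simp_all
    show "conn (B a)" using Suc.prems(2)[OF a] .
    show "B a \<inter> (\<Union>k\<in>below t (2 * a). B k) = {}" "B a \<inter> (\<Union>k\<in>below t (2 * a + 1). B k) = {}"
      using disj[of "{a}" "below t (2 * a)"] disj[of "{a}" "below t (2 * a + 1)"] a sub bd by simp_all
    show "(\<Union>k\<in>below t (2 * a). B k) \<inter> (\<Union>k\<in>below t (2 * a + 1). B k) = {}"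
      using disj[OF sub bd(3)] .
    show "adj (B a) (B (2 * a))" "adj (B a) (B (2 * a + 1))" using adjs by simp_all
  qed simp
  moreover have "B a \<union> (\<Union>k\<in>below t (2 * a). B k) \<union> (\<Union>k\<in>below t (2 * a + 1). B k) = (\<Union>k\<in>below (Suc t) a. B k)"
    by auto
  ultimately show ?case by metis
qed simp

end

section \<open>Nested pairs inside a binary tree\<close>

context two_conn_graph begin

lemma bintree_card:
  assumes "bintree (Suc t) R U" "U \<subseteq> V" shows "2 \<le> card U"
proof -
  obtain R1 U1 R2 U2 where n: "bintree t R1 U1" "bintree t R2 U2" "conn R" "U = R \<union> U1 \<union> U2"
    "R \<inter> U1 = {}" "R \<inter> U2 = {}" "U1 \<inter> U2 = {}" "adj R R1" "adj R R2" by (rule bintree_SucE[OF assms(1)])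
  obtain x where x: "x \<in> R" using conn_nonempty[OF n(3)] by blast
  obtain y where y: "y \<in> U1" using conn_nonempty bintree_conn[OF n(1)] by blast
  have "{x, y} \<subseteq> U" "x \<noteq> y" using x y n(4,5) by auto
  then show ?thesis using card_mono[of U "{x, y}"] assms(2) finite_V finite_subset by fastforce
qed

text \<open>One level of nesting costs \<open>Suc d\<close> levels of the tree: one to split at the
  root and \<open>d\<close> to find in each half \<open>W1\<close> a subtree that
  \<open>V - W1\<close> does not touch. If there were none, \<open>bintree_escape\<close> would give
  an apex tree with apex \<open>V - W1\<close>. The additional level gives the innermost branches
  two vertices.\<close>

lemma nested_of_bintree:
  assumes noapex: "\<And>R Z A. apex_tree d R Z A \<Longrightarrow> Z \<subseteq> V \<Longrightarrow> A \<subseteq> V \<Longrightarrow> Z \<inter> A = {} \<Longrightarrow> conn A \<Longrightarrow> False"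
    and "bintree (Suc d * h + 1) R U" "U \<subseteq> V" "conn (V - U)" "adj R (V - U)"
  shows "nested h U"
  using assms(2-)
proof (induction h arbitrary: R U)
  case 0
  then have b: "bintree (Suc 0) R U" by (simp only: mult_0_right add_0 One_nat_def)
  show ?case using bintree_conn[OF b] bintree_card[OF b 0(2)] 0(2) by (simp only: nested.simps)
next
  case (Suc h)
  let ?t = "Suc d * h + 1"
  have "bintree (Suc (d + ?t)) R U" using Suc.prems(1) by (simp add: algebra_simps)
  then obtain R1 U1 R2 U2 where n: "bintree (d + ?t) R1 U1" "bintree (d + ?t) R2 U2" "conn R" "U = R \<union> U1 \<union> U2"
    "R \<inter> U1 = {}" "R \<inter> U2 = {}" "U1 \<inter> U2 = {}" "adj R R1" "adj R R2" by (rule bintree_SucE)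
  have eq2: "U = R \<union> U2 \<union> U1" "U2 \<inter> U1 = {}" using n(4,7) by auto
  have branch: "\<exists>S y. bintree ?t S y \<and> y \<subseteq> W1 \<and> \<not> adj y (V - W1) \<and> S1 \<subseteq> W1 - y \<and> conn (W1 - y) \<and> adj S (W1 - y) \<and> nested h y"
    if o: "bintree (d + ?t) S1 W1" "bintree (d + ?t) S2 W2" "U = R \<union> W1 \<union> W2"
      "R \<inter> W1 = {}" "W1 \<inter> W2 = {}" "adj R S1" "adj R S2" for S1 W1 S2 W2
  proof -
    note c1 = bintree_conn[OF o(1)] and c2 = bintree_conn[OF o(2)]
    have cR: "conn (R \<union> W2)" using conn_Un[OF n(3)] c2 adj_mono[OF o(7), of R W2] by simp
    have eq: "V - W1 = (V - U) \<union> (R \<union> W2)" using o(3-5) Suc.prems(2) by blast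
    have cV: "conn (V - W1)" unfolding eq
      using conn_Un[OF Suc.prems(3) cR] adj_mono[OF Suc.prems(4), of "R \<union> W2" "V - U"] adj_sym by auto
    have aS: "adj S1 (V - W1)" unfolding eq using o(6) adj_sym by auto
    have WV: "W1 \<subseteq> V" using o(3) Suc.prems(2) by blast
    from bintree_escape[OF o(1), of "V - W1"] show ?thesis
    proof
      assume "\<exists>R'. S1 \<subseteq> R' \<and> apex_tree d R' W1 (V - W1)"
      then obtain R' where "apex_tree d R' W1 (V - W1)" by (elim exE conjE)
      then show ?thesis using noapex[of R' W1 "V - W1"] WV cV by auto
    next
      assume "\<exists>S y. bintree ?t S y \<and> y \<subseteq> W1 \<and> \<not> adj y (V - W1) \<and>
        (y = W1 \<and> S = S1 \<or> S1 \<subseteq> W1 - y \<and> conn (W1 - y) \<and> adj S (W1 - y))"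
      then obtain S y where y: "bintree ?t S y" "y \<subseteq> W1" "\<not> adj y (V - W1)"
        "y = W1 \<and> S = S1 \<or> S1 \<subseteq> W1 - y \<and> conn (W1 - y) \<and> adj S (W1 - y)" by (elim exE conjE)
      \<comment> \<open>The root of the half touches \<open>R\<close>, which lies outside it, so
        \<open>y\<close> is a proper part of the half.\<close>
      have "\<not> adj S1 (V - W1)" if "y = W1" using that y(3) adj_mono[of S1 "V - W1" W1 "V - W1"] c1 by blast
      then have y4: "S1 \<subseteq> W1 - y" "conn (W1 - y)" "adj S (W1 - y)" using y(4) aS by auto
      have eqy: "V - y = (V - W1) \<union> (W1 - y)" using WV y(2) by blast
      have "adj (V - W1) (W1 - y)" using adj_mono[OF aS y4(1) order_refl] adj_sym by blast
      then have cy: "conn (V - y)" unfolding eqy by (rule conn_Un[OF cV y4(2)])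
      have ay: "adj S (V - y)" unfolding eqy using y4(3) by simp
      have "nested h y" by (rule Suc.IH[OF y(1) _ cy ay]) (use y(2) WV in auto)
      then show ?thesis using y(1-3) y4 by (intro exI[of _ S] exI[of _ y]) simp
    qed
  qed
  from branch[OF n(1,2,4,5,7,8,9)] obtain S y where
    y: "bintree ?t S y" "y \<subseteq> U1" "\<not> adj y (V - U1)" "R1 \<subseteq> U1 - y" "conn (U1 - y)" "adj S (U1 - y)" "nested h y"
    by (elim exE conjE)
  from branch[OF n(2,1) eq2(1) n(6) eq2(2) n(9,8)] obtain S' y' where
    y': "bintree ?t S' y'" "y' \<subseteq> U2" "\<not> adj y' (V - U2)" "R2 \<subseteq> U2 - y'" "conn (U2 - y')" "adj S' (U2 - y')" "nested h y'"
    by (elim exE conjE)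
  have nb: "nbrs z \<subseteq> W - z" if "\<not> adj z (V - W)" for z W
    using that E_V' unfolding adj_def nbrs_def by blast
  have "split_pair U y y'" unfolding split_pair_def
  proof (intro conjI)
    show "U \<subseteq> V" "conn U" using Suc.prems(2) bintree_conn[OF Suc.prems(1)] by simp_all
    show "y \<subseteq> U" "y' \<subseteq> U" "y \<inter> y' = {}" using y(2) y'(2) n(4,7) by auto
    show "conn y" "conn y'" "2 \<le> card y" "2 \<le> card y'" using nested_basic y(7) y'(7) by simp_all
    have dU: "U2 \<subseteq> V - U1" using n(4,7) Suc.prems(2) by auto
    show "\<not> adj y y'" using y(3) adj_mono[of y y' y "V - U1"] y'(2) dU by blast
    have eq: "U - y - y' = R \<union> (U1 - y) \<union> (U2 - y')" using n(4-7) y(2) y'(2) by blast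
    have "conn (R \<union> (U1 - y))" using conn_Un[OF n(3) y(5)] adj_mono[OF n(8) order_refl y(4)] by simp
    then show "conn (U - y - y')" unfolding eq
      using conn_Un[OF _ y'(5), of "R \<union> (U1 - y)"] adj_mono[OF n(9), of R "U2 - y'"] y'(4) by simp
    show "nbrs y \<subseteq> U - y - y'" unfolding eq using nb[OF y(3)] by blast
    show "nbrs y' \<subseteq> U - y - y'" unfolding eq using nb[OF y'(3)] by blast
  qed
  then show ?case using y(7) y'(7) by (simp only: nested.simps) (intro exI[of _ y] exI[of _ y'], simp)
qed

theorem apex_tree_or_triang:
  assumes big: "\<not> good (2 ^ (h + 1) - 2) V" and h: "8 * d * Suc d + 2 \<le> h" and V: "conn V"
  shows "(\<exists>R Z A. apex_tree d R Z A \<and> Z \<subseteq> V \<and> A \<subseteq> V \<and> Z \<inter> A = {} \<and> conn A) \<or>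
    (\<exists>P Q X. triang (2 * d) P Q X \<and> conn P \<and> conn Q \<and> P \<subseteq> V \<and> Q \<subseteq> V \<and> X \<subseteq> V \<and>
      P \<inter> Q = {} \<and> X \<inter> P = {} \<and> X \<inter> Q = {} \<and> adj P Q)"
proof (rule disjCI)
  assume "\<not> (\<exists>P Q X. triang (2 * d) P Q X \<and> conn P \<and> conn Q \<and> P \<subseteq> V \<and> Q \<subseteq> V \<and> X \<subseteq> V \<and>
      P \<inter> Q = {} \<and> X \<inter> P = {} \<and> X \<inter> Q = {} \<and> adj P Q)"
  then have notri: "\<not> triang (2 * d) P Q X"
    if "conn P" "conn Q" "P \<subseteq> V" "Q \<subseteq> V" "X \<subseteq> V" "P \<inter> Q = {}" "X \<inter> P = {}" "X \<inter> Q = {}" "adj P Q" for P Q X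
    using that by blast
  show "\<exists>R Z A. apex_tree d R Z A \<and> Z \<subseteq> V \<and> A \<subseteq> V \<and> Z \<inter> A = {} \<and> conn A"
  proof (rule ccontr)
    assume "\<not> ?thesis"
    then have noapex: False if "apex_tree d R Z A" "Z \<subseteq> V" "A \<subseteq> V" "Z \<inter> A = {}" "conn A" for R Z A
      using that by blast
    \<comment> \<open>\<open>Suc d\<close> tree levels for each of \<open>8 * d\<close> levels of
      nesting, one for the size of the innermost branches, and one to split the whole tree into
      \<open>U1\<close> and a complement that hosts the hubs.\<close>
    define t where "t = 8 * d * Suc d + 2"
    have "\<exists>B. rooted_model (\<lambda>k. k div 2) (Suc (2 ^ (h + 1) - 2)) B"
      by (rule tree_model[OF _ big]) auto
    then obtain B0 where B0: "rooted_model (\<lambda>k. k div 2) (Suc (2 ^ (h + 1) - 2)) B0" ..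
    have idx: "below t 1 \<subseteq> {1..Suc (2 ^ (h + 1) - 2)}"
    proof
      fix k assume "k \<in> below t 1"
      then have k: "1 \<le> k" "k < 2 * 2 ^ t" using below_bounds[of 1 k t] by auto
      have "(2::nat) ^ t \<le> 2 ^ h" using h by (intro power_increasing) (auto simp: t_def)
      moreover have "(1::nat) \<le> 2 ^ h" by simp
      ultimately have "k < 2 ^ h * 2" "2 \<le> (2::nat) ^ h * 2" using k by linarith+
      then have "k \<le> Suc (2 ^ (h + 1) - 2)" unfolding power_add power_one_right by linarith
      then show "k \<in> {1..Suc (2 ^ (h + 1) - 2)}" using k by simp
    qed
    have root: "1 \<in> below t 1" by (simp add: t_def)
    have B0': "conn (B0 k)" "B0 k \<subseteq> V" if "k \<in> below t 1" for k
      using B0 idx that unfolding rooted_model_def by auto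
    have dB0: "disjoint_family_on B0 (below t 1)"
      using B0 disjoint_family_on_mono[OF idx] unfolding rooted_model_def by blast
    \<comment> \<open>Spreading the branch sets over the whole graph makes complements of subtrees
      unions of branch sets, hence connected.\<close>
    have "\<exists>Y. (\<forall>i\<in>below t 1. B0 i \<subseteq> Y i \<and> conn (Y i)) \<and> disjoint_family_on Y (below t 1) \<and> (\<Union>i\<in>below t 1. Y i) = V"
      by (rule absorb[OF finite_V V root]) (use B0' dB0 in simp_all)
    then obtain B where B: "\<forall>i\<in>below t 1. B0 i \<subseteq> B i \<and> conn (B i)" "disjoint_family_on B (below t 1)" "(\<Union>i\<in>below t 1. B i) = V"
      by (elim exE conjE)
    have tree: "bintree t (B 1) V"
      unfolding B(3)[symmetric]
    proof (rule bintree_of_model)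
      fix k assume k: "k \<in> below t 1"
      show "conn (B k)" using B(1) k by simp
      assume "k \<noteq> 1"
      then have k2: "k \<in> {2..Suc (2 ^ (h + 1) - 2)}" using idx k by force
      then have "adj (B0 k) (B0 (k div 2))" using B0 unfolding rooted_model_def by blast
      moreover have "k div 2 \<in> below t 1" using below_parent[OF k \<open>k \<noteq> 1\<close>] .
      ultimately show "adj (B k) (B (k div 2))" using adj_mono[of "B0 k" "B0 (k div 2)"] B(1) k by blast
    qed (use B in simp_all)
    have "t = Suc (Suc d * (8 * d) + 1)" by (simp add: t_def algebra_simps)
    then obtain R R1 U1 R2 U2 where n: "bintree (Suc d * (8 * d) + 1) R1 U1" "bintree (Suc d * (8 * d) + 1) R2 U2" "conn R"
      "V = R \<union> U1 \<union> U2" "R \<inter> U1 = {}" "R \<inter> U2 = {}" "U1 \<inter> U2 = {}" "adj R R1" "adj R R2"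
      using tree by (metis bintree_SucE)
    note c1 = bintree_conn[OF n(1)] and c2 = bintree_conn[OF n(2)]
    have eq: "V - U1 = R \<union> U2" using n(4-7) by blast
    have cV: "conn (V - U1)" unfolding eq using conn_Un[OF n(3)] c2 adj_mono[OF n(9), of R U2] by simp
    have U1V: "U1 \<subseteq> V" using n(4) by blast
    have aV: "adj R1 (V - U1)" unfolding eq using n(8) adj_sym by auto
    have nest: "nested (8 * d) U1"
      by (rule nested_of_bintree[OF noapex n(1) U1V cV aV])
    have "2 \<le> card (V - U1)"
    proof -
      have "2 \<le> card U2" using bintree_card[of "Suc d * (8 * d)" R2 U2] n(2,4) by simp
      moreover have "card U2 \<le> card (V - U1)" unfolding eq using finite_V n(4) by (intro card_mono) auto
      ultimately show ?thesis by simp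
    qed
    then have "2 \<le> card (nbrs U1)" using two_conn[OF conn_nonempty[of U1] U1V] c1 by simp
    then obtain c e where ce: "c \<in> nbrs U1" "e \<in> nbrs U1" "c \<noteq> e"
      by (metis card_2_iff' card_le_Suc0_iff_eq finite_nbrs not_less_eq_eq numeral_2_eq_2)
    have nV: "nbrs U1 \<subseteq> V - U1" using E_V' by (auto simp: nbrs_def)
    \<comment> \<open>Two neighbours of \<open>U1\<close>, which 2-connectivity provides, are the
      seeds of the hubs; absorption divides the complement of \<open>U1\<close> between
      them.\<close>
    obtain P Q where PQ: "{c} \<subseteq> P" "{e} \<subseteq> Q" "conn P" "conn Q" "P \<inter> Q = {}" "P \<union> Q = V - U1"
      by (rule absorb2[of "V - U1" "{c}" "{e}"]) (use finite_V cV ce nV in auto)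
    have PV: "P \<subseteq> V" "Q \<subseteq> V" "U1 \<inter> P = {}" "U1 \<inter> Q = {}" using PQ(6) by auto
    have "hubs U1 P Q" unfolding hubs_def
    proof (intro conjI)
      show "adj U1 P" "adj U1 Q" using ce PQ(1,2) by (auto simp: nbrs_def adj_def)
      show "nbrs U1 \<subseteq> P \<union> Q" using nV PQ(6) by simp
    qed (use PQ PV in simp_all)
    \<comment> \<open>Height \<open>d\<close> for a tree at either hub and stage
      \<open>2 * d\<close> for the triangulation.\<close>
    moreover have "nested (2 * (d + d + 2 * d)) U1" using nest by simp
    ultimately have "rooted_apex d U1 P Q \<or> rooted_apex d U1 Q P \<or> triang (2 * d) P Q U1"
      by (intro apex_or_triang)
    moreover have "\<not> rooted_apex d U1 A C" if "C \<subseteq> V" "U1 \<inter> C = {}" for A C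
    proof
      assume "rooted_apex d U1 A C"
      then obtain S Z X where n: "Z \<subseteq> U1" "X \<subseteq> U1" "Z \<inter> X = {}" "apex_tree d S Z (C \<union> X)" "adj S A" "conn (C \<union> X)"
        by (rule rooted_apexE)
      show False by (rule noapex[OF n(4) _ _ _ n(6)]) (use n(1-3) U1V that in auto)
    qed
    moreover have "\<not> triang (2 * d) P Q U1"
    proof (rule notri)
      have "adj P (V - U1 - P)"
        by (rule connD[OF cV]) (use PQ conn_nonempty in auto)
      moreover have "V - U1 - P = Q" using PQ(5,6) by blast
      ultimately show "adj P Q" by simp
    qed (use PQ PV U1V in simp_all)
    ultimately show False using PV by blast
  qed
qed

end

section \<open>Non-crossing vertex orders\<close>

context sym_rel begin

text \<open>The excluded subgraphs are the subdivisions of the complete bipartite graph with parts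
  of sizes 2 and 3.\<close>

definition theta_free :: bool where
  "theta_free \<longleftrightarrow> (\<forall>a b p q r. p \<noteq> [] \<longrightarrow> q \<noteq> [] \<longrightarrow> r \<noteq> [] \<longrightarrow> distinct (a # b # p @ q @ r) \<longrightarrow>
    successively E (a # p @ [b]) \<longrightarrow> successively E (a # q @ [b]) \<longrightarrow> successively E (a # r @ [b]) \<longrightarrow> False)"

definition chord_free :: bool where
  "chord_free \<longleftrightarrow> (\<forall>a c p q b d. distinct (a # c # p @ q) \<longrightarrow> successively E (a # p @ [c]) \<longrightarrow>
    successively E (a # q @ [c]) \<longrightarrow> b \<in> set p \<longrightarrow> d \<in> set q \<longrightarrow> E a c \<longrightarrow> E b d \<longrightarrow> False)"

definition noncrossing :: "'a list \<Rightarrow> bool" where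
  "noncrossing xs \<longleftrightarrow> (\<forall>i j k l. i < j \<longrightarrow> j < k \<longrightarrow> k < l \<longrightarrow> l < length xs \<longrightarrow>
    E (xs ! i) (xs ! k) \<longrightarrow> E (xs ! j) (xs ! l) \<longrightarrow> False)"

lemma noncrossingD:
  "noncrossing xs \<Longrightarrow> i < j \<Longrightarrow> j < k \<Longrightarrow> k < l \<Longrightarrow> l < length xs \<Longrightarrow> E (xs ! i) (xs ! k) \<Longrightarrow> E (xs ! j) (xs ! l) \<Longrightarrow> False"
  unfolding noncrossing_def by blast

lemma noncrossing_rotate1:
  assumes "noncrossing (x # xs)" shows "noncrossing (xs @ [x])"
  unfolding noncrossing_def
proof (intro allI impI)
  fix i j k l
  assume *: "i < j" "j < k" "k < l" "l < length (xs @ [x])" "E ((xs @ [x]) ! i) ((xs @ [x]) ! k)" "E ((xs @ [x]) ! j) ((xs @ [x]) ! l)"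
  show False
  proof (cases "l = length xs")
    case True
    then have "E (xs ! i) (xs ! k)" "E x (xs ! j)" using * sym by (auto simp: nth_append)
    then show False using noncrossingD[OF assms, of 0 "Suc i" "Suc j" "Suc k"] * True by simp
  next
    case False
    then have "E (xs ! i) (xs ! k)" "E (xs ! j) (xs ! l)" using * by (auto simp: nth_append)
    then show False using noncrossingD[OF assms, of "Suc i" "Suc j" "Suc k" "Suc l"] * False by simp
  qed
qed

text \<open>The property belongs to the cyclic order. Rotation brings a cut vertex to an end of the
  list before gluing.\<close>

lemma noncrossing_rotate: "noncrossing (as @ bs) \<Longrightarrow> noncrossing (bs @ as)"
proof (induction as arbitrary: bs)
  case (Cons a as)
  have "noncrossing (as @ (bs @ [a]))" using noncrossing_rotate1[of a "as @ bs"] Cons.prems by simp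
  then show ?case using Cons.IH[of "bs @ [a]"] by simp
qed simp

text \<open>Among four positions not all on one side, the first lies in \<open>as\<close> and the
  last in \<open>bs\<close>. The first edge then cannot end in \<open>bs\<close>, so with at most
  one vertex in \<open>vs\<close> the second edge starts in \<open>as\<close>; but it ends in
  \<open>bs\<close>.\<close>

lemma noncrossing_glue:
  assumes A: "noncrossing (as @ vs)" and B: "noncrossing (vs @ bs)" and vs: "length vs \<le> 1"
    and no: "\<not> adj (set as) (set bs)"
  shows "noncrossing (as @ vs @ bs)"
  unfolding noncrossing_def
proof (intro allI impI)
  let ?xs = "as @ vs @ bs"
  fix i j k l
  assume *: "i < j" "j < k" "k < l" "l < length ?xs" "E (?xs ! i) (?xs ! k)" "E (?xs ! j) (?xs ! l)"
  have a: "?xs ! n \<in> set as" if "n < length as" for n using that by (simp add: nth_append)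
  have b: "?xs ! n \<in> set bs" if "length as + length vs \<le> n" "n < length ?xs" for n
    using that by (auto simp: nth_append)
  have noE: "\<not> E (?xs ! m) (?xs ! n)" if "m < length as" "length as + length vs \<le> n" "n < length ?xs" for m n
    using no a[OF that(1)] b[OF that(2,3)] by (auto simp: adj_def)
  have na: "?xs ! n = (as @ vs) ! n" if "n < length as + length vs" for n
    using that nth_append[of "as @ vs" bs n] by simp
  have nb: "?xs ! n = (vs @ bs) ! (n - length as)" if "length as \<le> n" for n
    using that by (simp add: nth_append)
  consider "l < length as + length vs" | "length as \<le> i" | "i < length as" "length as + length vs \<le> l" by linarith
  then show False
  proof cases
    case 1
    then show False using noncrossingD[OF A, of i j k l] * na[of i] na[of j] na[of k] na[of l] by simp
  next
    case 2
    then have "l - length as < length (vs @ bs)" using * by simp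
    then show False
      using 2 noncrossingD[OF B, of "i - length as" "j - length as" "k - length as" "l - length as"] *
        nb[of i] nb[of j] nb[of k] nb[of l] by (simp add: less_diff_iff)
  next
    case 3
    then have "k < length as + length vs" using noE[of i k] * by fastforce
    then have "j < length as" using * vs by linarith
    then show False using noE[of j l] * 3 by simp
  qed
qed

definition is_cycle :: "'a list \<Rightarrow> bool" where
  "is_cycle xs \<longleftrightarrow> 3 \<le> length xs \<and> distinct xs \<and> successively E xs \<and> E (last xs) (hd xs)"

lemma is_cycle_rotate:
  assumes "is_cycle (as @ x # bs)" shows "is_cycle (x # bs @ as)"
proof (cases as)
  case (Cons a as')
  have cy: "3 \<le> length (as @ x # bs)" "distinct (as @ x # bs)" "successively E as" "successively E (x # bs)"
    "E (last as) x" "E (last (x # bs)) (hd as)"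
    using assms Cons unfolding is_cycle_def successively_append_iff by simp_all
  have "successively E ((x # bs) @ as)" using cy(3,4,6) unfolding successively_append_iff by simp
  moreover have "distinct ((x # bs) @ as)" using cy(2) by auto
  moreover have "E (last ((x # bs) @ as)) x" using cy(5) Cons by simp
  ultimately show ?thesis using cy(1) unfolding is_cycle_def by simp
qed (use assms in simp)

lemma is_cycle_split:
  assumes "is_cycle xs" "c \<in> set xs" "d \<in> set xs" "c \<noteq> d"
  obtains A B where "is_cycle (c # A @ d # B)" "set (c # A @ d # B) = set xs" "length (c # A @ d # B) = length xs"
proof -
  obtain as bs where ab: "xs = as @ c # bs" using assms(2) by (meson split_list)
  then have cy: "is_cycle (c # bs @ as)" using is_cycle_rotate assms(1) by simp
  have "d \<in> set (bs @ as)" using assms(3,4) ab by auto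
  then obtain A B where AB: "bs @ as = A @ d # B" by (meson split_list)
  have "set (c # A @ d # B) = set xs" using AB ab by (metis Un_commute set_append list.simps(15) Un_insert_right)
  moreover have "length (c # A @ d # B) = length xs" using arg_cong[OF AB, of length] ab by simp
  ultimately show thesis using that cy unfolding AB by blast
qed

lemma cycle_arcs:
  assumes "is_cycle (c # A @ d # B)"
  shows "distinct (c # d # A @ rev B)" "successively E (c # A @ [d])" "successively E (c # rev B @ [d])"
proof -
  have cy: "distinct (c # A @ d # B)" "successively E (c # A @ d # B)" "E (last (d # B)) c"
    using assms by (auto simp: is_cycle_def)
  show "distinct (c # d # A @ rev B)" using cy(1) by auto
  have "successively E ((c # A @ [d]) @ B)" using cy(2) by simp
  then show "successively E (c # A @ [d])" by (simp only: successively_append_iff)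
  have "successively E ((c # A) @ (d # B))" using cy(2) by simp
  then have "successively E (d # B)" by (simp only: successively_append_iff)
  then have "successively E ((d # B) @ [c])" using cy(3) by (simp only: successively_append_iff) simp
  then have "successively (\<lambda>x y. E y x) (rev ((d # B) @ [c]))" unfolding successively_rev .
  then have "successively (\<lambda>x y. E y x) (c # rev B @ [d])" by simp
  then show "successively E (c # rev B @ [d])" by (rule successively_mono) (rule sym)
qed

text \<open>Two neighbours of \<open>u\<close> joined by a path that avoids
  \<open>u\<close>.\<close>

lemma two_connected_cycle:
  assumes X: "finite X" "3 \<le> card X" "conn X" "\<And>v. v \<in> X \<Longrightarrow> conn (X - {v})"
  shows "\<exists>xs. is_cycle xs \<and> set xs \<subseteq> X"
proof -
  obtain u where u: "u \<in> X" using X(2) by fastforce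
  have c: "card (X - {u}) \<ge> 2" using X(1,2) u by simp
  then have "X - {u} \<noteq> {}" by fastforce
  then obtain a where a: "a \<in> X - {u}" "E u a"
    using connD[OF X(3), of "{u}"] u unfolding adj_def by blast
  have "X - {a} - {u} \<noteq> {}"
  proof
    assume "X - {a} - {u} = {}"
    then have "X \<subseteq> {a, u}" by blast
    then have "card X \<le> card {a, u}" by (rule card_mono[rotated]) simp
    also have "\<dots> \<le> 2" by (simp add: card_insert_if)
    finally show False using X(2) by simp
  qed
  then obtain b where b: "b \<in> X - {a} - {u}" "E u b"
    using connD[OF X(4), of a "{u}"] a u unfolding adj_def by blast
  obtain p where p: "p \<noteq> []" "distinct p" "successively E p" "set p \<subseteq> X - {u}" "hd p = a" "last p = b"
    using conn_path[OF X(4)[OF u], of a b] a b by auto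
  have "length p \<noteq> 1" using p(1,5,6) b by (cases p) auto
  then have "2 \<le> length p" using p(1) by (cases p rule: remdups_adj.cases) auto
  then have "is_cycle (u # p)"
    using p a b sym by (auto simp: is_cycle_def successively_Cons)
  then show ?thesis using p(4) u by (intro exI[of _ "u # p"]) auto
qed

lemma theta_freeD:
  "theta_free \<Longrightarrow> p \<noteq> [] \<Longrightarrow> q \<noteq> [] \<Longrightarrow> r \<noteq> [] \<Longrightarrow> distinct (a # b # p @ q @ r) \<Longrightarrow>
    successively E (a # p @ [b]) \<Longrightarrow> successively E (a # q @ [b]) \<Longrightarrow> successively E (a # r @ [b]) \<Longrightarrow> False"
  unfolding theta_free_def by blast

text \<open>Take a longest cycle. A component outside it attaches to two cycle vertices
  \<open>c\<close> and \<open>d\<close>. If one arc between them has no inner vertex, a path through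
  the component replaces it and lengthens the cycle; otherwise that path and the two arcs contradict
  \<open>theta_free\<close>.\<close>

lemma hamiltonian:
  assumes X: "finite X" "3 \<le> card X" "conn X" "\<And>v. v \<in> X \<Longrightarrow> conn (X - {v})" and tf: theta_free
  shows "\<exists>xs. is_cycle xs \<and> set xs = X"
proof -
  let ?P = "\<lambda>xs. is_cycle xs \<and> set xs \<subseteq> X"
  obtain xs0 where "?P xs0" using two_connected_cycle[OF X] by blast
  moreover have "length xs < Suc (card X)" if "?P xs" for xs
  proof -
    have "length xs = card (set xs)" using that by (simp add: is_cycle_def distinct_card)
    then show ?thesis using that card_mono[OF X(1)] by (simp add: less_Suc_eq_le)
  qed
  ultimately obtain xs where xs: "?P xs" and max: "\<And>ys. ?P ys \<Longrightarrow> length ys \<le> length xs"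
    using ex_has_greatest_nat[of ?P xs0 length "Suc (card X)"] by blast
  have "set xs = X"
  proof (rule ccontr)
    assume "set xs \<noteq> X"
    then obtain v where v: "v \<in> X - set xs" using xs by blast
    define K where "K = component (X - set xs) v"
    note K = component_props[OF v, folded K_def]
    have sx: "set xs \<subseteq> X" "xs \<noteq> []" using xs by (auto simp: is_cycle_def)
    have "adj K (set xs)" using component_adj_cut[OF X(3) sx(1) _ v] sx(2) unfolding K_def by simp
    then obtain k c where kc: "k \<in> K" "c \<in> set xs" "E k c" by (auto simp: adj_def)
    have "\<exists>k' d. k' \<in> K \<and> d \<in> set xs \<and> d \<noteq> c \<and> E k' d"
    proof -
      have "2 \<le> length xs" "distinct xs" using xs by (auto simp: is_cycle_def)
      then have "card (set xs) \<ge> 2" by (simp add: distinct_card)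
      then have "set xs - {c} \<noteq> {}" using card_mono[of "{c}" "set xs"] by fastforce
      then have "set xs - {c} \<noteq> {} \<and> set xs - {c} \<subseteq> X - {c} \<and> v \<in> X - {c} - (set xs - {c})"
        using sx(1) v kc(2) by blast
      moreover have "X - {c} - (set xs - {c}) = X - set xs" using kc(2) by blast
      ultimately have "adj K (set xs - {c})"
        using component_adj_cut[OF X(4)[of c], of "set xs - {c}" v] kc(2) sx(1) unfolding K_def by auto
      then show ?thesis by (auto simp: adj_def)
    qed
    then obtain k' d where kd: "k' \<in> K" "d \<in> set xs" "d \<noteq> c" "E k' d" by blast
    obtain q where q: "q \<noteq> []" "distinct q" "successively E q" "set q \<subseteq> K" "hd q = k" "last q = k'"
      using conn_path[OF K(3) kc(1) kd(1)] by blast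
    have qxs: "set q \<inter> set xs = {}" using q(4) K(2) by blast
    obtain A B where AB: "is_cycle (c # A @ d # B)" "set (c # A @ d # B) = set xs" "length (c # A @ d # B) = length xs"
      using is_cycle_split[OF conjunct1[OF xs] kc(2) kd(2) kd(3)[symmetric]] by blast
    note arcs = cycle_arcs[OF AB(1)]
    have sq: "successively E (c # q @ [d])"
      using q(1,3,5,6) kc(3) kd(4) sym by (auto simp: successively_append_iff successively_Cons)
    have dis: "distinct (c # d # A @ q @ rev B)" using arcs(1) q(2) qxs AB(2) by auto
    have qX: "set q \<subseteq> X" using q(4) K(2) by blast
    \<comment> \<open>\<open>p\<close> is an arc that holds all cycle vertices except
      \<open>c\<close> and \<open>d\<close>; closing it with \<open>q\<close> exceeds the old length
      by that of \<open>q\<close>.\<close>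
    have longer: False if "successively E (c # p @ [d])" "set p \<subseteq> X" "distinct (c # d # p @ q)"
      "length p + 2 = length xs" for p
    proof -
      have "successively E ((c # q @ [d]) @ rev p)"
      proof -
        have "successively (\<lambda>x y. E y x) (rev (c # p @ [d]))" using that(1) unfolding successively_rev .
        then have "successively E (rev (c # p @ [d]))" by (rule successively_mono) (rule sym)
        then have "successively E (d # rev p @ [c])" by simp
        then have "successively E ((d # rev p) @ [c])" by simp
        then have "successively E (d # rev p)" by (simp only: successively_append_iff)
        then have "successively E ((c # q) @ (d # rev p))"
          using sq unfolding append_Cons[symmetric] successively_append_iff by simp
        then show ?thesis by simp
      qed
      moreover have "E (last ((c # q @ [d]) @ rev p)) c"
        using that(1) sym by (cases p) (auto simp: successively_Cons last_rev)
      moreover have "distinct ((c # q @ [d]) @ rev p)" using that(3) by auto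
      moreover have len: "length ((c # q @ [d]) @ rev p) = length q + length xs" using that(4) by simp
      moreover have "3 \<le> length xs" using xs by (simp add: is_cycle_def)
      ultimately have "is_cycle ((c # q @ [d]) @ rev p)" unfolding is_cycle_def by simp
      moreover have "set ((c # q @ [d]) @ rev p) \<subseteq> X" using that(2) qX kc(2) kd(2) sx(1) by auto
      ultimately have "length ((c # q @ [d]) @ rev p) \<le> length xs" by (intro max conjI)
      then have "length q = 0" unfolding len by simp
      then show False using q(1) by simp
    qed
    have setAB: "set A \<subseteq> X" "set B \<subseteq> X" using AB(2) sx(1) by auto
    show False
    proof (cases "A = [] \<or> B = []")
      case True
      then show False
      proof
        assume "A = []"
        then show False using longer[of "rev B"] arcs(3) setAB dis AB(3) by auto
      next
        assume "B = []"
        then show False using longer[of A] arcs(2) setAB dis AB(3) by auto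
      qed
    next
      case False
      then show False using theta_freeD[OF tf _ q(1) _ dis arcs(2) sq arcs(3)] by simp
    qed
  qed
  then show ?thesis using xs by blast
qed

lemma noncrossing_cycle:
  assumes cy: "is_cycle xs" and cf: chord_free
  shows "noncrossing xs"
  unfolding noncrossing_def
proof (intro allI impI)
  fix i j k l
  assume *: "i < j" "j < k" "k < l" "l < length xs" "E (xs ! i) (xs ! k)" "E (xs ! j) (xs ! l)"
  define a b c d where "a = xs ! i" and "b = xs ! j" and "c = xs ! k" and "d = xs ! l"
  define A where "A = take (k - Suc i) (drop (Suc i) xs)"
  define B where "B = drop (Suc k) xs"
  have dr: "drop i xs = a # A @ c # B"
  proof -
    have "drop i xs = a # drop (Suc i) xs" using * by (simp add: a_def Cons_nth_drop_Suc)
    moreover have "drop (Suc i) xs = A @ drop (k - Suc i) (drop (Suc i) xs)"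
      unfolding A_def by (rule append_take_drop_id[symmetric])
    moreover have "k - Suc i + Suc i = k" using * by simp
    then have "drop (k - Suc i) (drop (Suc i) xs) = drop k xs" unfolding drop_drop by simp
    moreover have "drop k xs = c # B" using * by (simp add: c_def B_def Cons_nth_drop_Suc)
    ultimately show ?thesis by metis
  qed
  have "is_cycle (take i xs @ a # A @ c # B)" using cy dr append_take_drop_id[of i xs] by simp
  then have "is_cycle (a # (A @ c # B) @ take i xs)" by (rule is_cycle_rotate)
  then have cy': "is_cycle (a # A @ c # (B @ take i xs))" by simp
  have "b \<in> set A"
  proof -
    have "A ! (j - Suc i) = b" "j - Suc i < length A" using * by (auto simp: A_def b_def)
    then show ?thesis using nth_mem by metis
  qed
  moreover have "d \<in> set (rev (B @ take i xs))"
  proof -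
    have "B ! (l - Suc k) = d" "l - Suc k < length B" using * by (auto simp: B_def d_def)
    then have "d \<in> set B" using nth_mem by metis
    then show ?thesis by simp
  qed
  ultimately show False
    using cf cycle_arcs[OF cy'] *(5,6) unfolding chord_free_def a_def b_def c_def d_def by blast
qed

theorem noncrossing_order:
  assumes tf: theta_free and cf: chord_free and "finite X"
  shows "\<exists>xs. distinct xs \<and> set xs = X \<and> noncrossing xs"
  using assms(3)
proof (induction "card X" arbitrary: X rule: less_induct)
  case less
  have small: ?case if "card X < 3"
  proof -
    obtain xs where xs: "set xs = X" "distinct xs" using finite_distinct_list[OF less.prems] by blast
    then have "length xs < 3" using that by (metis distinct_card)
    then show ?thesis using xs by (intro exI[of _ xs]) (auto simp: noncrossing_def)
  qed
  \<comment> \<open>\<open>W\<close> is empty for a disconnected set and consists of the cut vertex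
    otherwise.\<close>
  have split: ?case if AB: "X = A \<union> W \<union> B" "A \<inter> W = {}" "B \<inter> W = {}" "A \<inter> B = {}" "A \<noteq> {}" "B \<noteq> {}" "\<not> adj A B"
    "W = {} \<or> W = {v}" for A B W v
  proof -
    have "A \<union> W \<subset> X" "W \<union> B \<subset> X" using AB by auto
    then have "card (A \<union> W) < card X" "card (W \<union> B) < card X" using less.prems psubset_card_mono by blast+
    moreover have "finite (A \<union> W)" "finite (W \<union> B)" using less.prems AB(1) by auto
    ultimately have "\<exists>xs. distinct xs \<and> set xs = A \<union> W \<and> noncrossing xs"
      "\<exists>ys. distinct ys \<and> set ys = W \<union> B \<and> noncrossing ys"
      using less.hyps[of "A \<union> W"] less.hyps[of "W \<union> B"] by simp_all
    then obtain xs ys where xs: "distinct xs" "set xs = A \<union> W" "noncrossing xs"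
      and ys: "distinct ys" "set ys = W \<union> B" "noncrossing ys"
      by (elim exE conjE)
    from AB(8) show ?case
    proof
      assume W: "W = {}"
      have "noncrossing (xs @ [] @ ys)"
        by (rule noncrossing_glue) (use xs ys W AB(7) in simp_all)
      then show ?thesis using xs ys W AB by (intro exI[of _ "xs @ ys"]) auto
    next
      assume W: "W = {v}"
      obtain a1 a2 where a: "xs = a1 @ v # a2" using xs(2) W split_list[of v xs] by auto
      obtain b1 b2 where b: "ys = b1 @ v # b2" using ys(2) W split_list[of v ys] by auto
      \<comment> \<open>Rotated so that \<open>v\<close> closes the order of one side and opens the
        order of the other.\<close>
      have na: "noncrossing ((a2 @ a1) @ [v])"
        using noncrossing_rotate[of "a1 @ [v]" a2] xs(3) unfolding a by simp
      have nb: "noncrossing ([v] @ (b2 @ b1))" using noncrossing_rotate[of b1 "v # b2"] ys(3) unfolding b by simp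
      have sa: "set (a2 @ a1) = A" "distinct (a2 @ a1)" "v \<notin> set (a2 @ a1)" using xs(1,2) AB(2) unfolding a W by auto
      have sb: "set (b2 @ b1) = B" "distinct (b2 @ b1)" "v \<notin> set (b2 @ b1)" using ys(1,2) AB(3) unfolding b W by auto
      have "noncrossing ((a2 @ a1) @ [v] @ (b2 @ b1))"
        by (rule noncrossing_glue[OF na nb]) (use sa(1) sb(1) AB(7) in simp_all)
      moreover have "distinct ((a2 @ a1) @ [v] @ (b2 @ b1))"
        using sa sb AB(4) unfolding distinct_append by simp
      moreover have "set ((a2 @ a1) @ [v] @ (b2 @ b1)) = X" using sa(1) sb(1) unfolding AB(1) W by auto
      ultimately show ?thesis by blast
    qed
  qed
  have cut: "\<exists>A B. Y = A \<union> B \<and> A \<inter> B = {} \<and> A \<noteq> {} \<and> B \<noteq> {} \<and> \<not> adj A B" if "\<not> conn Y" "Y \<noteq> {}" for Y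
  proof -
    have "\<exists>A\<subseteq>Y. A \<noteq> {} \<and> A \<noteq> Y \<and> \<not> adj A (Y - A)" using that by (auto simp: conn_def)
    then obtain A where "A \<subseteq> Y" "A \<noteq> {}" "A \<noteq> Y" "\<not> adj A (Y - A)" by (elim exE conjE)
    then show ?thesis by (intro exI[of _ A] exI[of _ "Y - A"]) auto
  qed
  show ?case
  proof (cases "card X < 3")
    case True then show ?thesis by (rule small)
  next
    case False
    then have c3: "3 \<le> card X" by simp
    show ?thesis
    proof (cases "conn X")
      case False
      have "X \<noteq> {}" using c3 by auto
      from cut[OF False this] obtain A B where "X = A \<union> B" "A \<inter> B = {}" "A \<noteq> {}" "B \<noteq> {}" "\<not> adj A B" by (elim exE conjE)
      then show ?thesis using split[of A "{}" B] by simp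
    next
      case cX: True
      show ?thesis
      proof (cases "\<forall>v\<in>X. conn (X - {v})")
        case True
        then obtain xs where "is_cycle xs" "set xs = X" using hamiltonian[OF less.prems c3 cX _ tf] by blast
        then show ?thesis using noncrossing_cycle[OF _ cf] by (auto simp: is_cycle_def)
      next
        case False
        then obtain v where v: "v \<in> X" "\<not> conn (X - {v})" by blast
        have "X - {v} \<noteq> {}"
        proof
          assume "X - {v} = {}"
          then have "card X \<le> card {v}" by (intro card_mono) auto
          then show False using c3 by simp
        qed
        from cut[OF v(2) this] obtain A B where AB: "X - {v} = A \<union> B" "A \<inter> B = {}" "A \<noteq> {}" "B \<noteq> {}" "\<not> adj A B" by (elim exE conjE)
        then have "X = A \<union> {v} \<union> B" "A \<inter> {v} = {}" "B \<inter> {v} = {}" using v(1) by auto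
        then show ?thesis using split[of A "{v}" B v] AB by simp
      qed
    qed
  qed
qed

end

section \<open>Theta curves in the plane\<close>

definition theta_curve :: "(real \<Rightarrow> complex) \<Rightarrow> (real \<Rightarrow> complex) \<Rightarrow> (real \<Rightarrow> complex) \<Rightarrow> complex \<Rightarrow> complex \<Rightarrow> bool" where
  "theta_curve g h k a b \<longleftrightarrow> a \<noteq> b \<and> arc g \<and> arc h \<and> arc k \<and>
    pathstart g = a \<and> pathfinish g = b \<and> pathstart h = a \<and> pathfinish h = b \<and> pathstart k = a \<and> pathfinish k = b \<and>
    path_image g \<inter> path_image h = {a, b} \<and> path_image g \<inter> path_image k = {a, b} \<and> path_image h \<inter> path_image k = {a, b}"

lemma theta_curve_perm: "theta_curve g h k a b \<Longrightarrow> theta_curve h k g a b" "theta_curve g h k a b \<Longrightarrow> theta_curve h g k a b"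
  unfolding theta_curve_def by (auto simp: Int_commute)

lemma theta_loop:
  assumes "theta_curve g h k a b"
  shows "simple_path (g +++ reversepath h)" "pathfinish (g +++ reversepath h) = pathstart (g +++ reversepath h)"
    "path_image (g +++ reversepath h) = path_image g \<union> path_image h"
proof -
  show "simple_path (g +++ reversepath h)"
    by (rule simple_path_join_loop) (use assms in \<open>auto simp: theta_curve_def arc_reversepath\<close>)
qed (use assms in \<open>auto simp: theta_curve_def path_image_join\<close>)

lemma inside_or_outside:
  fixes c :: "real \<Rightarrow> complex"
  assumes "simple_path c" "pathfinish c = pathstart c" "Topological_Spaces.connected S" "S \<inter> path_image c = {}"
  shows "S \<subseteq> inside (path_image c) \<or> S \<subseteq> outside (path_image c)"
proof -
  note J = Jordan_inside_outside[OF assms(1,2)]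
  have "S \<subseteq> inside (path_image c) \<union> outside (path_image c)" using J assms(4) by blast
  moreover from this have "inside (path_image c) \<inter> S = {} \<or> outside (path_image c) \<inter> S = {}"
    using J assms(3) inside_Int_outside[of "path_image c"] by (intro connectedD[of S]) auto
  ultimately show ?thesis by blast
qed

lemma arc_interior_connected: "arc g \<Longrightarrow> Topological_Spaces.connected (path_image g - {pathstart g, pathfinish g})"
  by (rule connected_simple_path_endless) (rule arc_imp_simple_path)

lemma arc_interior_closure:
  assumes "arc g" shows "path_image g \<subseteq> closure (path_image g - {pathstart g, pathfinish g})"
proof -
  have eq: "path_image g - {pathstart g, pathfinish g} = g ` {0<..<1}"
    using simple_path_endless arc_imp_simple_path assms by blast
  have "continuous_on {0..1} g" using assms by (simp add: arc_def path_def)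
  then have "g ` closure {0<..<1} \<subseteq> closure (g ` {0<..<1})"
    by (intro image_closure_subset) (auto simp: closure_subset)
  then show ?thesis unfolding eq by (simp add: path_image_def)
qed

lemma winding_theta:
  assumes "theta_curve g h k a b" "z \<notin> path_image g" "z \<notin> path_image h"
  shows "winding_number (g +++ reversepath h) z = winding_number g z - winding_number h z"
  using assms by (subst winding_number_join) (auto simp: theta_curve_def arc_imp_path winding_number_reversepath)

text \<open>For the three loops of a theta curve, lying inside becomes inequality of two out of
  three numbers. If the numbers of \<open>g\<close> and \<open>h\<close> differ, that of
  \<open>k\<close> must differ from one of them.\<close>

lemma inside_iff_winding:
  assumes "theta_curve g h k a b" "z \<notin> path_image g" "z \<notin> path_image h"
  shows "z \<in> inside (path_image g \<union> path_image h) \<longleftrightarrow> winding_number g z \<noteq> winding_number h z"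
proof -
  note L = theta_loop[OF assms(1)] and w = winding_theta[OF assms]
  have "z \<in> inside (path_image (g +++ reversepath h)) \<longleftrightarrow> winding_number (g +++ reversepath h) z \<noteq> 0"
  proof
    assume "z \<in> inside (path_image (g +++ reversepath h))"
    then have "norm (winding_number (g +++ reversepath h) z) = 1"
      by (rule simple_closed_path_norm_winding_number_inside[OF L(1)])
    then show "winding_number (g +++ reversepath h) z \<noteq> 0" by auto
  next
    assume nz: "winding_number (g +++ reversepath h) z \<noteq> 0"
    have "z \<notin> outside (path_image (g +++ reversepath h))"
      using winding_number_zero_in_outside[of "g +++ reversepath h" z] L nz simple_path_imp_path by blast
    moreover have "z \<notin> path_image (g +++ reversepath h)" using L(3) assms(2,3) by blast
    ultimately show "z \<in> inside (path_image (g +++ reversepath h))" using inside_Un_outside by blast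
  qed
  then show ?thesis using L(3) w by simp
qed

text \<open>The region inside the first loop is connected, misses the second loop and shares
  \<open>z\<close> with its inside, so it is contained in that inside. The arc \<open>g\<close> lies
  in its closure and meets the second loop only at the ends.\<close>

lemma theta_step:
  assumes t: "theta_curve g h k a b"
    and z: "z \<in> inside (path_image g \<union> path_image h)" "z \<in> inside (path_image h \<union> path_image k)"
    and k: "inside (path_image g \<union> path_image h) \<inter> path_image k = {}"
  shows "path_image g - {a, b} \<subseteq> inside (path_image h \<union> path_image k)"
proof -
  let ?I = "inside (path_image g \<union> path_image h)" and ?J = "inside (path_image h \<union> path_image k)"
  note L = theta_loop[OF t] and M = theta_loop[OF theta_curve_perm(1)[OF t]]
  note JI = Jordan_inside_outside[OF L(1,2), unfolded L(3)] and JJ = Jordan_inside_outside[OF M(1,2), unfolded M(3)]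
  have "?I \<inter> path_image h = {}" using JI by blast
  then have "?I \<inter> path_image (h +++ reversepath k) = {}" using k M(3) by blast
  then have "?I \<subseteq> ?J \<or> ?I \<subseteq> outside (path_image h \<union> path_image k)"
    using inside_or_outside[OF M(1,2), of ?I] JI M(3) by simp
  then have "?I \<subseteq> ?J" using z JJ by blast
  moreover have "path_image g \<union> path_image h \<subseteq> closure ?I" using JI by (metis frontier_subset_closed frontier_def Diff_subset)
  ultimately have "path_image g \<subseteq> closure ?J" using closure_mono by blast
  moreover have "closed (path_image h \<union> path_image k)"
    using t by (auto simp: theta_curve_def closed_arc_image)
  ultimately have "path_image g \<subseteq> path_image h \<union> path_image k \<union> ?J" using closure_inside_subset by blast
  moreover have "path_image g \<inter> (path_image h \<union> path_image k) = {a, b}" using t unfolding theta_curve_def by blast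
  ultimately show ?thesis by blast
qed

text \<open>If \<open>k\<close> does not run inside the loop of \<open>g\<close> and
  \<open>h\<close>, it runs outside. A point \<open>z\<close> inside that loop is, by comparison of
  winding numbers, also inside one of the two loops with \<open>k\<close>, and
  \<open>theta_step\<close> puts the remaining arc inside that loop.\<close>

theorem theta_inside:
  assumes t: "theta_curve g h k a b"
  shows "path_image k - {a, b} \<subseteq> inside (path_image g \<union> path_image h) \<or>
    path_image g - {a, b} \<subseteq> inside (path_image h \<union> path_image k) \<or>
    path_image h - {a, b} \<subseteq> inside (path_image g \<union> path_image k)"
proof (rule ccontr)
  assume neg: "\<not> ?thesis"
  note L = theta_loop[OF t]
  note J = Jordan_inside_outside[OF L(1,2), unfolded L(3)]
  have kab: "pathstart k = a" "pathfinish k = b" "arc k" "a \<in> path_image g" "b \<in> path_image g"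
    "path_image g \<inter> path_image k = {a, b}" "path_image h \<inter> path_image k = {a, b}"
    using t unfolding theta_curve_def by auto
  have "path_image k - {a, b} \<subseteq> outside (path_image g \<union> path_image h)"
    using inside_or_outside[OF L(1,2), of "path_image k - {a, b}"] arc_interior_connected[OF kab(3)] kab neg
    unfolding L(3) by blast
  then have k: "inside (path_image g \<union> path_image h) \<inter> path_image k = {}" using J kab(4,5) by blast
  obtain z where z: "z \<in> inside (path_image g \<union> path_image h)" using J by blast
  then have zn: "z \<notin> path_image g" "z \<notin> path_image h" "z \<notin> path_image k"
    using inside_no_overlap[of "path_image g \<union> path_image h"] k by blast+
  have "winding_number g z \<noteq> winding_number h z" using inside_iff_winding[OF t zn(1,2)] z by simp
  then have "winding_number h z \<noteq> winding_number k z \<or> winding_number g z \<noteq> winding_number k z" by auto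
  then show False
  proof
    assume "winding_number h z \<noteq> winding_number k z"
    then have "z \<in> inside (path_image h \<union> path_image k)"
      using inside_iff_winding[OF theta_curve_perm(1)[OF t] zn(2,3)] by simp
    then show False using theta_step[OF t z _ k] neg by blast
  next
    assume "winding_number g z \<noteq> winding_number k z"
    then have "z \<in> inside (path_image g \<union> path_image k)"
      using inside_iff_winding[OF theta_curve_perm(1)[OF theta_curve_perm(2)[OF t]] zn(1,3)] by simp
    then show False
      using theta_step[OF theta_curve_perm(2)[OF t], of z] z k neg by (simp add: Un_commute)
  qed
qed

text \<open>A connected unbounded set that misses the curve lies outside it, and its closure cannot
  enter the inside, which is open.\<close>

lemma outer_face_not_inside:
  fixes c :: "real \<Rightarrow> complex"
  assumes "simple_path c" "pathfinish c = pathstart c" "Topological_Spaces.connected F" "\<not> bounded F" "F \<inter> path_image c = {}" "x \<in> frontier F"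
  shows "x \<notin> inside (path_image c)"
proof
  assume x: "x \<in> inside (path_image c)"
  note J = Jordan_inside_outside[OF assms(1,2)]
  have "bounded (inside (path_image c))" using J by simp
  then have "\<not> F \<subseteq> inside (path_image c)" using assms(4) bounded_subset by blast
  then have "F \<inter> inside (path_image c) = {}" using inside_or_outside[OF assms(1,2,3,5)] inside_Int_outside[of "path_image c"] by blast
  then have "closure F \<inter> inside (path_image c) = {}"
    using J open_Int_closure_eq_empty[of "inside (path_image c)" F] by (simp add: Int_commute)
  then show False using x assms(6) by (auto simp: frontier_def)
qed

text \<open>Of the three outcomes of \<open>theta_inside\<close>, two would put \<open>x\<close> or
  \<open>y\<close> inside a loop, which points on the frontier of \<open>F\<close> exclude.\<close>

lemma theta_outer_chord:
  assumes t: "theta_curve g h k a b"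
    and F: "Topological_Spaces.connected F" "\<not> bounded F" "F \<inter> (path_image g \<union> path_image h \<union> path_image k) = {}"
    and x: "x \<in> path_image g - {a, b}" "x \<in> frontier F" and y: "y \<in> path_image h - {a, b}" "y \<in> frontier F"
  shows "path_image k - {a, b} \<subseteq> inside (path_image g \<union> path_image h)"
proof -
  have t2: "theta_curve h k g a b" "theta_curve g k h a b" using theta_curve_perm t by blast+
  have "x \<notin> inside (path_image h \<union> path_image k)"
    using outer_face_not_inside[OF theta_loop(1,2)[OF t2(1)] F(1,2) _ x(2)] F(3) theta_loop(3)[OF t2(1)] by auto
  moreover have "y \<notin> inside (path_image g \<union> path_image k)"
    using outer_face_not_inside[OF theta_loop(1,2)[OF t2(2)] F(1,2) _ y(2)] F(3) theta_loop(3)[OF t2(2)] by auto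
  ultimately show ?thesis using theta_inside[OF t] x y by blast
qed

lemma theta_outer_False:
  assumes t: "theta_curve g h k a b"
    and F: "Topological_Spaces.connected F" "\<not> bounded F" "F \<inter> (path_image g \<union> path_image h \<union> path_image k) = {}"
    and x: "x \<in> path_image g - {a, b}" "x \<in> frontier F" and y: "y \<in> path_image h - {a, b}" "y \<in> frontier F"
    and z: "z \<in> path_image k - {a, b}" "z \<in> frontier F"
  shows False
proof -
  have "z \<in> inside (path_image g \<union> path_image h)" using theta_outer_chord[OF t F x y] z by blast
  moreover have "z \<notin> inside (path_image g \<union> path_image h)"
    using outer_face_not_inside[OF theta_loop(1,2)[OF t] F(1,2) _ z(2)] F(3) theta_loop(3)[OF t] by auto
  ultimately show False by blast
qed

text \<open>The chord \<open>k\<close> divides the inside into a region along \<open>g\<close> and a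
  region along \<open>h\<close>. The interior of \<open>m\<close> is connected and avoids
  \<open>k\<close>, so it stays in one region; but \<open>x\<close> is not in the closure of the
  second, nor \<open>y\<close> in the closure of the first.\<close>

lemma crossing_chords_False:
  assumes t: "theta_curve g h k a b" and kin: "path_image k - {a, b} \<subseteq> inside (path_image g \<union> path_image h)"
    and m: "arc m" "pathstart m = x" "pathfinish m = y" "x \<in> path_image g - {a, b}" "y \<in> path_image h - {a, b}"
    and min: "path_image m - {x, y} \<subseteq> inside (path_image g \<union> path_image h)"
    and mk: "(path_image m - {x, y}) \<inter> path_image k = {}"
  shows False
proof -
  let ?I = "inside (path_image g \<union> path_image h)"
  have tt: "a \<noteq> b" "arc g" "arc h" "arc k" "pathstart g = a" "pathfinish g = b" "pathstart h = a" "pathfinish h = b"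
    "pathstart k = a" "pathfinish k = b" "path_image g \<inter> path_image h = {a, b}" "path_image g \<inter> path_image k = {a, b}"
    "path_image h \<inter> path_image k = {a, b}"
    using t unfolding theta_curve_def by simp_all
  note J = Jordan_inside_outside[OF theta_loop(1,2)[OF t], unfolded theta_loop(3)[OF t]]
  have "path_image k - {a, b} \<noteq> {}" using arc_interior_closure[OF tt(4)] tt(9,10) pathstart_in_path_image[of k] by fastforce
  then have ne: "path_image k \<inter> ?I \<noteq> {}" using kin by blast
  obtain "inside (path_image g \<union> path_image k) \<inter> inside (path_image h \<union> path_image k) = {}"
    "inside (path_image g \<union> path_image k) \<union> inside (path_image h \<union> path_image k) \<union> (path_image k - {a, b}) = ?I"
    by (rule split_inside_simple_closed_curve[OF arc_imp_simple_path[OF tt(2)] tt(5,6) arc_imp_simple_path[OF tt(3)] tt(7,8)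
        arc_imp_simple_path[OF tt(4)] tt(9,10) tt(1) tt(11-13) ne])
  note sp = this
  let ?A = "inside (path_image g \<union> path_image k)" and ?B = "inside (path_image h \<union> path_image k)"
  let ?m = "path_image m - {x, y}"
  have cl: "closed (path_image g \<union> path_image k)" "closed (path_image h \<union> path_image k)"
    using tt by (auto intro: closed_arc_image)
  have op: "open ?A" "open ?B" using cl open_inside by auto
  have "?m \<subseteq> ?A \<union> ?B" using min sp(2) mk by blast
  moreover have "Topological_Spaces.connected ?m" using arc_interior_connected[OF m(1)] m(2,3) by simp
  ultimately have "?m \<inter> ?A = {} \<or> ?m \<inter> ?B = {}"
    using connectedD[of ?m ?A ?B] op sp(1) by blast
  then have "?m \<subseteq> ?A \<or> ?m \<subseteq> ?B" using \<open>?m \<subseteq> ?A \<union> ?B\<close> by blast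
  moreover have xy: "x \<in> closure ?m" "y \<in> closure ?m"
    using arc_interior_closure[OF m(1)] m(2,3) pathstart_in_path_image[of m] pathfinish_in_path_image[of m] by auto
  have out: "x \<notin> ?I" "y \<notin> ?I" using m(4,5) inside_no_overlap[of "path_image g \<union> path_image h"] by blast+
  moreover have "y \<notin> closure ?A"
    using closure_inside_subset[OF cl(1)] m(5) tt(11,13) out(2) sp(2) by blast
  moreover have "x \<notin> closure ?B"
    using closure_inside_subset[OF cl(2)] m(4) tt(11,12) out(1) sp(2) by blast
  ultimately show False using closure_mono xy by blast
qed

section \<open>Plane drawings\<close>

fun path_edges :: "'a list \<Rightarrow> 'a set set" where
  "path_edges (x # y # zs) = insert {x, y} (path_edges (y # zs))"
| "path_edges _ = {}"

lemma path_edges_append: "path_edges (xs @ y # zs) = path_edges (xs @ [y]) \<union> path_edges (y # zs)"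
  by (induction xs rule: induct_list012) auto

lemma path_edges_rev: "path_edges (rev xs) = path_edges xs"
proof (induction xs rule: induct_list012)
  case (3 x y zs)
  have "path_edges (rev (x # y # zs)) = path_edges (rev zs @ y # [x])" by simp
  also have "\<dots> = path_edges (rev (y # zs)) \<union> {{y, x}}" by (subst path_edges_append) simp
  finally show ?case using 3(2) by (auto simp: insert_commute)
qed auto

lemma path_edges_sub: "e \<in> path_edges xs \<Longrightarrow> e \<subseteq> set xs"
  by (induction xs rule: induct_list012) auto

lemma path_edges_cover: "2 \<le> length xs \<Longrightarrow> x \<in> set xs \<Longrightarrow> \<exists>e\<in>path_edges xs. x \<in> e"
proof (induction xs rule: induct_list012)
  case (3 a b zs)
  show ?case
  proof (cases "x = a \<or> x = b")
    case False
    then have "x \<in> set (b # zs)" "2 \<le> length (b # zs)" using 3(4) by (auto simp: Suc_le_eq)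
    then show ?thesis using 3(2) by auto
  qed auto
qed auto

text \<open>Makes two paths with common ends and disjoint interiors edge-disjoint as soon as one of
  them has an inner vertex.\<close>

lemma path_edges_interior:
  assumes "e \<in> path_edges (a # p @ [b])" "p \<noteq> []" shows "e \<inter> set p \<noteq> {}"
proof -
  have "path_edges (a # p @ [b]) \<subseteq> {e. e \<inter> set p \<noteq> {}}"
    using assms(2)
  proof (induction p arbitrary: a)
    case (Cons x p)
    show ?case
    proof (cases "p = []")
      case False
      then have "path_edges (x # p @ [b]) \<subseteq> {e. e \<inter> set p \<noteq> {}}" using Cons.IH by simp
      then show ?thesis by auto
    qed auto
  qed simp
  then show ?thesis using assms(1) by blast
qed

locale plane_drawing =
  fixes E :: "'a \<Rightarrow> 'a \<Rightarrow> bool" and V :: "'a set" and p :: "'a \<Rightarrow> complex" and \<gamma> :: "'a set \<Rightarrow> real \<Rightarrow> complex"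
  assumes E_sym: "E u v \<Longrightarrow> E v u" and E_V: "E u v \<Longrightarrow> u \<in> V" and E_neq: "E u v \<Longrightarrow> u \<noteq> v"
    and inj: "inj_on p V"
    and edge_arc: "E u v \<Longrightarrow> arc (\<gamma> {u, v})"
    and edge_ends: "E u v \<Longrightarrow> {pathstart (\<gamma> {u, v}), pathfinish (\<gamma> {u, v})} = {p u, p v}"
    and edge_disjoint: "E u v \<Longrightarrow> E x y \<Longrightarrow> {u, v} \<noteq> {x, y} \<Longrightarrow> z \<in> path_image (\<gamma> {u, v}) \<Longrightarrow> z \<in> path_image (\<gamma> {x, y}) \<Longrightarrow>
      z \<in> p ` {u, v}"
begin

definition im :: "'a list \<Rightarrow> complex set" where
  "im xs = (\<Union>e\<in>path_edges xs. path_image (\<gamma> e))"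

lemma edges_E: "successively E xs \<Longrightarrow> e \<in> path_edges xs \<Longrightarrow> \<exists>u v. e = {u, v} \<and> E u v"
  by (induction xs rule: induct_list012) auto

lemma im_Int:
  assumes "successively E xs" "successively E ys" "path_edges xs \<inter> path_edges ys = {}"
  shows "im xs \<inter> im ys \<subseteq> p ` (set xs \<inter> set ys)"
proof
  fix z assume "z \<in> im xs \<inter> im ys"
  then obtain e f where ef: "e \<in> path_edges xs" "f \<in> path_edges ys" "z \<in> path_image (\<gamma> e)" "z \<in> path_image (\<gamma> f)"
    by (auto simp: im_def)
  obtain u v where uv: "e = {u, v}" "E u v" using edges_E[OF assms(1) ef(1)] by blast
  obtain x y where xy: "f = {x, y}" "E x y" using edges_E[OF assms(2) ef(2)] by blast
  have "e \<noteq> f" using ef assms(3) by blast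
  then have "z \<in> p ` {u, v}" "z \<in> p ` {x, y}"
    using edge_disjoint[OF uv(2) xy(2)] edge_disjoint[OF xy(2) uv(2)] ef uv xy by auto
  then obtain s t where st: "s \<in> e" "t \<in> f" "z = p s" "z = p t" using uv xy by blast
  have "s \<in> V" "t \<in> V" using st uv xy E_V E_sym by blast+
  then have "s = t" using st inj by (auto dest: inj_onD)
  then show "z \<in> p ` (set xs \<inter> set ys)" using st path_edges_sub ef by blast
qed

text \<open>\<open>\<gamma>\<close> is indexed by undirected edges, so its arc may run either way
  and is reversed if necessary.\<close>

lemma edge_path:
  assumes "E u v"
  obtains g where "arc g" "pathstart g = p u" "pathfinish g = p v" "path_image g = path_image (\<gamma> {u, v})"
proof -
  have neq: "p u \<noteq> p v" using inj E_V E_sym E_neq assms by (metis inj_onD)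
  then consider "pathstart (\<gamma> {u, v}) = p u" "pathfinish (\<gamma> {u, v}) = p v" | "pathstart (\<gamma> {u, v}) = p v" "pathfinish (\<gamma> {u, v}) = p u"
    using edge_ends[OF assms] by (auto simp: doubleton_eq_iff)
  then show thesis
  proof cases
    case 1 then show thesis using that[of "\<gamma> {u, v}"] edge_arc[OF assms] by simp
  next
    case 2 then show thesis using that[of "reversepath (\<gamma> {u, v})"] edge_arc[OF assms] by (simp add: arc_reversepath)
  qed
qed

lemma path_arc:
  assumes "2 \<le> length xs" "distinct xs" "successively E xs"
  shows "\<exists>g. arc g \<and> pathstart g = p (hd xs) \<and> pathfinish g = p (last xs) \<and> path_image g = im xs"
  using assms
proof (induction xs rule: induct_list012)
  case (3 x y zs)
  have xy: "E x y" using 3(5) by simp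
  obtain g where g: "arc g" "pathstart g = p x" "pathfinish g = p y" "path_image g = path_image (\<gamma> {x, y})"
    by (rule edge_path[OF xy])
  show ?case
  proof (cases "zs = []")
    case True
    then show ?thesis using g by (intro exI[of _ g]) (simp add: im_def)
  next
    case False
    then have "2 \<le> length (y # zs)" by (cases zs) auto
    from 3(2)[OF this] 3(4,5) obtain h where h: "arc h" "pathstart h = p y" "pathfinish h = p (last (y # zs))" "path_image h = im (y # zs)"
      by auto
    have gi: "path_image g = im [x, y]" using g(4) by (simp add: im_def)
    have "{x, y} \<notin> path_edges (y # zs)" using path_edges_sub[of "{x, y}" "y # zs"] 3(4) by auto
    then have "im [x, y] \<inter> im (y # zs) \<subseteq> p ` (set [x, y] \<inter> set (y # zs))"
      using 3(5) xy by (intro im_Int) auto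
    also have "set [x, y] \<inter> set (y # zs) = {y}" using 3(4) by auto
    finally have "path_image g \<inter> path_image h \<subseteq> {pathstart h}" using gi h by simp
    then have "arc (g +++ h)" using g h by (intro arc_join) auto
    moreover have "path_image (g +++ h) = im (x # y # zs)"
      using g h by (simp add: path_image_join im_def)
    ultimately show ?thesis using g h by (intro exI[of _ "g +++ h"]) simp
  qed
qed auto

lemma vertex_in_im:
  assumes "2 \<le> length xs" "successively E xs" "x \<in> set xs" shows "p x \<in> im xs"
proof -
  obtain e where e: "e \<in> path_edges xs" "x \<in> e" using path_edges_cover[OF assms(1,3)] by blast
  obtain u v where uv: "e = {u, v}" "E u v" using edges_E[OF assms(2) e(1)] by blast
  have "p x \<in> {pathstart (\<gamma> e), pathfinish (\<gamma> e)}" using edge_ends[OF uv(2)] uv(1) e(2) by auto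
  then have "p x \<in> path_image (\<gamma> e)" by auto
  then show ?thesis using e by (auto simp: im_def)
qed

lemma path_V: "successively E xs \<Longrightarrow> 2 \<le> length xs \<Longrightarrow> set xs \<subseteq> V"
  using path_edges_cover edges_E E_V E_sym by (metis insertE singletonD subsetI)

text \<open>With \<open>R = []\<close> the third arc is a single edge, that is, a chord of the cycle
  formed by the other two paths.\<close>

lemma theta_of_paths:
  assumes d: "distinct (a # b # P @ Q @ R)" and s: "successively E (a # P @ [b])" "successively E (a # Q @ [b])" "successively E (a # R @ [b])"
    and ne: "P \<noteq> []" "Q \<noteq> []"
  obtains g h k where "theta_curve g h k (p a) (p b)" "path_image g = im (a # P @ [b])" "path_image h = im (a # Q @ [b])"
    "path_image k = im (a # R @ [b])"
proof -
  let ?P = "a # P @ [b]" and ?Q = "a # Q @ [b]" and ?R = "a # R @ [b]"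
  obtain g where g: "arc g" "pathstart g = p a" "pathfinish g = p b" "path_image g = im ?P"
    using path_arc[OF _ _ s(1)] d by auto
  obtain h where h: "arc h" "pathstart h = p a" "pathfinish h = p b" "path_image h = im ?Q"
    using path_arc[OF _ _ s(2)] d by auto
  obtain k where k: "arc k" "pathstart k = p a" "pathfinish k = p b" "path_image k = im ?R"
    using path_arc[OF _ _ s(3)] d by auto
  have "set ?P \<subseteq> V" by (rule path_V[OF s(1)]) simp
  then have ab: "a \<in> V" "b \<in> V" by simp_all
  have pab: "p a \<noteq> p b" using inj_onD[OF inj _ ab] d by auto
  have meet: "im (a # S @ [b]) \<inter> im (a # T @ [b]) = {p a, p b}"
    if "successively E (a # S @ [b])" "successively E (a # T @ [b])" "distinct (a # b # S @ T)" "S \<noteq> []" for S T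
  proof
    have "path_edges (a # S @ [b]) \<inter> path_edges (a # T @ [b]) = {}"
    proof (rule ccontr)
      assume "path_edges (a # S @ [b]) \<inter> path_edges (a # T @ [b]) \<noteq> {}"
      then obtain e where e: "e \<in> path_edges (a # S @ [b])" "e \<in> path_edges (a # T @ [b])" by blast
      have "e \<inter> set S \<noteq> {}" using path_edges_interior[OF e(1) that(4)] .
      moreover have "e \<subseteq> set (a # T @ [b])" using path_edges_sub[OF e(2)] .
      ultimately show False using that(3) by auto
    qed
    then have "im (a # S @ [b]) \<inter> im (a # T @ [b]) \<subseteq> p ` (set (a # S @ [b]) \<inter> set (a # T @ [b]))"
      using im_Int that by blast
    moreover have "set (a # S @ [b]) \<inter> set (a # T @ [b]) = {a, b}" using that(3) by auto
    ultimately show "im (a # S @ [b]) \<inter> im (a # T @ [b]) \<subseteq> {p a, p b}" by (metis image_insert image_empty)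
    show "{p a, p b} \<subseteq> im (a # S @ [b]) \<inter> im (a # T @ [b])"
      using vertex_in_im[OF _ that(1)] vertex_in_im[OF _ that(2)] by simp
  qed
  have "im ?P \<inter> im ?Q = {p a, p b}" "im ?P \<inter> im ?R = {p a, p b}" "im ?Q \<inter> im ?R = {p a, p b}"
    by (rule meet[OF s(1,2)] meet[OF s(1,3)] meet[OF s(2,3)]; use d ne in \<open>simp add: Int_Un_distrib\<close>)+
  then have "theta_curve g h k (p a) (p b)" unfolding theta_curve_def using g h k pab by simp
  then show thesis using that g h k by blast
qed

end

locale outer_drawing = plane_drawing +
  fixes F :: "complex set"
  assumes F: "Topological_Spaces.connected F" "\<not> bounded F" "E u v \<Longrightarrow> F \<inter> path_image (\<gamma> {u, v}) = {}" "v \<in> V \<Longrightarrow> p v \<in> frontier F"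
begin

lemma F_im: "successively E xs \<Longrightarrow> F \<inter> im xs = {}"
  using edges_E F(3) unfolding im_def by blast

lemma interior_vertex:
  assumes "distinct (a # b # P)" "successively E (a # P @ [b])" "x \<in> set P"
  shows "p x \<in> im (a # P @ [b]) - {p a, p b}" "p x \<in> frontier F"
proof -
  have V: "set (a # P @ [b]) \<subseteq> V" by (rule path_V[OF assms(2)]) simp
  then show "p x \<in> frontier F" using F(4) assms(3) by auto
  have "p x \<in> im (a # P @ [b])" using vertex_in_im[OF _ assms(2)] assms(3) by simp
  moreover have "p x \<noteq> p a" "p x \<noteq> p b" using inj_onD[OF inj] V assms(1,3) by auto
  ultimately show "p x \<in> im (a # P @ [b]) - {p a, p b}" by simp
qed

lemma no_theta:
  assumes ne: "P \<noteq> []" "Q \<noteq> []" "R \<noteq> []" and d: "distinct (a # b # P @ Q @ R)"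
    and s: "successively E (a # P @ [b])" "successively E (a # Q @ [b])" "successively E (a # R @ [b])"
  shows False
proof -
  obtain g h k where t: "theta_curve g h k (p a) (p b)" "path_image g = im (a # P @ [b])" "path_image h = im (a # Q @ [b])"
    "path_image k = im (a # R @ [b])" by (rule theta_of_paths[OF d s ne(1,2)])
  obtain x y z where xyz: "x \<in> set P" "y \<in> set Q" "z \<in> set R" using ne by (meson last_in_set)
  have "F \<inter> (path_image g \<union> path_image h \<union> path_image k) = {}" using F_im s t by blast
  moreover have "p x \<in> path_image g - {p a, p b}" "p x \<in> frontier F"
    using interior_vertex[OF _ s(1) xyz(1)] d t by auto
  moreover have "p y \<in> path_image h - {p a, p b}" "p y \<in> frontier F"
    using interior_vertex[OF _ s(2) xyz(2)] d t by auto
  moreover have "p z \<in> path_image k - {p a, p b}" "p z \<in> frontier F"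
    using interior_vertex[OF _ s(3) xyz(3)] d t by auto
  ultimately show False using theta_outer_False[OF t(1) F(1,2)] by blast
qed

lemma chord_inside:
  assumes ne: "P \<noteq> []" "Q \<noteq> []" and d: "distinct (a # b # P @ Q)"
    and s: "successively E (a # P @ [b])" "successively E (a # Q @ [b])" and ab: "E a b"
  obtains g h k where "theta_curve g h k (p a) (p b)" "path_image g = im (a # P @ [b])" "path_image h = im (a # Q @ [b])"
    "path_image k = path_image (\<gamma> {a, b})"
    "path_image k - {p a, p b} \<subseteq> inside (im (a # P @ [b]) \<union> im (a # Q @ [b]))"
proof -
  have s3: "successively E (a # [] @ [b])" using ab by simp
  obtain g h k where t: "theta_curve g h k (p a) (p b)" "path_image g = im (a # P @ [b])" "path_image h = im (a # Q @ [b])"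
    "path_image k = im (a # [] @ [b])" by (rule theta_of_paths[OF _ s s3 ne]) (use d in auto)
  obtain x y where xy: "x \<in> set P" "y \<in> set Q" using ne by (meson last_in_set)
  have "F \<inter> (path_image g \<union> path_image h \<union> path_image k) = {}" using F_im s s3 t by blast
  moreover have "p x \<in> path_image g - {p a, p b}" "p x \<in> frontier F"
    using interior_vertex[OF _ s(1) xy(1)] d t by auto
  moreover have "p y \<in> path_image h - {p a, p b}" "p y \<in> frontier F"
    using interior_vertex[OF _ s(2) xy(2)] d t by auto
  ultimately have "path_image k - {p a, p b} \<subseteq> inside (path_image g \<union> path_image h)"
    using theta_outer_chord[OF t(1) F(1,2)] by blast
  then show thesis using that[OF t(1-3)] t by (simp add: im_def)
qed

text \<open>The cycle through \<open>a\<close>, \<open>P\<close>, \<open>c\<close>, \<open>Q\<close>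
  is also composed of two paths between \<open>b\<close> and \<open>e\<close>. Read in both ways,
  \<open>chord_inside\<close> places both chords inside the same closed curve, where disjoint chords
  with alternating ends cannot exist.\<close>

lemma no_crossing_chords:
  assumes d: "distinct (a # c # P @ Q)" and s: "successively E (a # P @ [c])" "successively E (a # Q @ [c])"
    and b: "b \<in> set P" and e: "e \<in> set Q" and ac: "E a c" and be: "E b e"
  shows False
proof -
  have ne: "P \<noteq> []" "Q \<noteq> []" using b e by auto
  obtain g h k where t: "theta_curve g h k (p a) (p c)" "path_image g = im (a # P @ [c])" "path_image h = im (a # Q @ [c])"
    "path_image k = path_image (\<gamma> {a, c})" "path_image k - {p a, p c} \<subseteq> inside (im (a # P @ [c]) \<union> im (a # Q @ [c]))"
    by (rule chord_inside[OF ne d s ac])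
  obtain P1 P2 where P: "P = P1 @ b # P2" using b by (meson split_list)
  obtain Q1 Q2 where Q: "Q = Q1 @ e # Q2" using e by (meson split_list)
  let ?S = "P2 @ c # rev Q2" and ?T = "rev P1 @ a # Q1"
  have srev: "successively E (rev xs)" if "successively E xs" for xs
  proof -
    have "successively (\<lambda>x y. E y x) (rev xs)" using that unfolding successively_rev .
    then show ?thesis by (rule successively_mono) (rule E_sym)
  qed
  have s1: "successively E ((a # P1) @ (b # P2 @ [c]))" "successively E ((a # Q1) @ (e # Q2 @ [c]))" using s P Q by simp_all
  then have p1: "successively E (a # P1)" "successively E (b # P2 @ [c])" "E (last (a # P1)) b"
    and q1: "successively E (a # Q1)" "successively E (e # Q2 @ [c])" "E (last (a # Q1)) e"
    unfolding successively_append_iff by simp_all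
  have "successively E (rev (e # Q2 @ [c]))" using srev q1(2) by blast
  then have qr: "successively E (c # rev Q2 @ [e])" by simp
  have "successively E ((b # P2) @ [c])" using p1(2) by simp
  then have "successively E (b # P2)" "E (last (b # P2)) c" unfolding successively_append_iff by simp_all
  then have "successively E ((b # P2) @ (c # rev Q2 @ [e]))" using qr unfolding successively_append_iff by simp
  then have sS: "successively E (b # ?S @ [e])" by simp
  have "successively E (rev ((a # P1) @ [b]))" by (rule srev) (use p1 in \<open>simp only: successively_append_iff; simp\<close>)
  then have "successively E ((b # rev P1) @ [a])" by simp
  then have "successively E (b # rev P1)" "E (last (b # rev P1)) a" unfolding successively_append_iff by simp_all
  moreover have "successively E ((a # Q1) @ [e])" using q1 unfolding successively_append_iff by simp
  then have "successively E (a # Q1 @ [e])" by simp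
  ultimately have "successively E ((b # rev P1) @ (a # Q1 @ [e]))" unfolding successively_append_iff by simp
  then have sT: "successively E (b # ?T @ [e])" by simp
  have dST: "distinct (b # e # ?S @ ?T)" using d unfolding P Q by auto
  have im_eq: "im (b # ?S @ [e]) \<union> im (b # ?T @ [e]) = im (a # P @ [c]) \<union> im (a # Q @ [c])"
  proof -
    have e1: "path_edges (b # ?S @ [e]) = path_edges (b # P2 @ [c]) \<union> path_edges (e # Q2 @ [c])"
      using path_edges_append[of "b # P2" c "rev Q2 @ [e]"] path_edges_rev[of "e # Q2 @ [c]"] by simp
    have e2: "path_edges (b # ?T @ [e]) = path_edges (a # P1 @ [b]) \<union> path_edges (a # Q1 @ [e])"
      using path_edges_append[of "b # rev P1" a "Q1 @ [e]"] path_edges_rev[of "a # P1 @ [b]"] by simp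
    have e3: "path_edges (a # P @ [c]) = path_edges (a # P1 @ [b]) \<union> path_edges (b # P2 @ [c])"
      using path_edges_append[of "a # P1" b "P2 @ [c]"] P by simp
    have e4: "path_edges (a # Q @ [c]) = path_edges (a # Q1 @ [e]) \<union> path_edges (e # Q2 @ [c])"
      using path_edges_append[of "a # Q1" e "Q2 @ [c]"] Q by simp
    show ?thesis unfolding im_def e1 e2 e3 e4 by blast
  qed
  obtain g' h' m where m: "theta_curve g' h' m (p b) (p e)" "path_image m = path_image (\<gamma> {b, e})"
    "path_image m - {p b, p e} \<subseteq> inside (im (b # ?S @ [e]) \<union> im (b # ?T @ [e]))"
    using chord_inside[OF _ _ dST sS sT be] by (metis append_is_Nil_conv list.distinct(1))
  have arcm: "arc m" "pathstart m = p b" "pathfinish m = p e" using m(1) unfolding theta_curve_def by auto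
  have pb: "p b \<in> path_image g - {p a, p c}" using interior_vertex(1)[OF _ s(1) b] d t(2) by auto
  have pe: "p e \<in> path_image h - {p a, p c}" using interior_vertex(1)[OF _ s(2) e] d t(3) by auto
  have "(path_image m - {p b, p e}) \<inter> path_image k = {}"
  proof -
    have "{b, e} \<noteq> {a, c}" using d b e by auto
    then show ?thesis using edge_disjoint[OF be ac] m(2) t(4) by auto
  qed
  then show False
    using crossing_chords_False[OF t(1) _ arcm pb pe] t(2,3,5) m(3) im_eq by simp
qed

end

section \<open>Graphs as symmetric relations\<close>

lemma connected_iff_conn:
  assumes F: "sym_rel F" and D: "\<And>u v. u \<rightarrow>\<^bsub>D\<^esub> v \<longleftrightarrow> F u v \<and> u \<in> verts D \<and> v \<in> verts D"
  shows "Digraph_Component.connected D \<longleftrightarrow> sym_rel.conn F (verts D)"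
proof -
  interpret sym_rel F by (rule F)
  have R: "(u, v) \<in> symcl (arcs_ends D) \<longleftrightarrow> F u v \<and> u \<in> verts D \<and> v \<in> verts D" for u v
  proof -
    have "(u, v) \<in> symcl (arcs_ends D) \<longleftrightarrow> u \<rightarrow>\<^bsub>D\<^esub> v \<or> v \<rightarrow>\<^bsub>D\<^esub> u" unfolding symcl_def by auto
    then show ?thesis unfolding D using sym[of u v] sym[of v u] by auto
  qed
  show ?thesis
  proof
    assume con: "Digraph_Component.connected D"
    show "conn (verts D)" unfolding conn_def
    proof (intro conjI allI impI)
      show "verts D \<noteq> {}" using con unfolding connected_conv by simp
      fix Y assume Y: "Y \<subseteq> verts D" "Y \<noteq> {}" "Y \<noteq> verts D"
      then obtain u v where uv: "u \<in> Y" "v \<in> verts D" "v \<notin> Y" by blast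
      then have "(u, v) \<in> rtrancl_on (verts D) (symcl (arcs_ends D))" using con Y(1) unfolding connected_conv by (simp add: subsetD)
      then have "v \<in> Y \<or> adj Y (verts D - Y)"
      proof (induction rule: rtrancl_on_induct)
        case (step y z)
        then have "F y z" using R by simp
        then show ?case using step.hyps(4) step.IH adjI[of y Y z "verts D - Y"] by blast
      qed (use uv in simp)
      then show "adj Y (verts D - Y)" using uv by simp
    qed
  next
    assume con: "conn (verts D)"
    have "(u, v) \<in> rtrancl_on (verts D) (symcl (arcs_ends D))" if uv: "u \<in> verts D" "v \<in> verts D" for u v
    proof (rule ccontr)
      assume nv: "(u, v) \<notin> rtrancl_on (verts D) (symcl (arcs_ends D))"
      let ?Y = "{w \<in> verts D. (u, w) \<in> rtrancl_on (verts D) (symcl (arcs_ends D))}"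
      have "u \<in> ?Y" "v \<notin> ?Y" using uv nv by simp_all
      then have "adj ?Y (verts D - ?Y)" using uv by (intro connD[OF con]) blast+
      then obtain x y where xy: "x \<in> ?Y" "y \<in> verts D - ?Y" "F x y" unfolding adj_def by blast
      then have "(x, y) \<in> symcl (arcs_ends D)" using R by simp
      then have "(u, y) \<in> rtrancl_on (verts D) (symcl (arcs_ends D))"
        by (rule rtrancl_on_into_rtrancl_on[rotated]) (use xy in simp_all)
      then show False using xy(2) by simp
    qed
    then show "Digraph_Component.connected D" using conn_nonempty[OF con] unfolding connected_conv by simp
  qed
qed

text \<open>Cycles in \<open>undirected_forest\<close> are lists of arcs, whereas the paths of this
  proof are lists of vertices; this is the translation.\<close>

lemma awalk_of_walk:
  assumes "vs \<noteq> []" "successively (dominates D) vs" "hd vs \<in> verts D" "wf_digraph D"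
  shows "\<exists>es. pre_digraph.awalk D (hd vs) es (last vs) \<and> pre_digraph.awalk_verts D (hd vs) es = vs"
  using assms(1-3)
proof (induction vs rule: induct_list012)
  case (2 x)
  then show ?case by (intro exI[of _ "[]"]) (simp add: pre_digraph.awalk_def pre_digraph.cas.simps pre_digraph.awalk_verts.simps)
next
  case (3 x y zs)
  obtain e where e: "e \<in> arcs D" "tail D e = x" "head D e = y" using 3(4) by auto
  then have "y \<in> verts D" using wf_digraph.head_in_verts[OF assms(4)] by blast
  then obtain es where es: "pre_digraph.awalk D y es (last (y # zs))" "pre_digraph.awalk_verts D y es = y # zs"
    using 3(2,4) by auto
  then show ?case using e 3(5)
    by (intro exI[of _ "e # es"]) (simp add: pre_digraph.awalk_def pre_digraph.cas.simps pre_digraph.awalk_verts.simps)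
qed simp

sublocale graph \<subseteq> rel: fin_graph "dominates G" "verts G"
proof
  show "u \<rightarrow> v \<Longrightarrow> v \<rightarrow> u" for u v using sym_arcs unfolding symmetric_def sym_def by simp
  show "u \<rightarrow> v \<Longrightarrow> u \<in> verts G" for u v by auto
qed simp

context graph begin

lemma dominates_neq: "u \<rightarrow> v \<Longrightarrow> u \<noteq> v"
  using no_loops by (metis reachableE)

lemma dominates_del_vert: "u \<rightarrow>\<^bsub>del_vert w\<^esub> v \<longleftrightarrow> u \<rightarrow> v \<and> u \<noteq> w \<and> v \<noteq> w"
  by (auto simp: arcs_ends_conv del_vert_simps)

lemma connected_iff: "Digraph_Component.connected G \<longleftrightarrow> rel.conn (verts G)"
  by (rule connected_iff_conn[OF rel.sym_rel_axioms]) (auto intro: rel.E_V rel.E_V')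

lemma connected_del_vert_iff: "Digraph_Component.connected (del_vert v) \<longleftrightarrow> rel.conn (verts G - {v})"
  using connected_iff_conn[OF rel.sym_rel_axioms, of "del_vert v"] rel.E_V rel.E_V'
  by (simp add: dominates_del_vert verts_del_vert) blast

lemma connected_induce_iff: "Digraph_Component.connected (G \<restriction> X) \<longleftrightarrow> rel.conn X"
  using connected_iff_conn[OF rel.sym_rel_axioms, of "G \<restriction> X"]
  by (auto simp: arcs_ends_conv induce_subgraph_def)

text \<open>Connectivity gives \<open>X\<close> one neighbour \<open>v\<close>. A second vertex lies
  outside \<open>X\<close>, so connectivity of the graph without \<open>v\<close> gives another
  neighbour.\<close>

lemma two_connected_imp:
  assumes "two_connected G"
  shows "two_conn_graph (dominates G) (verts G)" "rel.conn (verts G)"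
proof -
  show con: "rel.conn (verts G)" using assms connected_iff unfolding two_connected_def by simp
  have del: "rel.conn (verts G - {v})" if "v \<in> verts G" for v
    using assms that connected_del_vert_iff unfolding two_connected_def by simp
  show "two_conn_graph (dominates G) (verts G)"
  proof
    fix X assume X: "X \<noteq> {}" "X \<subseteq> verts G" "2 \<le> card (verts G - X)"
    have sub: "rel.nbrs X \<subseteq> verts G - X" unfolding rel.nbrs_def using rel.E_V' by blast
    have fin: "finite (rel.nbrs X)" by (rule finite_subset[OF sub]) simp
    show "2 \<le> card (rel.nbrs X)"
    proof (rule ccontr)
      assume "\<not> 2 \<le> card (rel.nbrs X)"
      then have "card (rel.nbrs X) \<le> Suc 0" by simp
      then have one: "x = y" if "x \<in> rel.nbrs X" "y \<in> rel.nbrs X" for x y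
        using that card_le_Suc0_iff_eq[OF fin] by blast
      have "verts G - X \<noteq> {}" using X(3) by (metis card.empty not_numeral_le_zero)
      then have "rel.adj X (verts G - X)" using X by (intro rel.connD[OF con]) blast+
      then obtain v where v: "v \<in> verts G - X" "v \<in> rel.nbrs X" using rel.adj_nbrs[of X "verts G - X"] by blast
      have "X \<noteq> verts G - {v}"
      proof
        assume "X = verts G - {v}"
        then have "verts G - X = {v}" using v by blast
        then show False using X(3) by simp
      qed
      then have "rel.adj X (verts G - {v} - X)" using X v by (intro rel.connD[OF del]) blast+
      then obtain w where "w \<in> verts G - {v} - X" "w \<in> rel.nbrs X" using rel.adj_nbrs[of X "verts G - {v} - X"] by blast
      then show False using one v by blast
    qed
  qed
qed

lemma is_minorI:
  assumes "\<And>x. x \<in> verts H \<Longrightarrow> M x \<subseteq> verts G" "\<And>x. x \<in> verts H \<Longrightarrow> rel.conn (M x)" "disjoint_family_on M (verts H)"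
    "\<And>x y. x \<rightarrow>\<^bsub>H\<^esub> y \<Longrightarrow> rel.adj (M x) (M y)"
  shows "is_minor H G"
  unfolding is_minor_def
proof (rule exI[of _ M], intro conjI ballI allI impI)
  show "\<exists>u\<in>M x. \<exists>v\<in>M y. u \<rightarrow> v" if "x \<rightarrow>\<^bsub>H\<^esub> y" for x y using assms(4)[OF that] unfolding rel.adj_def .
qed (use assms in \<open>simp_all add: connected_induce_iff\<close>)

section \<open>Pathwidth and linear layouts\<close>

text \<open>The bag at position \<open>k\<close> holds the vertex there and every earlier vertex
  that still has a neighbour at position \<open>k\<close> or later. The vertex at position
  \<open>m\<close> thus occurs from \<open>m\<close> up to the position of its last neighbour, or
  only at \<open>m\<close>, and an edge lies in the bag of its later end.\<close>

lemma pathwidth_le: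
  assumes "distinct xs" "set xs = verts G" "\<And>i. i < length xs \<Longrightarrow> card (rel.bd (set (take i xs))) \<le> w"
  shows "pathwidth G \<le> w"
proof -
  let ?n = "length xs"
  define bag where "bag k = insert (xs ! k) (rel.bd (set (take k xs)))" for k
  let ?Bs = "map bag [0..<?n]"
  have drop: "verts G - set (take k xs) = set (drop k xs)" for k
  proof -
    have "set (take k xs) \<inter> set (drop k xs) = {}" using assms(1) by (simp add: set_take_disj_set_drop_if_distinct)
    moreover have "set (take k xs) \<union> set (drop k xs) = verts G" by (metis append_take_drop_id assms(2) set_append)
    ultimately show ?thesis by blast
  qed
  have take: "xs ! m \<in> set (take k xs) \<longleftrightarrow> m < k" if "m < ?n" "k < ?n" for m k
    using that assms(1) by (auto simp: in_set_conv_nth nth_eq_iff_index_eq)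
  have dropm: "v \<in> set (drop k xs) \<longleftrightarrow> (\<exists>j. k \<le> j \<and> j < ?n \<and> v = xs ! j)" if "k < ?n" for k v
  proof
    assume "v \<in> set (drop k xs)"
    then obtain i where "i < ?n - k" "v = xs ! (k + i)" using that by (auto simp: in_set_conv_nth)
    then show "\<exists>j. k \<le> j \<and> j < ?n \<and> v = xs ! j" by (intro exI[of _ "k + i"]) simp
  next
    assume "\<exists>j. k \<le> j \<and> j < ?n \<and> v = xs ! j"
    then obtain j where "k \<le> j" "j < ?n" "v = xs ! j" by blast
    then show "v \<in> set (drop k xs)" using that by (auto simp: in_set_conv_nth intro!: exI[of _ "j - k"])
  qed
  have bag: "xs ! m \<in> bag k \<longleftrightarrow> k = m \<or> (m < k \<and> (\<exists>j. k \<le> j \<and> j < ?n \<and> xs ! m \<rightarrow> xs ! j))" if "m < ?n" "k < ?n" for m k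
  proof -
    have "xs ! m \<in> rel.bd (set (take k xs)) \<longleftrightarrow> m < k \<and> (\<exists>v\<in>set (drop k xs). xs ! m \<rightarrow> v)"
      unfolding rel.bd_def drop using take[OF that] by simp
    also have "\<dots> \<longleftrightarrow> m < k \<and> (\<exists>j. k \<le> j \<and> j < ?n \<and> xs ! m \<rightarrow> xs ! j)"
      unfolding Bex_def dropm[OF that(2)] by auto
    finally show ?thesis using that assms(1) by (auto simp: bag_def nth_eq_iff_index_eq)
  qed
  have "path_decomposition G ?Bs"
    unfolding path_decomposition_def
  proof (intro conjI ballI allI impI)
    fix B assume "B \<in> set ?Bs"
    then obtain k where k: "k < ?n" "B = bag k" by auto
    have "set (take k xs) \<subseteq> verts G" using assms(2) set_take_subset[of k xs] by simp
    then show "B \<subseteq> verts G" using k assms(2) nth_mem[of k xs] unfolding bag_def rel.bd_def by auto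
  next
    fix v assume "v \<in> verts G"
    then obtain m where m: "m < ?n" "v = xs ! m" using assms(2) by (metis in_set_conv_nth)
    let ?J = "{k. k < ?n \<and> v \<in> bag k}"
    have fin: "finite ?J" by simp
    have mJ: "m \<in> ?J" using m by (simp add: bag_def)
    have "?J = {m..Max ?J}"
    proof (intro equalityI subsetI)
      fix k assume k: "k \<in> ?J"
      then have "m \<le> k" using bag[OF m(1), of k] m(2) by auto
      then show "k \<in> {m..Max ?J}" using Max_ge[OF fin k] by simp
    next
      fix k assume k: "k \<in> {m..Max ?J}"
      have MJ: "Max ?J \<in> ?J" using fin mJ by (intro Max_in) auto
      then have kn: "k < ?n" "Max ?J < ?n" using k by simp_all
      show "k \<in> ?J"
      proof (cases "k = m")
        case False
        then have mk: "m < k" "k \<le> Max ?J" using k by simp_all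
        then obtain j where "Max ?J \<le> j" "j < ?n" "xs ! m \<rightarrow> xs ! j" using bag[OF m(1) kn(2)] MJ m(2) by auto
        then have "\<exists>j. k \<le> j \<and> j < ?n \<and> xs ! m \<rightarrow> xs ! j" using mk(2) by (intro exI[of _ j]) simp
        then show ?thesis using bag[OF m(1) kn(1)] kn(1) mk(1) m(2) by simp
      qed (use mJ in simp)
    qed
    moreover have "{k. k < length ?Bs \<and> v \<in> ?Bs ! k} = ?J" by auto
    moreover have "m \<le> Max ?J" using Max_ge[OF fin mJ] .
    ultimately show "\<exists>i j. i \<le> j \<and> {k. k < length ?Bs \<and> v \<in> ?Bs ! k} = {i..j}" by metis
  next
    have *: "\<exists>B\<in>set ?Bs. xs ! a \<in> B \<and> xs ! b \<in> B" if ab: "a < b" "b < ?n" "xs ! a \<rightarrow> xs ! b" for a b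
    proof -
      have "xs ! a \<in> bag b" using ab by (subst bag) auto
      moreover have "xs ! b \<in> bag b" by (simp add: bag_def)
      ultimately show ?thesis using ab by auto
    qed
    fix u v assume uv: "u \<rightarrow> v"
    then have "u \<in> set xs" "v \<in> set xs" using assms(2) rel.E_V rel.E_V' by auto
    then obtain a b where ab: "a < ?n" "u = xs ! a" "b < ?n" "v = xs ! b" by (metis in_set_conv_nth)
    have "a \<noteq> b" using dominates_neq[OF uv] ab by blast
    then consider "a < b" | "b < a" by linarith
    then show "\<exists>B\<in>set ?Bs. u \<in> B \<and> v \<in> B"
    proof cases
      case 1 then show ?thesis using * uv ab by simp
    next
      case 2
      then have "\<exists>B\<in>set ?Bs. v \<in> B \<and> u \<in> B" using * rel.sym[OF uv] ab by simp
      then show ?thesis by blast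
    qed
  qed
  moreover have "\<forall>B\<in>set ?Bs. card B \<le> w + 1"
  proof
    fix B assume "B \<in> set ?Bs"
    then obtain k where k: "k < ?n" "B = bag k" by auto
    have "card B \<le> Suc (card (rel.bd (set (take k xs))))" unfolding k(2) bag_def by (rule card_insert_le_m1) simp_all
    then show "card B \<le> w + 1" using assms(3)[OF k(1)] by simp
  qed
  ultimately show ?thesis unfolding pathwidth_def by (intro Least_le exI[of _ ?Bs]) simp
qed

text \<open>A layout whose prefixes have fewer than \<open>w\<close> boundary vertices gives
  pathwidth at most \<open>w - 1\<close>.\<close>

lemma not_good_of_pathwidth:
  assumes "w \<le> pathwidth G" "0 < w"
  shows "\<not> rel.good w (verts G)"
proof
  assume "rel.good w (verts G)"
  then obtain xs where xs: "distinct xs" "set xs = verts G" "\<forall>i<length xs. card (rel.bd (set (take i xs))) < w"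
    using rel.good_layout by blast
  then have "pathwidth G \<le> w - 1" by (intro pathwidth_le[of xs]) fastforce+
  then show False using assms by simp
qed

section \<open>Apex-forests\<close>

text \<open>Two distinct neighbours of \<open>r\<close> in a connected set that avoids
  \<open>r\<close> are joined by a path there, which closes through \<open>r\<close> to a cycle of
  length at least 3.\<close>

lemma undirected_forest_acyclic:
  assumes "undirected_forest (del_vert v)"
  shows "rel.acyclic_on (verts G - {v})"
  unfolding rel.acyclic_on_def
proof (intro ballI allI impI)
  fix r C a b
  assume r: "r \<in> verts G - {v}" and C: "C \<subseteq> verts G - {v} - {r}" "rel.conn C" and ab: "a \<in> C" "b \<in> C" "r \<rightarrow> a" "r \<rightarrow> b"
  show "a = b"
  proof (rule ccontr)
    assume neq: "a \<noteq> b"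
    obtain p where p: "p \<noteq> []" "distinct p" "successively (dominates G) p" "set p \<subseteq> C" "hd p = a" "last p = b"
      using rel.conn_path[OF C(2) ab(1,2)] by blast
    let ?D = "del_vert v" and ?vs = "r # p @ [r]"
    have "successively (dominates G) ?vs"
      using p(1,3,5,6) ab(3) rel.sym[OF ab(4)] by (simp add: successively_append_iff successively_Cons)
    moreover have "set ?vs \<subseteq> - {v}" using r C(1) p(4) by auto
    then have "successively (dominates ?D) ?vs \<longleftrightarrow> successively (dominates G) ?vs"
      by (intro successively_cong) (auto simp: dominates_del_vert)
    ultimately have "successively (dominates ?D) ?vs" by simp
    moreover have "hd ?vs \<in> verts ?D" using r by (simp add: verts_del_vert)
    ultimately obtain es where "pre_digraph.awalk ?D (hd ?vs) es (last ?vs)" "pre_digraph.awalk_verts ?D (hd ?vs) es = ?vs"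
      using awalk_of_walk[of ?vs ?D] wf_digraph_del_vert by blast
    then have es: "pre_digraph.awalk ?D r es r" "pre_digraph.awalk_verts ?D r es = ?vs" by simp_all
    have "length es = length p + 1"
    proof -
      have "length (pre_digraph.awalk_verts ?D u es) = length es + 1" for u
        by (induction es arbitrary: u) (simp_all add: pre_digraph.awalk_verts.simps)
      from this[of r] show ?thesis using es(2) by simp
    qed
    moreover have "length p \<noteq> 0" "length p \<noteq> 1" using p(1,5,6) neq by (auto simp: length_Suc_conv)
    ultimately have len: "3 \<le> length es" by linarith
    have "r \<notin> set p" using p(4) C(1) by blast
    then have "pre_digraph.cycle ?D es"
      unfolding pre_digraph.cycle_def using es p(2) len by (intro exI[of _ r]) auto
    then show False using assms len unfolding undirected_forest_def by blast
  qed
qed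

end

text \<open>\<open>A\<close> is the branch set of the apex \<open>v\<close>, and every branch set of
  the forest touches it. A tree of height \<open>d\<close> has room for \<open>Suc d\<close> forest
  vertices, so with the apex there are \<open>Suc (Suc d)\<close>.\<close>

lemma (in graph) apex_forest_minor:
  assumes H: "graph H" and v: "v \<in> verts H" "undirected_forest (pre_digraph.del_vert H v)" and "card (verts H) \<le> Suc (Suc d)"
    and t: "rel.apex_tree d R Z A" "Z \<subseteq> verts G" "A \<subseteq> verts G" "Z \<inter> A = {}" "rel.conn A"
  shows "is_minor H G"
proof -
  interpret H: graph H by (rule H)
  let ?X = "verts H - {v}"
  show ?thesis
  proof (cases "?X = {}")
    case True
    then have "verts H = {v}" using v by blast
    moreover have "\<not> x \<rightarrow>\<^bsub>H\<^esub> y" for x y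
      using H.rel.E_V[of x y] H.rel.E_V'[of x y] H.dominates_neq[of x y] calculation by auto
    ultimately show ?thesis using t by (intro is_minorI[of H "\<lambda>_. A"]) (auto simp: disjoint_family_on_def)
  next
    case False
    then obtain r where r: "r \<in> ?X" by blast
    have "card ?X \<le> Suc d" using assms(4) v by simp
    then obtain M where M: "\<forall>x\<in>?X. rel.conn (M x) \<and> M x \<subseteq> Z \<and> rel.adj (M x) A" "disjoint_family_on M ?X"
      "\<forall>x\<in>?X. \<forall>y\<in>?X. x \<rightarrow>\<^bsub>H\<^esub> y \<longrightarrow> x \<noteq> y \<longrightarrow> rel.adj (M x) (M y)"
      using rel.forest_in_apex_tree[OF H.rel.sym_rel_axioms t(1) _ r _ H.undirected_forest_acyclic[OF v(2)]] by auto
    show ?thesis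
    proof (rule is_minorI[of H "M(v := A)"])
      fix x assume "x \<in> verts H"
      then show "(M(v := A)) x \<subseteq> verts G" "rel.conn ((M(v := A)) x)" using M(1) t by auto
    next
      show "disjoint_family_on (M(v := A)) (verts H)"
        unfolding disjoint_family_on_def
      proof (intro ballI impI)
        fix x y assume xy: "x \<in> verts H" "y \<in> verts H" "x \<noteq> y"
        consider "x = v" "y \<in> ?X" | "y = v" "x \<in> ?X" | "x \<in> ?X" "y \<in> ?X" using xy by blast
        then show "(M(v := A)) x \<inter> (M(v := A)) y = {}"
        proof cases
          case 3 then show ?thesis using M(2) xy unfolding disjoint_family_on_def by simp
        qed (use M(1) t(4) xy in fastforce)+
      qed
    next
      fix x y assume E: "x \<rightarrow>\<^bsub>H\<^esub> y"
      then have xy: "x \<in> verts H" "y \<in> verts H" "x \<noteq> y" using H.rel.E_V H.rel.E_V' H.dominates_neq by blast+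
      consider "x = v" "y \<in> ?X" | "y = v" "x \<in> ?X" | "x \<in> ?X" "y \<in> ?X" using xy by blast
      then show "rel.adj ((M(v := A)) x) ((M(v := A)) y)"
      proof cases
        case 1 then show ?thesis using M(1) xy rel.adj_sym by simp
      next
        case 2 then show ?thesis using M(1) xy by simp
      next
        case 3 then show ?thesis using M(3) xy E by simp
      qed
    qed
  qed
qed

section \<open>Outerplanar graphs\<close>

lemma (in graph) outerplanar_noncrossing:
  assumes "outerplanar G"
  shows "\<exists>xs. distinct xs \<and> set xs = verts G \<and> rel.noncrossing xs"
proof -
  obtain p \<gamma> F where pe: "plane_embedding G p \<gamma>" and F: "F \<in> components (- drawing G p \<gamma>)" "\<not> bounded F" "p ` verts G \<subseteq> frontier F"
    using assms unfolding outerplanar_def by blast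
  note emb = pe[unfolded plane_embedding_def]
  note edges = emb[THEN conjunct2, THEN conjunct1, rule_format] and disjoint = emb[THEN conjunct2, THEN conjunct2, rule_format]
  have edge: "{u, v} \<in> undirected_edges G" if "u \<rightarrow> v" for u v using that unfolding undirected_edges_def by blast
  interpret outer_drawing "dominates G" "verts G" p \<gamma> F
  proof
    show "u \<rightarrow> v \<Longrightarrow> v \<rightarrow> u" for u v by (rule rel.sym)
    show "u \<rightarrow> v \<Longrightarrow> u \<in> verts G" for u v by (rule rel.E_V)
    show "u \<rightarrow> v \<Longrightarrow> u \<noteq> v" for u v by (rule dominates_neq)
    show "inj_on p (verts G)" by (rule emb[THEN conjunct1])
    show "Path_Connected.arc (\<gamma> {u, v})" if "u \<rightarrow> v" for u v using edges[OF edge[OF that]] by simp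
    show "{pathstart (\<gamma> {u, v}), pathfinish (\<gamma> {u, v})} = {p u, p v}" if "u \<rightarrow> v" for u v
    proof -
      have "{pathstart (\<gamma> {u, v}), pathfinish (\<gamma> {u, v})} = p ` {u, v}" using edges[OF edge[OF that]] by (elim conjE)
      then show ?thesis by simp
    qed
    show "z \<in> p ` {u, v}" if "u \<rightarrow> v" "x \<rightarrow> y" "{u, v} \<noteq> {x, y}" "z \<in> path_image (\<gamma> {u, v})" "z \<in> path_image (\<gamma> {x, y})" for u v x y z
    proof -
      have "(path_image (\<gamma> {u, v}) - p ` {u, v}) \<inter> path_image (\<gamma> {x, y}) = {}"
        by (rule disjoint[OF edge[OF that(1)] edge[OF that(2)] that(3)])
      then show ?thesis using that(4,5) by blast
    qed
    show "Topological_Spaces.connected F" using F(1) by (rule in_components_connected)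
    show "\<not> bounded F" by (rule F(2))
    have sub: "F \<subseteq> - drawing G p \<gamma>" using F(1) by (rule in_components_subset)
    show "F \<inter> path_image (\<gamma> {u, v}) = {}" if "u \<rightarrow> v" for u v using sub edge[OF that] unfolding drawing_def by blast
    show "v \<in> verts G \<Longrightarrow> p v \<in> frontier F" for v using F(3) by blast
  qed
  have "rel.theta_free" unfolding rel.theta_free_def
    by (intro allI impI notI) (rule no_theta)
  moreover have "rel.chord_free" unfolding rel.chord_free_def
    by (intro allI impI notI) (rule no_crossing_chords)
  ultimately show ?thesis by (rule rel.noncrossing_order) simp
qed

text \<open>The vertices are placed at positions \<open>0..b\<close> of a non-crossing order. An
  edge between the first and the last position is not supplied by
  \<open>noncrossing_in_triang\<close>; it comes from the adjacency of \<open>P\<close> and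
  \<open>Q\<close>.\<close>

lemma (in graph) outerplanar_minor:
  assumes H: "graph H" "outerplanar H" "card (verts H) \<le> Suc (Suc d)"
    and t: "rel.triang (2 * d) P Q X" "rel.conn P" "rel.conn Q" "P \<subseteq> verts G" "Q \<subseteq> verts G" "X \<subseteq> verts G"
      "P \<inter> Q = {}" "X \<inter> P = {}" "X \<inter> Q = {}" "rel.adj P Q"
  shows "is_minor H G"
proof -
  interpret H: graph H by (rule H)
  obtain xs where xs: "distinct xs" "set xs = verts H" "H.rel.noncrossing xs" using H.outerplanar_noncrossing[OF H(2)] by blast
  have len: "length xs \<le> Suc (Suc d)" using H(3) xs distinct_card by metis
  show ?thesis
  proof (cases "length xs \<le> 1")
    case True
    have one: "x = y" if "x \<in> verts H" "y \<in> verts H" for x y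
    proof -
      have "card (verts H) \<le> Suc 0" using True xs(1,2) distinct_card[OF xs(1)] by simp
      then show ?thesis using that card_le_Suc0_iff_eq[of "verts H"] by simp
    qed
    have "\<not> x \<rightarrow>\<^bsub>H\<^esub> y" for x y
      using H.rel.E_V[of x y] H.rel.E_V'[of x y] H.dominates_neq[of x y] one by blast
    then show ?thesis using t one by (intro is_minorI[of H "\<lambda>_. P"]) (auto simp: disjoint_family_on_def)
  next
    case False
    define b where "b = length xs - 1"
    have b: "0 < b" "b \<le> Suc (0 + d)" "length xs = Suc b" using False len unfolding b_def by auto
    define N where "N i j \<longleftrightarrow> i < length xs \<and> j < length xs \<and> xs ! i \<rightarrow>\<^bsub>H\<^esub> xs ! j" for i j
    have nc: False if "i < j" "j < k" "k < l" "N i k" "N j l" for i j k l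
      using H.rel.noncrossingD[OF xs(3) that(1-3)] that(4,5) unfolding N_def by blast
    have "\<exists>\<nu>. (\<forall>i\<in>{0..b}. rel.conn (\<nu> i)) \<and> disjoint_family_on \<nu> {0..b} \<and> P \<subseteq> \<nu> 0 \<and> \<nu> 0 \<subseteq> P \<union> X \<and>
      Q \<subseteq> \<nu> b \<and> \<nu> b \<subseteq> Q \<union> X \<and> (\<forall>i. 0 < i \<longrightarrow> i < b \<longrightarrow> \<nu> i \<subseteq> X) \<and>
      (\<forall>x y. 0 \<le> x \<longrightarrow> x < y \<longrightarrow> y \<le> b \<longrightarrow> N x y \<longrightarrow> (x, y) \<noteq> (0, b) \<longrightarrow> rel.adj (\<nu> x) (\<nu> y))"
      by (rule rel.noncrossing_in_triang[OF _ t(1-3) t(7-9) b(1,2)]) (rule nc)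
    then obtain \<nu> where \<nu>: "\<forall>i\<in>{0..b}. rel.conn (\<nu> i)" "disjoint_family_on \<nu> {0..b}" "P \<subseteq> \<nu> 0" "\<nu> 0 \<subseteq> P \<union> X"
      "Q \<subseteq> \<nu> b" "\<nu> b \<subseteq> Q \<union> X" "\<forall>i. 0 < i \<longrightarrow> i < b \<longrightarrow> \<nu> i \<subseteq> X"
      "\<forall>x y. 0 \<le> x \<longrightarrow> x < y \<longrightarrow> y \<le> b \<longrightarrow> N x y \<longrightarrow> (x, y) \<noteq> (0, b) \<longrightarrow> rel.adj (\<nu> x) (\<nu> y)"
      by (elim exE conjE)
    have "\<forall>x\<in>verts H. \<exists>i. i < length xs \<and> xs ! i = x" using xs(2) in_set_conv_nth[of _ xs] by simp
    from bchoice[OF this] obtain idx where idx: "\<And>x. x \<in> verts H \<Longrightarrow> idx x < length xs \<and> xs ! idx x = x" by blast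
    have idx_b: "idx x \<in> {0..b}" if "x \<in> verts H" for x using idx[OF that] b by simp
    have inj: "idx x \<noteq> idx y" if "x \<in> verts H" "y \<in> verts H" "x \<noteq> y" for x y using idx that by metis
    have up: "rel.adj (\<nu> (idx x)) (\<nu> (idx y))" if xy: "x \<rightarrow>\<^bsub>H\<^esub> y" "idx x < idx y" for x y
    proof (cases "(idx x, idx y) = (0, b)")
      case True
      then show ?thesis using rel.adj_mono[OF t(10) \<nu>(3,5)] by simp
    next
      case False
      have V: "x \<in> verts H" "y \<in> verts H" using H.rel.E_V[OF xy(1)] H.rel.E_V'[OF xy(1)] by simp_all
      have "N (idx x) (idx y)" using idx[OF V(1)] idx[OF V(2)] xy(1) unfolding N_def by simp
      then show ?thesis using \<nu>(8)[rule_format, OF _ xy(2) _ _ False] idx_b[OF V(2)] by simp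
    qed
    show ?thesis
    proof (rule is_minorI[of H "\<lambda>x. \<nu> (idx x)"])
      fix x assume x: "x \<in> verts H"
      then show "rel.conn (\<nu> (idx x))" using \<nu>(1) idx_b by simp
      consider "idx x = 0" | "idx x = b" | "0 < idx x" "idx x < b" using idx_b[OF x] by fastforce
      then show "\<nu> (idx x) \<subseteq> verts G"
      proof cases
        case 1 then show ?thesis using \<nu>(4) t(4,6) by auto
      next
        case 2 then show ?thesis using \<nu>(6) t(5,6) by auto
      next
        case 3 then show ?thesis using \<nu>(7) t(6) by blast
      qed
    next
      show "disjoint_family_on (\<lambda>x. \<nu> (idx x)) (verts H)"
        using \<nu>(2) idx_b inj unfolding disjoint_family_on_def by simp
    next
      fix x y assume E: "x \<rightarrow>\<^bsub>H\<^esub> y"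
      have "x \<in> verts H" "y \<in> verts H" "x \<noteq> y" using H.rel.E_V[OF E] H.rel.E_V'[OF E] H.dominates_neq[OF E] by simp_all
      then have "idx x \<noteq> idx y" by (rule inj)
      then consider "idx x < idx y" | "idx y < idx x" by linarith
      then show "rel.adj (\<nu> (idx x)) (\<nu> (idx y))"
      proof cases
        case 1 then show ?thesis using up[OF E] by simp
      next
        case 2 then show ?thesis using up[OF H.rel.sym[OF E]] rel.adj_sym by simp
      qed
    qed
  qed
qed

theorem theorem6p3:
  fixes H\<^sub>1 :: "('a, 'b) pre_digraph"
    and H\<^sub>2 :: "('c, 'd) pre_digraph"
    and G :: "('e, 'f) pre_digraph"
    and l :: nat
  assumes "graph H\<^sub>1" and "apex_forest H\<^sub>1"
    and "graph H\<^sub>2" and "outerplanar H\<^sub>2"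
    and "l = Max {card (verts H\<^sub>1), card (verts H\<^sub>2), 2} - 1"
    and "graph G" and "two_connected G"
    and "pathwidth G \<ge> 2 ^ (9 * l\<^sup>2 - 3 * l + 2) - 2"
  shows "is_minor H\<^sub>1 G \<or> is_minor H\<^sub>2 G"
proof -
  interpret graph G by (rule assms(6))
  interpret two_conn_graph "dominates G" "verts G" by (rule two_connected_imp(1)[OF assms(7)])
  define d where "d = l - 1"
  have "card (verts H\<^sub>1) \<le> l + 1" "card (verts H\<^sub>2) \<le> l + 1" "1 \<le> l" unfolding assms(5) by auto
  then have l: "l = Suc d" and H: "card (verts H\<^sub>1) \<le> Suc (Suc d)" "card (verts H\<^sub>2) \<le> Suc (Suc d)" unfolding d_def by auto
  \<comment> \<open>In terms of \<open>d\<close> the exponent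
    \<open>9 * l\<^sup>2 - 3 * l + 2\<close> is \<open>h + 1\<close>. A complete binary tree of
    height \<open>h\<close> has \<open>2 ^ (h + 1) - 1\<close> nodes, one more than the bound on the
    pathwidth, in accordance with \<open>tree_model\<close>.\<close>
  define h where "h = 9 * d * d + 15 * d + 7"
  have "9 * l\<^sup>2 - 3 * l + 2 = h + 1" unfolding l h_def by (simp add: power2_eq_square)
  then have pw: "2 ^ (h + 1) - 2 \<le> pathwidth G" using assms(8) by simp
  have "(2::nat) ^ 1 < 2 ^ (h + 1)" by (rule power_strict_increasing) (simp_all add: h_def)
  then have "\<not> rel.good (2 ^ (h + 1) - 2) (verts G)" using not_good_of_pathwidth[OF pw] by simp
  moreover have "8 * d * Suc d + 2 \<le> h" unfolding h_def by simp
  ultimately consider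
      R Z A where "rel.apex_tree d R Z A" "Z \<subseteq> verts G" "A \<subseteq> verts G" "Z \<inter> A = {}" "rel.conn A"
    | P Q X where "rel.triang (2 * d) P Q X" "rel.conn P" "rel.conn Q" "P \<subseteq> verts G" "Q \<subseteq> verts G" "X \<subseteq> verts G"
      "P \<inter> Q = {}" "X \<inter> P = {}" "X \<inter> Q = {}" "rel.adj P Q"
    using apex_tree_or_triang[of h d] two_connected_imp(2)[OF assms(7)] by blast
  then show ?thesis
  proof cases
    case 1
    obtain v where "v \<in> verts H\<^sub>1" "undirected_forest (pre_digraph.del_vert H\<^sub>1 v)" using assms(2) unfolding apex_forest_def by blast
    then show ?thesis using apex_forest_minor[OF assms(1) _ _ H(1) 1] by blast
  next
    case 2
    then show ?thesis using outerplanar_minor[OF assms(3,4) H(2) 2] by blast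
  qed
qed

end
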